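(* Let $\langle\mathcal M,\in^{\mathcal M}\rangle$ be a countable model of G\"odel--Bernays set theory ${\rm GB}$ (presented on domain $\omega$), and suppose $\mathbb{P}\in\mathcal M$ is a class forcing notion whose atomic forcing relation is a class in $\mathcal M$. Then from an oracle for the $\Delta^1_0$-elementary diagram of $\mathcal M$ there is a computable procedure to compute an $\mathcal M$-generic filter $G\subseteq\mathbb{P}$ and the $\Delta^1_0$-diagram of (a presentation of) $\mathcal M[G]$.
   Context: Models of ${\rm GB}$ are two-sorted first-order structures with sets and classes and a membership relation. A class forcing notion is a partial order which is a class of the model; $G\subseteq\mathbb{P}$ is $\mathcal M$-generic if it is a filter meeting every dense subclass of $\mathbb{P}$ belonging to $\mathcal M$. $\mathcal M[G]$ is the extension whose sets and classes are given by interpreting set $\mathbb{P}$-names and class $\mathbb{P}$-names of $\mathcal M$ via $G$ (quotient by forced equality with membership given by the forcing relation, using conditions in $G$). $\Delta^1_0$ formulae are formulae of the two-sorted language with only set quantifiers (no class quantifiers); the $\Delta^1_0$-elementary diagram is the set of such formulae with parameters true in the model. *)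

theory Defs
  imports Main "HOL-Library.Nat_Bijection"
begin

section \<open>Two-sorted structures and their language\<close>

record 'a structure2 =
  Sets :: "'a set"
  Classes :: "'a set"
  Mem :: "'a \<Rightarrow> 'a \<Rightarrow> bool"

definition dom2 :: "'a structure2 \<Rightarrow> 'a set" where
  "dom2 M = Sets M \<union> Classes M"

definition two_sorted :: "'a structure2 \<Rightarrow> bool" where
  "two_sorted M \<longleftrightarrow> Sets M \<inter> Classes M = {} \<and>
     (\<forall>x y. Mem M x y \<longrightarrow> x \<in> Sets M \<and> y \<in> dom2 M)"

definition isomorphic2 :: "'a structure2 \<Rightarrow> 'b structure2 \<Rightarrow> bool" where
  "isomorphic2 M N \<longleftrightarrow>
     (\<exists>f. bij_betw f (dom2 M) (dom2 N) \<and> f ` Sets M = Sets N \<and> f ` Classes M = Classes N \<and>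
        (\<forall>x \<in> dom2 M. \<forall>y \<in> dom2 M. Mem M x y \<longleftrightarrow> Mem N (f x) (f y)))"

text \<open>Variables are de Bruijn indices, counted separately for the two sorts: \<open>ExS\<close> binds set
  variable 0 and \<open>ExC\<close> binds class variable 0. Set variables are interpreted by the list
  \<open>xs\<close> of sets and class variables by the list \<open>ys\<close> of classes.\<close>

datatype fm =
    EqS nat nat
  | EqC nat nat
  | InS nat nat
  | InC nat nat  \<comment> \<open>set variable, class variable\<close>
  | Neg fm
  | And fm fm
  | ExS fm
  | ExC fm

fun sat :: "'a structure2 \<Rightarrow> fm \<Rightarrow> 'a list \<Rightarrow> 'a list \<Rightarrow> bool" where
  "sat M (EqS i j) xs ys \<longleftrightarrow> xs ! i = xs ! j"
| "sat M (EqC i j) xs ys \<longleftrightarrow> ys ! i = ys ! j"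
| "sat M (InS i j) xs ys \<longleftrightarrow> Mem M (xs ! i) (xs ! j)"
| "sat M (InC i j) xs ys \<longleftrightarrow> Mem M (xs ! i) (ys ! j)"
| "sat M (Neg \<phi>) xs ys \<longleftrightarrow> \<not> sat M \<phi> xs ys"
| "sat M (And \<phi> \<psi>) xs ys \<longleftrightarrow> sat M \<phi> xs ys \<and> sat M \<psi> xs ys"
| "sat M (ExS \<phi>) xs ys \<longleftrightarrow> (\<exists>x \<in> Sets M. sat M \<phi> (x # xs) ys)"
| "sat M (ExC \<phi>) xs ys \<longleftrightarrow> (\<exists>y \<in> Classes M. sat M \<phi> xs (y # ys))"

text \<open>\<open>fits \<phi> m n\<close>: the free set variables of \<open>\<phi>\<close> are below \<open>m\<close>, the free class variables
  below \<open>n\<close>.\<close>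

fun fits :: "fm \<Rightarrow> nat \<Rightarrow> nat \<Rightarrow> bool" where
  "fits (EqS i j) m n \<longleftrightarrow> i < m \<and> j < m"
| "fits (EqC i j) m n \<longleftrightarrow> i < n \<and> j < n"
| "fits (InS i j) m n \<longleftrightarrow> i < m \<and> j < m"
| "fits (InC i j) m n \<longleftrightarrow> i < m \<and> j < n"
| "fits (Neg \<phi>) m n \<longleftrightarrow> fits \<phi> m n"
| "fits (And \<phi> \<psi>) m n \<longleftrightarrow> fits \<phi> m n \<and> fits \<psi> m n"
| "fits (ExS \<phi>) m n \<longleftrightarrow> fits \<phi> (Suc m) n"
| "fits (ExC \<phi>) m n \<longleftrightarrow> fits \<phi> m (Suc n)"

fun delta10 :: "fm \<Rightarrow> bool" where
  "delta10 (Neg \<phi>) \<longleftrightarrow> delta10 \<phi>"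
| "delta10 (And \<phi> \<psi>) \<longleftrightarrow> delta10 \<phi> \<and> delta10 \<psi>"
| "delta10 (ExS \<phi>) \<longleftrightarrow> delta10 \<phi>"
| "delta10 (ExC \<phi>) \<longleftrightarrow> False"
| "delta10 _ \<longleftrightarrow> True"


section \<open>Goedel-Bernays set theory\<close>

definition is_upair :: "'a structure2 \<Rightarrow> 'a \<Rightarrow> 'a \<Rightarrow> 'a \<Rightarrow> bool" where
  "is_upair M z x y \<longleftrightarrow> z \<in> Sets M \<and> (\<forall>w \<in> Sets M. Mem M w z \<longleftrightarrow> w = x \<or> w = y)"

definition is_opair :: "'a structure2 \<Rightarrow> 'a \<Rightarrow> 'a \<Rightarrow> 'a \<Rightarrow> bool" where
  "is_opair M z x y \<longleftrightarrow>
     (\<exists>a \<in> Sets M. \<exists>b \<in> Sets M. is_upair M a x x \<and> is_upair M b x y \<and> is_upair M z a b)"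

definition related :: "'a structure2 \<Rightarrow> 'a \<Rightarrow> 'a \<Rightarrow> 'a \<Rightarrow> bool" where
  "related M R x y \<longleftrightarrow> (\<exists>z \<in> Sets M. is_opair M z x y \<and> Mem M z R)"

definition related3 :: "'a structure2 \<Rightarrow> 'a \<Rightarrow> 'a \<Rightarrow> 'a \<Rightarrow> 'a \<Rightarrow> bool" where
  "related3 M R x y z \<longleftrightarrow> (\<exists>u \<in> Sets M. is_opair M u y z \<and> related M R x u)"

definition set_extensionality :: "'a structure2 \<Rightarrow> bool" where
  "set_extensionality M \<longleftrightarrow>
     (\<forall>x \<in> Sets M. \<forall>y \<in> Sets M. (\<forall>z \<in> Sets M. Mem M z x \<longleftrightarrow> Mem M z y) \<longrightarrow> x = y)"

definition class_extensionality :: "'a structure2 \<Rightarrow> bool" where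
  "class_extensionality M \<longleftrightarrow>
     (\<forall>X \<in> Classes M. \<forall>Y \<in> Classes M. (\<forall>z \<in> Sets M. Mem M z X \<longleftrightarrow> Mem M z Y) \<longrightarrow> X = Y)"

definition pairing :: "'a structure2 \<Rightarrow> bool" where
  "pairing M \<longleftrightarrow> (\<forall>x \<in> Sets M. \<forall>y \<in> Sets M. \<exists>z \<in> Sets M. is_upair M z x y)"

definition union :: "'a structure2 \<Rightarrow> bool" where
  "union M \<longleftrightarrow> (\<forall>x \<in> Sets M. \<exists>u \<in> Sets M. \<forall>z \<in> Sets M.
     Mem M z u \<longleftrightarrow> (\<exists>y \<in> Sets M. Mem M y x \<and> Mem M z y))"

definition power_set :: "'a structure2 \<Rightarrow> bool" where
  "power_set M \<longleftrightarrow> (\<forall>x \<in> Sets M. \<exists>u \<in> Sets M. \<forall>y \<in> Sets M.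
     Mem M y u \<longleftrightarrow> (\<forall>z \<in> Sets M. Mem M z y \<longrightarrow> Mem M z x))"

definition infinity :: "'a structure2 \<Rightarrow> bool" where
  "infinity M \<longleftrightarrow> (\<exists>w \<in> Sets M.
     (\<exists>e \<in> Sets M. Mem M e w \<and> (\<forall>z \<in> Sets M. \<not> Mem M z e)) \<and>
     (\<forall>x \<in> Sets M. Mem M x w \<longrightarrow>
        (\<exists>s \<in> Sets M. Mem M s w \<and> (\<forall>z \<in> Sets M. Mem M z s \<longleftrightarrow> Mem M z x \<or> z = x))))"

definition foundation :: "'a structure2 \<Rightarrow> bool" where
  "foundation M \<longleftrightarrow> (\<forall>X \<in> Classes M. (\<exists>x \<in> Sets M. Mem M x X) \<longrightarrow>
     (\<exists>x \<in> Sets M. Mem M x X \<and> (\<forall>y \<in> Sets M. Mem M y x \<longrightarrow> \<not> Mem M y X)))"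

definition class_replacement :: "'a structure2 \<Rightarrow> bool" where
  "class_replacement M \<longleftrightarrow> (\<forall>F \<in> Classes M.
     (\<forall>x \<in> Sets M. \<forall>y \<in> Sets M. \<forall>y' \<in> Sets M. related M F x y \<and> related M F x y' \<longrightarrow> y = y') \<longrightarrow>
     (\<forall>a \<in> Sets M. \<exists>b \<in> Sets M. \<forall>y \<in> Sets M.
        Mem M y b \<longleftrightarrow> (\<exists>x \<in> Sets M. Mem M x a \<and> related M F x y)))"

definition elementary_comprehension :: "'a structure2 \<Rightarrow> bool" where
  "elementary_comprehension M \<longleftrightarrow>
     (\<forall>\<phi> xs ys. delta10 \<phi> \<and> set xs \<subseteq> Sets M \<and> set ys \<subseteq> Classes M \<and>
        fits \<phi> (Suc (length xs)) (length ys) \<longrightarrow>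
        (\<exists>X \<in> Classes M. \<forall>z \<in> Sets M. Mem M z X \<longleftrightarrow> sat M \<phi> (z # xs) ys))"

text \<open>No form of the axiom of choice is included.\<close>

definition GB_model :: "'a structure2 \<Rightarrow> bool" where
  "GB_model M \<longleftrightarrow> two_sorted M \<and>
     set_extensionality M \<and> class_extensionality M \<and> pairing M \<and> union M \<and> power_set M \<and>
     infinity M \<and> foundation M \<and> class_replacement M \<and> elementary_comprehension M"


section \<open>Class forcing\<close>

text \<open>A class forcing notion is given by the class \<open>P\<close> of conditions and the class \<open>L\<close> of
  ordered pairs \<open>(q, p)\<close> with \<open>q\<close> stronger than or equal to \<open>p\<close>.\<close>

definition Cond :: "'a structure2 \<Rightarrow> 'a \<Rightarrow> 'a set" where
  "Cond M P = {p \<in> Sets M. Mem M p P}"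

definition class_forcing_notion :: "'a structure2 \<Rightarrow> 'a \<Rightarrow> 'a \<Rightarrow> bool" where
  "class_forcing_notion M P L \<longleftrightarrow> P \<in> Classes M \<and> L \<in> Classes M \<and> Cond M P \<noteq> {} \<and>
     (\<forall>p \<in> Cond M P. related M L p p) \<and>
     (\<forall>p \<in> Cond M P. \<forall>q \<in> Cond M P. related M L p q \<and> related M L q p \<longrightarrow> p = q) \<and>
     (\<forall>p \<in> Cond M P. \<forall>q \<in> Cond M P. \<forall>r \<in> Cond M P.
        related M L p q \<and> related M L q r \<longrightarrow> related M L p r)"

definition filter_on :: "'a structure2 \<Rightarrow> 'a \<Rightarrow> 'a \<Rightarrow> 'a set \<Rightarrow> bool" where
  "filter_on M P L G \<longleftrightarrow> G \<subseteq> Cond M P \<and> G \<noteq> {} \<and>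
     (\<forall>p \<in> G. \<forall>q \<in> Cond M P. related M L p q \<longrightarrow> q \<in> G) \<and>
     (\<forall>p \<in> G. \<forall>q \<in> G. \<exists>r \<in> G. related M L r p \<and> related M L r q)"

definition dense_subclass :: "'a structure2 \<Rightarrow> 'a \<Rightarrow> 'a \<Rightarrow> 'a \<Rightarrow> bool" where
  "dense_subclass M P L D \<longleftrightarrow> D \<in> Classes M \<and> Cond M D \<subseteq> Cond M P \<and>
     (\<forall>p \<in> Cond M P. \<exists>q \<in> Cond M D. related M L q p)"

definition generic_filter :: "'a structure2 \<Rightarrow> 'a \<Rightarrow> 'a \<Rightarrow> 'a set \<Rightarrow> bool" where
  "generic_filter M P L G \<longleftrightarrow> filter_on M P L G \<and>
     (\<forall>D. dense_subclass M P L D \<longrightarrow> G \<inter> Cond M D \<noteq> {})"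

text \<open>In \<open>M\<close>, a \<open>P\<close>-name is recursively a set of pairs \<open>(\<rho>, p)\<close> with \<open>\<rho>\<close> a \<open>P\<close>-name and
  \<open>p \<in> P\<close>. As \<open>M\<close> may be ill-founded, the recursion has to be unfolded inside \<open>M\<close>: \<open>T\<close> is a set
  of \<open>M\<close> witnessing that \<open>\<sigma>\<close> is hereditarily of this form.\<close>

definition set_name :: "'a structure2 \<Rightarrow> 'a \<Rightarrow> 'a \<Rightarrow> bool" where
  "set_name M P \<sigma> \<longleftrightarrow> \<sigma> \<in> Sets M \<and> (\<exists>T \<in> Sets M. Mem M \<sigma> T \<and>
     (\<forall>\<tau> \<in> Sets M. Mem M \<tau> T \<longrightarrow> (\<forall>z \<in> Sets M. Mem M z \<tau> \<longrightarrow>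
        (\<exists>\<rho> \<in> Sets M. \<exists>p \<in> Cond M P. Mem M \<rho> T \<and> is_opair M z \<rho> p))))"

definition class_name :: "'a structure2 \<Rightarrow> 'a \<Rightarrow> 'a \<Rightarrow> bool" where
  "class_name M P \<Gamma> \<longleftrightarrow> \<Gamma> \<in> Classes M \<and> (\<forall>z \<in> Sets M. Mem M z \<Gamma> \<longrightarrow>
     (\<exists>\<rho>. \<exists>p \<in> Cond M P. set_name M P \<rho> \<and> is_opair M z \<rho> p))"

text \<open>The defining clauses for forcing atomic formulas. The first one says that the conditions
  \<open>r\<close> such that \<open>r \<le> s\<close> and \<open>r\<close> forces \<open>\<sigma> = \<rho>\<close> for some \<open>(\<rho>, s)\<close> in \<open>A\<close> are dense below \<open>p\<close>; \<open>eq\<close>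
  is the relation of forcing an equality of set names. The second one says that \<open>q\<close> forces
  \<open>\<rho> \<in> B\<close> whenever \<open>(\<rho>, s)\<close> is in \<open>A\<close> and \<open>q\<close> is below \<open>p\<close> and \<open>s\<close>; \<open>mem\<close> is the relation of
  forcing a membership. In both, \<open>A\<close> and \<open>B\<close> may be set names or class names.\<close>

definition mem_clause ::
  "'a structure2 \<Rightarrow> 'a \<Rightarrow> 'a \<Rightarrow> ('a \<Rightarrow> 'a \<Rightarrow> 'a \<Rightarrow> bool) \<Rightarrow> 'a \<Rightarrow> 'a \<Rightarrow> 'a \<Rightarrow> bool" where
  "mem_clause M P L eq p \<sigma> A \<longleftrightarrow>
     (\<forall>q \<in> Cond M P. related M L q p \<longrightarrow>
        (\<exists>r \<in> Cond M P. related M L r q \<and>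
           (\<exists>\<rho> \<in> Sets M. \<exists>s \<in> Cond M P. related M A \<rho> s \<and> related M L r s \<and> eq r \<sigma> \<rho>)))"

definition sub_clause ::
  "'a structure2 \<Rightarrow> 'a \<Rightarrow> 'a \<Rightarrow> ('a \<Rightarrow> 'a \<Rightarrow> 'a \<Rightarrow> bool) \<Rightarrow> 'a \<Rightarrow> 'a \<Rightarrow> 'a \<Rightarrow> bool" where
  "sub_clause M P L mem p A B \<longleftrightarrow>
     (\<forall>\<rho> \<in> Sets M. \<forall>s \<in> Cond M P. related M A \<rho> s \<longrightarrow>
        (\<forall>q \<in> Cond M P. related M L q p \<and> related M L q s \<longrightarrow> mem q \<rho> B))"

text \<open>The atomic forcing relation is a class of \<open>M\<close>: the classes \<open>E\<close> and \<open>I\<close> consist of the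
  triples \<open>(p, \<sigma>, \<tau>)\<close> such that \<open>p\<close> forces \<open>\<sigma> = \<tau>\<close>, respectively \<open>\<sigma> \<in> \<tau>\<close>. By foundation in
  \<open>M\<close>, the recursion determines \<open>E\<close> and \<open>I\<close> on conditions and set names.\<close>

definition atomic_forcing_relation :: "'a structure2 \<Rightarrow> 'a \<Rightarrow> 'a \<Rightarrow> 'a \<Rightarrow> 'a \<Rightarrow> bool" where
  "atomic_forcing_relation M P L E I \<longleftrightarrow> E \<in> Classes M \<and> I \<in> Classes M \<and>
     (\<forall>p \<in> Cond M P. \<forall>\<sigma> \<tau>. set_name M P \<sigma> \<and> set_name M P \<tau> \<longrightarrow>
        (related3 M I p \<sigma> \<tau> \<longleftrightarrow> mem_clause M P L (related3 M E) p \<sigma> \<tau>) \<and>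
        (related3 M E p \<sigma> \<tau> \<longleftrightarrow>
           sub_clause M P L (related3 M I) p \<sigma> \<tau> \<and> sub_clause M P L (related3 M I) p \<tau> \<sigma>))"

definition forces_mem_class ::
  "'a structure2 \<Rightarrow> 'a \<Rightarrow> 'a \<Rightarrow> 'a \<Rightarrow> 'a \<Rightarrow> 'a \<Rightarrow> 'a \<Rightarrow> bool" where
  "forces_mem_class M P L E = mem_clause M P L (related3 M E)"

definition forces_eq_class ::
  "'a structure2 \<Rightarrow> 'a \<Rightarrow> 'a \<Rightarrow> 'a \<Rightarrow> 'a \<Rightarrow> 'a \<Rightarrow> 'a \<Rightarrow> bool" where
  "forces_eq_class M P L E p \<Gamma> \<Delta> \<longleftrightarrow>
     sub_clause M P L (forces_mem_class M P L E) p \<Gamma> \<Delta> \<and>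
     sub_clause M P L (forces_mem_class M P L E) p \<Delta> \<Gamma>"

definition forcing_extension ::
  "'a structure2 \<Rightarrow> 'a \<Rightarrow> 'a \<Rightarrow> 'a \<Rightarrow> 'a \<Rightarrow> 'a set \<Rightarrow> 'a set structure2" where
  "forcing_extension M P L E I G =
     (let S = {\<sigma>. set_name M P \<sigma>} // {(\<sigma>, \<tau>). set_name M P \<sigma> \<and> set_name M P \<tau> \<and>
                (\<exists>p \<in> G. related3 M E p \<sigma> \<tau>)};
          C = {\<Gamma>. class_name M P \<Gamma>} // {(\<Gamma>, \<Delta>). class_name M P \<Gamma> \<and> class_name M P \<Delta> \<and>
                (\<exists>p \<in> G. forces_eq_class M P L E p \<Gamma> \<Delta>)}
      in \<lparr>Sets = S, Classes = C,
          Mem = (\<lambda>x y. x \<in> S \<and>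
             (y \<in> S \<and> (\<exists>\<sigma> \<in> x. \<exists>\<tau> \<in> y. \<exists>p \<in> G. related3 M I p \<sigma> \<tau>) \<or>
              y \<in> C \<and> (\<exists>\<sigma> \<in> x. \<exists>\<Gamma> \<in> y. \<exists>p \<in> G. forces_mem_class M P L E p \<sigma> \<Gamma>)))\<rparr>)"


section \<open>Oracle computability\<close>

text \<open>Programs for the partial recursive functions relative to an oracle; \<open>Query\<close> is the
  characteristic function of the oracle, and \<open>run A e xs y\<close> says that \<open>e\<close> with oracle \<open>A\<close> halts
  on input \<open>xs\<close> with output \<open>y\<close>.\<close>

datatype prog =
    Zero
  | Succ
  | Proj nat
  | Query
  | Comp prog "prog list"
  | PrimRec prog prog
  | Mu prog

inductive run :: "nat set \<Rightarrow> prog \<Rightarrow> nat list \<Rightarrow> nat \<Rightarrow> bool" for A :: "nat set" where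
  Zero: "run A Zero xs 0"
| Succ: "run A Succ [x] (Suc x)"
| Proj: "i < length xs \<Longrightarrow> run A (Proj i) xs (xs ! i)"
| Query: "run A Query [x] (if x \<in> A then 1 else 0)"
| Comp: "list_all2 (\<lambda>g y. run A g xs y) gs ys \<Longrightarrow> run A f ys z \<Longrightarrow> run A (Comp f gs) xs z"
| PrimRec_0: "run A f xs y \<Longrightarrow> run A (PrimRec f g) (0 # xs) y"
| PrimRec_Suc: "run A (PrimRec f g) (n # xs) y \<Longrightarrow> run A g (n # y # xs) z \<Longrightarrow>
    run A (PrimRec f g) (Suc n # xs) z"
| Mu: "run A f (n # xs) 0 \<Longrightarrow> (\<And>m. m < n \<Longrightarrow> \<exists>y. run A f (m # xs) (Suc y)) \<Longrightarrow>
    run A (Mu f) xs n"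

definition decides :: "nat set \<Rightarrow> prog \<Rightarrow> nat set \<Rightarrow> bool" where
  "decides A e B \<longleftrightarrow> (\<forall>n. run A e [n] (if n \<in> B then 1 else 0))"

inductive_cases run_elims:
  "run A Zero xs z" "run A Succ xs z" "run A (Proj i) xs z" "run A Query xs z"
  "run A (Comp f gs) xs z" "run A (PrimRec f g) (0 # xs) z"
  "run A (PrimRec f g) (Suc n # xs) z" "run A (Mu f) xs z"

lemma run_deterministic: "run A e xs y \<Longrightarrow> run A e xs z \<Longrightarrow> z = y"
proof (induction arbitrary: z rule: run.induct)
  case (Comp xs gs ys f y)
  from Comp.prems obtain ys' where ys': "list_all2 (\<lambda>g y. run A g xs y) gs ys'" "run A f ys' z"
    by (rule run_elims(5))
  have "ys' = ys"
    using Comp.IH(1) ys'(1) unfolding list_all2_conv_all_nth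
    by (intro nth_equalityI) simp_all
  then show ?case using Comp.IH(2) ys'(2) by blast
next
  case (PrimRec_0 f xs y g)
  from PrimRec_0.prems have "run A f xs z" by (rule run_elims(6))
  then show ?case by (rule PrimRec_0.IH)
next
  case (PrimRec_Suc f g n xs y z')
  from PrimRec_Suc.prems obtain w where w: "run A (PrimRec f g) (n # xs) w" "run A g (n # w # xs) z"
    by (rule run_elims(7))
  have "w = y" using w(1) by (rule PrimRec_Suc.IH(1))
  with w(2) show ?case by (intro PrimRec_Suc.IH(2)) simp
next
  case (Mu f n xs)
  from Mu.prems have z: "run A f (z # xs) 0" "\<And>m. m < z \<Longrightarrow> \<exists>y. run A f (m # xs) (Suc y)"
    by (auto elim: run_elims(8))
  have "\<not> z < n"
  proof
    assume "z < n"
    then obtain y where "\<forall>w. run A f (z # xs) w \<longrightarrow> w = Suc y" using Mu.IH(2) by blast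
    with z(1) show False by blast
  qed
  moreover have "\<not> n < z"
  proof
    assume "n < z"
    then obtain y where "run A f (n # xs) (Suc y)" using z(2) by blast
    then show False using Mu.IH(1) by blast
  qed
  ultimately show ?case by simp
qed (auto elim: run_elims(1-4))


section \<open>Diagrams\<close>

fun fm_code :: "fm \<Rightarrow> nat" where
  "fm_code (EqS i j) = prod_encode (0, prod_encode (i, j))"
| "fm_code (EqC i j) = prod_encode (1, prod_encode (i, j))"
| "fm_code (InS i j) = prod_encode (2, prod_encode (i, j))"
| "fm_code (InC i j) = prod_encode (3, prod_encode (i, j))"
| "fm_code (Neg \<phi>) = prod_encode (4, fm_code \<phi>)"
| "fm_code (And \<phi> \<psi>) = prod_encode (5, prod_encode (fm_code \<phi>, fm_code \<psi>))"
| "fm_code (ExS \<phi>) = prod_encode (6, fm_code \<phi>)"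
| "fm_code (ExC \<phi>) = prod_encode (7, fm_code \<phi>)"

definition delta10_diagram :: "nat structure2 \<Rightarrow> nat set" where
  "delta10_diagram M =
     {prod_encode (fm_code \<phi>, prod_encode (list_encode xs, list_encode ys)) | \<phi> xs ys.
        delta10 \<phi> \<and> set xs \<subseteq> Sets M \<and> set ys \<subseteq> Classes M \<and>
        fits \<phi> (length xs) (length ys) \<and> sat M \<phi> xs ys}"

definition on_omega :: "nat structure2 \<Rightarrow> bool" where
  "on_omega M \<longleftrightarrow> two_sorted M \<and> dom2 M = UNIV"

end

theory Submission
  imports Defs "HOL-Library.Infinite_Set"
begin

text \<open>Enumerate the classes, which are natural numbers, and build a descending sequence of conditions
  whose step \<open>D\<close> enters \<open>D\<close> if \<open>D\<close> is dense; density is \<open>\<Delta>\<^sup>1\<^sub>0\<close>, so the oracle decides it. The filter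
  \<open>G\<close> generated by the sequence is generic, and for every downward closed class \<open>K\<close> of conditions it
  is decidable whether \<open>G\<close> meets \<open>K\<close>: wait until the sequence enters \<open>K\<close> or reaches a condition with
  no extension in \<open>K\<close>. Everything else is reduced to this. Forced equality of names is such a class,
  hence least representatives of names give a presentation of the extension on \<open>\<omega>\<close>. For a
  \<open>\<Delta>\<^sup>1\<^sub>0\<close> formula \<open>\<phi>\<close> with fixed class names, the pairs of a condition and a tuple of set names such
  that the condition forces \<open>\<phi>\<close> of the tuple form a class. Instead of translating \<open>\<phi>\<close>
  syntactically, one searches for the number of this class by recursion on \<open>\<phi>\<close>: what relates it to
  the classes of the subformulas is one of finitely many fixed \<open>\<Delta>\<^sup>1\<^sub>0\<close> conditions.\<close>

section \<open>Relative computability\<close>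

text \<open>Class forcing need not preserve \<open>GB\<close>, so no axiom is available in the
  extension. Truth is analysed directly on the quotient of names, and the presentation, whose domain
  must be all of \<omega>, requires a separate proof that the extension is infinite; iterated
  singletons of the empty name supply it. The model may be ill-founded. Inductions on names
  therefore run inside it, by foundation applied to a class, and each property proved in this way
  must first be shown definable with set quantifiers only. Formulas are genuine finite objects, so
  forcing itself is defined by ordinary recursion on them. Definability of forcing for each single
  formula would not suffice: the procedure has to be uniform in the code. Formulas have arbitrarily
  many set variables, so an assignment is packed into one set of the model by iterated ordered
  pairs; every formula then yields a class of pairs, whatever its number of variables. Only total
  functions are composed, so each unbounded search carries a guard that makes it halt on senseless
  input.\<close>

definition pfst :: "nat \<Rightarrow> nat" where "pfst z = fst (prod_decode z)"
definition psnd :: "nat \<Rightarrow> nat" where "psnd z = snd (prod_decode z)"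

lemma pfst_encode [simp]: "pfst (prod_encode (a, b)) = a"
  and psnd_encode [simp]: "psnd (prod_encode (a, b)) = b"
  and encode_pfst_psnd [simp]: "prod_encode (pfst z, psnd z) = z"
  by (simp_all add: pfst_def psnd_def)

text \<open>Makes recursion on formula codes terminate, since compound formulas have a positive tag.
  A pair (a, b) is coded by \<open>triangle (a + b) + a\<close>, and
  \<open>k \<le> triangle k\<close> bounds the sum of the components by the code.\<close>

lemma psnd_less: "0 < pfst c \<Longrightarrow> psnd c < c"
proof -
  have "k \<le> triangle k" for k by (induction k) auto
  from this[of "pfst c + psnd c"] have "psnd c + pfst c \<le> prod_encode (pfst c, psnd c)"
    unfolding prod_encode_def by simp
  then show "0 < pfst c \<Longrightarrow> psnd c < c" unfolding encode_pfst_psnd by linarith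
qed

lemma pfst_le: "pfst c \<le> c" and psnd_le: "psnd c \<le> c"
  using le_prod_encode_1[of "pfst c" "psnd c"] le_prod_encode_2[of "psnd c" "pfst c"] by simp_all

text \<open>Functions are unary, and several arguments travel as one paired number; closure rules
  then need no arities and apply by resolution.\<close>

definition computable :: "nat set \<Rightarrow> (nat \<Rightarrow> nat) \<Rightarrow> bool" where
  "computable A f \<longleftrightarrow> (\<exists>e. \<forall>x. run A e [x] (f x))"

definition decidable :: "nat set \<Rightarrow> (nat \<Rightarrow> bool) \<Rightarrow> bool" where
  "decidable A P \<longleftrightarrow> computable A (\<lambda>x. of_bool (P x))"

lemma run_Comp1: "run A g xs y \<Longrightarrow> run A f [y] z \<Longrightarrow> run A (Comp f [g]) xs z"
  by (rule run.Comp[where ys = "[y]"]) simp_all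

lemma run_Comp2:
  "run A g xs y \<Longrightarrow> run A g' xs y' \<Longrightarrow> run A f [y, y'] z \<Longrightarrow> run A (Comp f [g, g']) xs z"
  by (rule run.Comp[where ys = "[y, y']"]) simp_all

lemma run_Proj: "i < length xs \<Longrightarrow> y = xs ! i \<Longrightarrow> run A (Proj i) xs y"
  using run.Proj by simp

lemma run_PrimRec:
  assumes "run A f xs (r 0)" and "\<And>n. run A g (n # r n # xs) (r (Suc n))"
  shows "run A (PrimRec f g) (n # xs) (r n)"
proof (induction n)
  case 0
  show ?case by (rule run.PrimRec_0) (rule assms(1))
next
  case (Suc n)
  show ?case by (rule run.PrimRec_Suc[OF Suc]) (rule assms(2))
qed

text \<open>Totality of \<open>f\<close> supplies what the rule \<open>Mu\<close> asks for: a
  positive value at each argument before the first zero.\<close>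

lemma run_Mu:
  assumes "\<And>y. run A e (y # xs) (f y)" and "\<exists>y. f y = 0"
  shows "run A (Mu e) xs (LEAST y. f y = 0)"
proof (rule run.Mu)
  show "run A e ((LEAST y. f y = 0) # xs) 0"
    using assms(1)[of "LEAST y. f y = 0"] LeastI_ex[OF assms(2)] by simp
  fix m assume "m < (LEAST y. f y = 0)"
  then have "f m \<noteq> 0" by (rule not_less_Least)
  then show "\<exists>y. run A e (m # xs) (Suc y)"
    using assms(1)[of m] by (metis not0_implies_Suc)
qed

section \<open>Programs for arithmetic and pairing\<close>

definition add_prog :: prog where
  "add_prog = PrimRec (Proj 0) (Comp Succ [Proj 1])"

lemma run_add: "run A add_prog [m, n] (m + n)"
  unfolding add_prog_def
  by (rule run_PrimRec[where r = "\<lambda>m. m + n"])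
    (auto intro!: run_Comp1 run_Proj run.Succ simp del: One_nat_def)

definition pred_prog :: prog where "pred_prog = PrimRec Zero (Proj 0)"

lemma run_pred: "run A pred_prog [n] (n - 1)"
  unfolding pred_prog_def
  by (rule run_PrimRec[where r = "\<lambda>n. n - 1"]) (auto intro!: run_Proj run.Zero)

definition sub_prog :: prog where "sub_prog = PrimRec (Proj 0) (Comp pred_prog [Proj 1])"

lemma run_sub: "run A sub_prog [m, n] (n - m)"
  unfolding sub_prog_def
proof (rule run_PrimRec[where r = "\<lambda>m. n - m"])
  fix k
  have "run A (Comp pred_prog [Proj 1]) [k, n - k, n] ((n - k) - 1)"
    by (rule run_Comp1[OF run_Proj run_pred]) auto
  then show "run A (Comp pred_prog [Proj 1]) [k, n - k, n] (n - Suc k)" by simp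
qed (auto intro: run_Proj)

definition triangle_prog :: prog where
  "triangle_prog = PrimRec Zero (Comp Succ [Comp add_prog [Proj 0, Proj 1]])"

lemma run_triangle: "run A triangle_prog [n] (triangle n)"
  unfolding triangle_prog_def
proof (rule run_PrimRec[where r = triangle])
  fix n
  have "run A (Comp Succ [Comp add_prog [Proj 0, Proj 1]]) [n, triangle n] (Suc (n + triangle n))"
    by (intro run_Comp1[OF run_Comp2[OF _ _ run_add] run.Succ] run_Proj) auto
  then show "run A (Comp Succ [Comp add_prog [Proj 0, Proj 1]]) [n, triangle n] (triangle (Suc n))"
    by (simp add: add.commute)
qed (auto intro: run.Zero)

definition pair_prog :: prog where
  "pair_prog = Comp add_prog [Comp triangle_prog [add_prog], Proj 0]"

lemma run_pair: "run A pair_prog [m, n] (prod_encode (m, n))"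
  unfolding pair_prog_def prod_encode_def prod.case
  by (intro run_Comp2[OF run_Comp1[OF run_add run_triangle] run_Proj run_add]) auto

lemma computable_comp: "computable A f \<Longrightarrow> computable A g \<Longrightarrow> computable A (\<lambda>x. f (g x))"
  unfolding computable_def by (meson run_Comp1)

lemma computable_binary:
  "(\<And>x y. run A e [x, y] (h x y)) \<Longrightarrow> computable A f \<Longrightarrow> computable A g \<Longrightarrow>
    computable A (\<lambda>x. h (f x) (g x))"
  unfolding computable_def by (meson run_Comp2)

lemma computable_id: "computable A (\<lambda>x. x)"
  unfolding computable_def by (auto intro!: exI[of _ "Proj 0"] run_Proj)

lemma computable_Suc: "computable A f \<Longrightarrow> computable A (\<lambda>x. Suc (f x))"
  by (rule computable_comp[where f = Suc]) (auto simp: computable_def intro: run.Succ)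

lemma computable_const: "computable A (\<lambda>x. c)"
proof (induction c)
  case 0
  show ?case unfolding computable_def by (auto intro: run.Zero)
qed (rule computable_Suc)

lemma computable_add: "computable A f \<Longrightarrow> computable A g \<Longrightarrow> computable A (\<lambda>x. f x + g x)"
  by (rule computable_binary[OF run_add])

lemma computable_diff: "computable A f \<Longrightarrow> computable A g \<Longrightarrow> computable A (\<lambda>x. f x - g x)"
  by (rule computable_binary[OF run_sub])

lemma computable_pair:
  "computable A f \<Longrightarrow> computable A g \<Longrightarrow> computable A (\<lambda>x. prod_encode (f x, g x))"
  by (rule computable_binary[OF run_pair])

lemma triangle_mono: "m \<le> n \<Longrightarrow> triangle m \<le> triangle n"
  by (induction n) (auto simp: le_Suc_eq)

text \<open>The truncated difference vanishes exactly when \<open>z < triangle (Suc s)\<close>. A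
  code \<open>z\<close> lies on the diagonal \<open>s\<close> with
  \<open>triangle s \<le> z < triangle (Suc s)\<close>, so unpairing is a search for the diagonal
  followed by subtractions.\<close>

lemma pairing_diagonal: "(LEAST s. Suc z - triangle (Suc s) = 0) = pfst z + psnd z"
proof (rule Least_equality)
  have z: "triangle (pfst z + psnd z) + pfst z = z"
    using encode_pfst_psnd[of z] by (simp add: prod_encode_def)
  then show "Suc z - triangle (Suc (pfst z + psnd z)) = 0" by simp
  fix s assume s: "Suc z - triangle (Suc s) = 0"
  show "pfst z + psnd z \<le> s"
  proof (rule ccontr)
    assume "\<not> ?thesis"
    then have "triangle (Suc s) \<le> triangle (pfst z + psnd z)" by (intro triangle_mono) simp
    with s z show False by linarith
  qed
qed

lemma computable_triangle: "computable A triangle"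
  unfolding computable_def using run_triangle by blast

lemma computable_pairing_diagonal: "computable A (\<lambda>z. pfst z + psnd z)"
proof -
  let ?e = "Comp sub_prog [Comp triangle_prog [Comp Succ [Proj 0]], Comp Succ [Proj 1]]"
  have "run A (Mu ?e) [z] (LEAST s. Suc z - triangle (Suc s) = 0)" for z
  proof (rule run_Mu)
    show "run A ?e [y, z] (Suc z - triangle (Suc y))" for y
      by (intro run_Comp2[OF run_Comp1[OF run_Comp1[OF run_Proj run.Succ] run_triangle]
            run_Comp1[OF run_Proj run.Succ] run_sub]) auto
    have "Suc z \<le> triangle (Suc z)" by simp
    then show "\<exists>s. Suc z - triangle (Suc s) = 0" by (intro exI[of _ z]) linarith
  qed
  then show ?thesis unfolding computable_def pairing_diagonal by blast
qed

lemma computable_pfst_self: "computable A pfst"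
proof -
  have "z - triangle (pfst z + psnd z) = pfst z" for z
    using encode_pfst_psnd[of z] unfolding prod_encode_def prod.case by linarith
  moreover have "computable A (\<lambda>z. z - triangle (pfst z + psnd z))"
    by (intro computable_diff computable_id computable_comp[OF computable_triangle]
        computable_pairing_diagonal)
  ultimately show ?thesis by simp
qed

lemma computable_pfst: "computable A f \<Longrightarrow> computable A (\<lambda>x. pfst (f x))"
  by (rule computable_comp[OF computable_pfst_self])

lemma computable_psnd: "computable A f \<Longrightarrow> computable A (\<lambda>x. psnd (f x))"
proof (rule computable_comp[where f = psnd])
  have "computable A (\<lambda>z. (pfst z + psnd z) - pfst z)"
    by (intro computable_diff computable_pairing_diagonal computable_pfst_self)
  then show "computable A psnd" by simp
qed

lemma computable_psnd_self: "computable A psnd"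
  by (rule computable_psnd[OF computable_id])

lemma computable_comp2:
  assumes "computable A (\<lambda>z. h (pfst z) (psnd z))" "computable A f" "computable A g"
  shows "computable A (\<lambda>x. h (f x) (g x))"
  using computable_comp[OF assms(1) computable_pair[OF assms(2,3)]] by simp

lemma computable_comp3:
  assumes "computable A (\<lambda>z. h (pfst z) (pfst (psnd z)) (psnd (psnd z)))"
    and "computable A f" "computable A g" "computable A k"
  shows "computable A (\<lambda>x. h (f x) (g x) (k x))"
  using computable_comp[OF assms(1) computable_pair[OF assms(2) computable_pair[OF assms(3,4)]]]
  by simp

lemma computable_rec_nat:
  assumes "computable A a" "computable A k"
    and "computable A (\<lambda>z. h (pfst z) (pfst (psnd z)) (psnd (psnd z)))"
  shows "computable A (\<lambda>x. rec_nat (a x) (\<lambda>n r. h n r x) (k x))"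
proof -
  obtain ea eh ek where e: "\<And>x. run A ea [x] (a x)" "\<And>x. run A ek [x] (k x)"
    "\<And>z. run A eh [z] (h (pfst z) (pfst (psnd z)) (psnd (psnd z)))"
    using assms unfolding computable_def by blast
  let ?g = "Comp eh [Comp pair_prog [Proj 0, Comp pair_prog [Proj 1, Proj 2]]]"
  have g: "run A ?g [n, r, x] (h n r x)" for n r x
    using e(3)[of "prod_encode (n, prod_encode (r, x))"]
    by (intro run_Comp1[OF run_Comp2[OF run_Proj run_Comp2[OF run_Proj run_Proj run_pair] run_pair]])
      auto
  have "run A (PrimRec ea ?g) [n, x] (rec_nat (a x) (\<lambda>n r. h n r x) n)" for n x
    by (rule run_PrimRec[where r = "rec_nat (a x) (\<lambda>n r. h n r x)"])
      (simp_all only: old.nat.simps e(1) g)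
  then have "run A (Comp (PrimRec ea ?g) [ek, Proj 0]) [x] (rec_nat (a x) (\<lambda>n r. h n r x) (k x))" for x
    by (intro run_Comp2[OF e(2) run_Proj]) auto
  then show ?thesis unfolding computable_def by blast
qed

lemma computable_oracle: "computable A f \<Longrightarrow> decidable A (\<lambda>x. f x \<in> A)"
  unfolding decidable_def
proof (rule computable_comp[where f = "\<lambda>x. of_bool (x \<in> A)"])
  show "computable A (\<lambda>x. of_bool (x \<in> A))"
    unfolding computable_def of_bool_def using run.Query by blast
qed

lemma computable_Least0:
  assumes "computable A (\<lambda>z. f (pfst z) (psnd z))" "\<And>x. \<exists>y. f y x = 0"
  shows "computable A (\<lambda>x. LEAST y. f y x = 0)"
proof -
  obtain e where e: "\<And>z. run A e [z] (f (pfst z) (psnd z))"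
    using assms(1) unfolding computable_def by blast
  have "run A (Mu (Comp e [Comp pair_prog [Proj 0, Proj 1]])) [x] (LEAST y. f y x = 0)" for x
  proof (rule run_Mu)
    show "run A (Comp e [Comp pair_prog [Proj 0, Proj 1]]) [y, x] (f y x)" for y
      using e[of "prod_encode (y, x)"]
      by (intro run_Comp1[OF run_Comp2[OF run_Proj run_Proj run_pair]]) auto
  qed (rule assms(2))
  then show ?thesis unfolding computable_def by blast
qed

section \<open>Decidable predicates and search\<close>

lemma decidable_eq_0: "computable A f \<Longrightarrow> decidable A (\<lambda>x. f x = 0)"
proof -
  assume "computable A f"
  then have "computable A (\<lambda>x. 1 - f x)" by (intro computable_diff computable_const)
  moreover have "1 - f x = of_bool (f x = 0)" for x by (cases "f x") auto
  ultimately show ?thesis unfolding decidable_def by simp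
qed

lemma decidable_Not: "decidable A P \<Longrightarrow> decidable A (\<lambda>x. \<not> P x)"
  using decidable_eq_0[of A "\<lambda>x. of_bool (P x)"] by (simp add: decidable_def)

lemma decidable_le: "computable A f \<Longrightarrow> computable A g \<Longrightarrow> decidable A (\<lambda>x. f x \<le> g x)"
  using decidable_eq_0[of A "\<lambda>x. f x - g x"] by (simp add: computable_diff)

lemma decidable_conj: "decidable A P \<Longrightarrow> decidable A Q \<Longrightarrow> decidable A (\<lambda>x. P x \<and> Q x)"
proof -
  assume "decidable A P" "decidable A Q"
  then have "decidable A (\<lambda>x. (1 - of_bool (P x)) + (1 - of_bool (Q x)) = (0 :: nat))"
    by (intro decidable_eq_0 computable_add computable_diff computable_const)
      (simp_all add: decidable_def)
  moreover have "(1 - of_bool (P x)) + (1 - of_bool (Q x)) = (0 :: nat) \<longleftrightarrow> P x \<and> Q x" for x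
    by (cases "P x"; cases "Q x") auto
  ultimately show ?thesis by (simp only:)
qed

lemma decidable_disj: "decidable A P \<Longrightarrow> decidable A Q \<Longrightarrow> decidable A (\<lambda>x. P x \<or> Q x)"
  using decidable_Not[OF decidable_conj[OF decidable_Not[of A P] decidable_Not[of A Q]]] by simp

lemma decidable_imp: "decidable A P \<Longrightarrow> decidable A Q \<Longrightarrow> decidable A (\<lambda>x. P x \<longrightarrow> Q x)"
  unfolding imp_conv_disj by (intro decidable_disj decidable_Not)

lemma decidable_const: "decidable A (\<lambda>x. b)"
  unfolding decidable_def by (rule computable_const)

lemma decidable_eq: "computable A f \<Longrightarrow> computable A g \<Longrightarrow> decidable A (\<lambda>x. f x = g x)"
  unfolding order.eq_iff by (intro decidable_conj decidable_le)

lemma decidable_less: "computable A f \<Longrightarrow> computable A g \<Longrightarrow> decidable A (\<lambda>x. f x < g x)"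
  unfolding not_le[symmetric] by (intro decidable_Not decidable_le)

lemma decidable_comp: "decidable A P \<Longrightarrow> computable A f \<Longrightarrow> decidable A (\<lambda>x. P (f x))"
  unfolding decidable_def by (rule computable_comp)

lemma computable_Least:
  assumes "decidable A (\<lambda>z. P (pfst z) (psnd z))" "\<And>x. \<exists>y. P y x"
  shows "computable A (\<lambda>x. LEAST y. P y x)"
proof -
  have "computable A (\<lambda>x. LEAST y. of_bool (\<not> P y x) = (0 :: nat))"
    using decidable_Not[OF assms(1)] assms(2)
    by (intro computable_Least0) (simp_all add: decidable_def)
  then show ?thesis by simp
qed

text \<open>A case distinction is a search for the unique number satisfying a decidable
  condition.\<close>

lemma computable_If:
  assumes "decidable A P" "computable A f" "computable A g"
  shows "computable A (\<lambda>x. if P x then f x else g x)"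
proof -
  have "computable A (\<lambda>x. LEAST y. if P x then y = f x else y = g x)"
  proof (rule computable_Least)
    have "decidable A (\<lambda>z. (P (psnd z) \<and> pfst z = f (psnd z)) \<or> (\<not> P (psnd z) \<and> pfst z = g (psnd z)))"
      by (intro decidable_disj decidable_conj decidable_Not decidable_eq decidable_comp[OF assms(1)]
          computable_comp[OF assms(2)] computable_comp[OF assms(3)]
          computable_pfst computable_psnd computable_id)
    then show "decidable A (\<lambda>z. if P (psnd z) then pfst z = f (psnd z) else pfst z = g (psnd z))"
      by (rule back_subst[of "decidable A"]) auto
  qed auto
  moreover have "(LEAST y. if P x then y = f x else y = g x) = (if P x then f x else g x)" for x
    by (auto intro: Least_equality)
  ultimately show ?thesis by simp
qed

text \<open>The search for a counterexample is stopped at the bound; the quantified statement holds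
  iff the bound itself is the first hit.\<close>

lemma decidable_ball:
  assumes "decidable A (\<lambda>z. P (pfst z) (psnd z))" "computable A k"
  shows "decidable A (\<lambda>x. \<forall>y<k x. P y x)"
proof -
  have "decidable A (\<lambda>x. (LEAST y. \<not> P y x \<or> y = k x) = k x)"
    by (intro decidable_eq computable_Least assms(2) decidable_disj decidable_Not assms(1)
        computable_comp[OF assms(2)] computable_pfst computable_psnd computable_id) auto
  moreover have "(LEAST y. \<not> P y x \<or> y = k x) = k x \<longleftrightarrow> (\<forall>y<k x. P y x)" for x
  proof
    assume "(LEAST y. \<not> P y x \<or> y = k x) = k x"
    then show "\<forall>y<k x. P y x" using not_less_Least[of _ "\<lambda>y. \<not> P y x \<or> y = k x"] by auto
  next
    assume "\<forall>y<k x. P y x"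
    then show "(LEAST y. \<not> P y x \<or> y = k x) = k x"
      by (intro Least_equality) (auto simp: not_less[symmetric])
  qed
  ultimately show ?thesis by simp
qed

lemmas computable_intros =
  computable_id computable_const computable_Suc computable_add computable_diff
  computable_pair computable_pfst computable_psnd computable_If
  decidable_const decidable_Not decidable_conj decidable_disj decidable_imp
  decidable_eq decidable_le decidable_less

section \<open>Coded lists and course-of-values recursion\<close>

definition code_nth :: "nat \<Rightarrow> nat \<Rightarrow> nat" where
  "code_nth c i = pfst (rec_nat c (\<lambda>n r. psnd (r - 1)) i - 1)"

definition code_length :: "nat \<Rightarrow> nat" where
  "code_length c = (LEAST i. rec_nat c (\<lambda>n r. psnd (r - 1)) i = 0)"

lemma psnd_0 [simp]: "psnd 0 = 0"
proof -
  have "prod_encode (0, 0) = 0" unfolding prod_encode_def by simp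
  then show ?thesis by (metis psnd_encode)
qed

lemma psnd_list_encode: "psnd (list_encode zs - 1) = list_encode (tl zs)"
  by (cases zs) simp_all

text \<open>A nonempty list is coded by the successor of the pair of its head and the code of its
  tail, so \<open>psnd (r - 1)\<close> removes the head. The empty list, coded by 0, is a fixed
  point because \<open>psnd 0 = 0\<close>.\<close>

lemma code_drop: "rec_nat (list_encode xs) (\<lambda>n r. psnd (r - 1)) i = list_encode (drop i xs)"
proof (induction i)
  case (Suc i)
  then show ?case by (simp only: old.nat.simps psnd_list_encode tl_drop drop_Suc)
qed (simp only: old.nat.simps drop_0)

lemma list_encode_eq_0 [simp]: "list_encode xs = 0 \<longleftrightarrow> xs = []"
  by (cases xs) auto

lemma code_nth [simp]:
  assumes "i < length xs"
  shows "code_nth (list_encode xs) i = xs ! i"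
proof -
  have "drop i xs = xs ! i # drop (Suc i) xs" by (rule Cons_nth_drop_Suc[OF assms, symmetric])
  then show ?thesis
    unfolding code_nth_def code_drop by (simp only: list_encode.simps diff_Suc_1 pfst_encode)
qed

lemma code_length [simp]: "code_length (list_encode xs) = length xs"
  unfolding code_length_def code_drop list_encode_eq_0 drop_eq_Nil
  by (rule Least_equality) simp_all

lemma computable_code_drop:
  "computable A f \<Longrightarrow> computable A g \<Longrightarrow>
    computable A (\<lambda>x. rec_nat (f x) (\<lambda>n r. psnd (r - 1)) (g x))"
  by (intro computable_rec_nat[where h = "\<lambda>n r x. psnd (r - 1)"] computable_intros)

lemma computable_code_nth:
  "computable A f \<Longrightarrow> computable A g \<Longrightarrow> computable A (\<lambda>x. code_nth (f x) (g x))"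
  unfolding code_nth_def by (intro computable_code_drop computable_intros)

lemma computable_code_length: "computable A f \<Longrightarrow> computable A (\<lambda>x. code_length (f x))"
proof (rule computable_comp[where f = code_length])
  show "computable A code_length"
    unfolding code_length_def
  proof (intro computable_Least decidable_eq computable_code_drop computable_intros)
    fix c
    show "\<exists>i. rec_nat c (\<lambda>n r. psnd (r - 1)) i = 0"
      using code_drop[of "list_decode c" "length (list_decode c)"] by auto
  qed
qed

text \<open>For the dummy parameter lists with which \<open>well_formed\<close> queries the
  oracle.\<close>

lemma computable_code_replicate:
  "computable A f \<Longrightarrow> computable A (\<lambda>x. list_encode (replicate (f x) a))"
proof -
  have "list_encode (replicate n a) = rec_nat 0 (\<lambda>n r. Suc (prod_encode (a, r))) n" for n
    by (induction n) auto
  moreover assume "computable A f"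
  then have "computable A (\<lambda>x. rec_nat 0 (\<lambda>n r. Suc (prod_encode (a, r))) (f x))"
    by (intro computable_rec_nat[where h = "\<lambda>n r x. Suc (prod_encode (a, r))"] computable_intros)
  ultimately show ?thesis by simp
qed

text \<open>The values are stored in reverse, so that passing from \<open>n\<close> to
  \<open>Suc n\<close> is a single cons. The value at \<open>i\<close> is therefore found at
  position \<open>n - Suc i\<close>.\<close>

definition history :: "(nat \<Rightarrow> nat) \<Rightarrow> nat \<Rightarrow> nat" where
  "history f n = list_encode (rev (map f [0..<n]))"

lemma history_nth: "i < n \<Longrightarrow> code_nth (history f n) (n - Suc i) = f i"
  unfolding history_def by (simp add: rev_nth)

text \<open>The table of earlier values is primitive recursive, and one more application of
  \<open>h\<close> reads the next value off it. This serves recursions on list codes and formula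
  codes, whose calls go to smaller codes that are not predecessors.\<close>

lemma computable_course_of_values:
  assumes "computable A (\<lambda>z. h (pfst z) (pfst (psnd z)) (psnd (psnd z)))"
    and "\<And>n x. f n x = h n (history (\<lambda>i. f i x) n) x"
    and "computable A k" "computable A g"
  shows "computable A (\<lambda>x. f (k x) (g x))"
proof -
  have "history (\<lambda>i. f i x) n = rec_nat 0 (\<lambda>n r. Suc (prod_encode (h n r x, r))) n" for n x
  proof (induction n)
    case (Suc n)
    have "history (\<lambda>i. f i x) (Suc n) = Suc (prod_encode (f n x, history (\<lambda>i. f i x) n))"
      by (simp add: history_def)
    also have "f n x = h n (history (\<lambda>i. f i x) n) x" by (rule assms(2))
    finally show ?case using Suc by (simp only: old.nat.simps)
  qed (simp add: history_def)
  moreover have "computable A (\<lambda>z. rec_nat 0 (\<lambda>n r. Suc (prod_encode (h n r (psnd z), r))) (pfst z))"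
    by (intro computable_rec_nat[where h = "\<lambda>n r z. Suc (prod_encode (h n r (psnd z), r))"]
        computable_comp3[where h = h, OF assms(1)] computable_intros)
  ultimately have "computable A (\<lambda>z. history (\<lambda>i. f i (psnd z)) (pfst z))" by (simp only:)
  then have "computable A (\<lambda>z. h (pfst z) (history (\<lambda>i. f i (psnd z)) (pfst z)) (psnd z))"
    by (rule computable_comp3[where h = h, OF assms(1) computable_pfst[OF computable_id] _
          computable_psnd[OF computable_id]])
  then have "computable A (\<lambda>z. f (pfst z) (psnd z))" by (simp only: assms(2)[symmetric])
  then show ?thesis by (rule computable_comp2[where h = f, OF _ assms(3,4)])
qed

section \<open>Relations definable with set quantifiers\<close>

lemma fm_code_inject: "fm_code \<phi> = fm_code \<psi> \<Longrightarrow> \<phi> = \<psi>"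
proof (induction \<phi> arbitrary: \<psi>)
  case (EqS i j) then show ?case by (cases \<psi>) auto
next
  case (EqC i j) then show ?case by (cases \<psi>) auto
next
  case (InS i j) then show ?case by (cases \<psi>) auto
next
  case (InC i j) then show ?case by (cases \<psi>) auto
next
  case (Neg \<phi>) then show ?case by (cases \<psi>) auto
next
  case (And \<phi>1 \<phi>2) then show ?case by (cases \<psi>) auto
next
  case (ExS \<phi>) then show ?case by (cases \<psi>) auto
next
  case (ExC \<phi>) then show ?case by (cases \<psi>) auto
qed

declare list_encode_eq [simp]

lemma delta10_diagram_iff:
  "prod_encode (fm_code \<phi>, prod_encode (list_encode xs, list_encode ys)) \<in> delta10_diagram M \<longleftrightarrow>
    delta10 \<phi> \<and> set xs \<subseteq> Sets M \<and> set ys \<subseteq> Classes M \<and> fits \<phi> (length xs) (length ys) \<and> sat M \<phi> xs ys"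
  unfolding delta10_diagram_def by (auto dest: fm_code_inject)

lemma fits_mono: "fits \<phi> m n \<Longrightarrow> n \<le> n' \<Longrightarrow> fits \<phi> m n'"
  by (induction \<phi> arbitrary: m n n') auto

lemma sat_append:
  "fits \<phi> (length xs) (length ys) \<Longrightarrow> sat M \<phi> xs (ys @ zs) \<longleftrightarrow> sat M \<phi> xs ys"
proof (induction \<phi> arbitrary: xs ys)
  case (ExS \<phi>)
  then show ?case using ExS.IH[of "_ # xs" ys] by simp
next
  case (ExC \<phi>)
  then show ?case using ExC.IH[of xs "_ # ys"] by simp
qed (auto simp: nth_append)

text \<open>Lets the truth lemma, proved for the quotient of names, speak about its presentation on
  the numbers. The quantifier cases use that each sort is mapped onto the corresponding one.\<close>

lemma sat_isomorphic:
  assumes f: "bij_betw f (dom2 M) (dom2 N)" "f ` Sets M = Sets N" "f ` Classes M = Classes N"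
    "\<forall>x\<in>dom2 M. \<forall>y\<in>dom2 M. Mem M x y \<longleftrightarrow> Mem N (f x) (f y)"
  shows "set xs \<subseteq> Sets M \<Longrightarrow> set ys \<subseteq> Classes M \<Longrightarrow> fits \<phi> (length xs) (length ys) \<Longrightarrow>
    sat M \<phi> xs ys \<longleftrightarrow> sat N \<phi> (map f xs) (map f ys)"
proof (induction \<phi> arbitrary: xs ys)
  case (EqS i j)
  then have "xs ! i \<in> dom2 M" "xs ! j \<in> dom2 M" using nth_mem unfolding dom2_def by (auto simp: subset_iff)
  then show ?case using EqS f(1) by (auto simp: bij_betw_def inj_on_eq_iff)
next
  case (EqC i j)
  then have "ys ! i \<in> dom2 M" "ys ! j \<in> dom2 M" using nth_mem unfolding dom2_def by (auto simp: subset_iff)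
  then show ?case using EqC f(1) by (auto simp: bij_betw_def inj_on_eq_iff)
next
  case (InS i j)
  then have "xs ! i \<in> dom2 M" "xs ! j \<in> dom2 M" using nth_mem unfolding dom2_def by (auto simp: subset_iff)
  then show ?case using InS f(4) by auto
next
  case (InC i j)
  then have "xs ! i \<in> dom2 M" "ys ! j \<in> dom2 M" using nth_mem unfolding dom2_def by (auto simp: subset_iff)
  then show ?case using InC f(4) by auto
next
  case (ExS \<phi>)
  have "sat M \<phi> (x # xs) ys \<longleftrightarrow> sat N \<phi> (f x # map f xs) (map f ys)" if "x \<in> Sets M" for x
    using ExS.IH[of "x # xs" ys] ExS.prems that by simp
  then show ?case unfolding sat.simps f(2)[symmetric] by simp
next
  case (ExC \<phi>)
  have "sat M \<phi> xs (y # ys) \<longleftrightarrow> sat N \<phi> (map f xs) (f y # map f ys)" if "y \<in> Classes M" for y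
    using ExC.IH[of xs "y # ys"] ExC.prems that by simp
  then show ?case unfolding sat.simps f(3)[symmetric] by simp
qed auto

locale gb =
  fixes M :: "'a structure2" and ps :: "'a list"
  assumes GB: "GB_model M" and params: "set ps \<subseteq> Classes M"
begin

text \<open>A relation is a function of the lists \<open>xs\<close> and \<open>ys\<close> of values of its set and class variables,
  the classes \<open>ps\<close> being available as parameters. A quantifier pushes its witness onto \<open>xs\<close>; writing
  bodies with \<^const>\<open>hd\<close> and \<^const>\<open>tl\<close> makes the closure rules below applicable by resolution, without
  index arithmetic.\<close>

definition svar :: "nat \<Rightarrow> nat \<Rightarrow> ('a list \<Rightarrow> 'a list \<Rightarrow> 'a) \<Rightarrow> bool" where
  "svar m n v \<longleftrightarrow> (\<exists>i<m. \<forall>xs ys. length xs = m \<and> length ys = n \<longrightarrow> v xs ys = xs ! i)"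

definition cvar :: "nat \<Rightarrow> nat \<Rightarrow> ('a list \<Rightarrow> 'a list \<Rightarrow> 'a) \<Rightarrow> bool" where
  "cvar m n v \<longleftrightarrow>
     (\<exists>j<length ps + n. \<forall>xs ys. length xs = m \<and> length ys = n \<longrightarrow> v xs ys = (ps @ ys) ! j)"

definition var :: "nat \<Rightarrow> nat \<Rightarrow> ('a list \<Rightarrow> 'a list \<Rightarrow> 'a) \<Rightarrow> bool" where
  "var m n v \<longleftrightarrow> svar m n v \<or> cvar m n v"

definition definable :: "nat \<Rightarrow> nat \<Rightarrow> ('a list \<Rightarrow> 'a list \<Rightarrow> bool) \<Rightarrow> bool" where
  "definable m n R \<longleftrightarrow> (\<exists>\<phi>. delta10 \<phi> \<and> fits \<phi> m (length ps + n) \<and>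
     (\<forall>xs ys. length xs = m \<and> length ys = n \<and> set xs \<subseteq> Sets M \<and> set ys \<subseteq> Classes M \<longrightarrow>
        (sat M \<phi> xs (ps @ ys) \<longleftrightarrow> R xs ys)))"

section \<open>Closure properties of definability\<close>

lemma svar_hd: "svar (Suc m) n (\<lambda>xs ys. hd xs)"
  unfolding svar_def by (auto intro!: exI[of _ 0] simp: length_Suc_conv)

lemma svar_tl: "svar m n v \<Longrightarrow> svar (Suc m) n (\<lambda>xs ys. v (tl xs) ys)"
  unfolding svar_def by (force simp: nth_tl)

lemma svar_nth: "i < m \<Longrightarrow> svar m n (\<lambda>xs ys. xs ! i)"
  unfolding svar_def by auto

lemma cvar_tl: "cvar m n v \<Longrightarrow> cvar (Suc m) n (\<lambda>xs ys. v (tl xs) ys)"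
  unfolding cvar_def by force

lemma cvar_nth: "i < n \<Longrightarrow> cvar m n (\<lambda>xs ys. ys ! i)"
  unfolding cvar_def by (auto intro!: exI[of _ "length ps + i"])

lemma cvar_param: "c \<in> set ps \<Longrightarrow> cvar m n (\<lambda>xs ys. c)"
  unfolding cvar_def in_set_conv_nth by (metis nth_append trans_less_add1)

lemma var_hd: "var (Suc m) n (\<lambda>xs ys. hd xs)"
  unfolding var_def using svar_hd by blast

lemma var_tl: "var m n v \<Longrightarrow> var (Suc m) n (\<lambda>xs ys. v (tl xs) ys)"
  unfolding var_def using svar_tl cvar_tl by blast

lemma var_nth_class: "i < n \<Longrightarrow> var m n (\<lambda>xs ys. ys ! i)"
  unfolding var_def using cvar_nth by blast

lemma var_nth_set: "i < m \<Longrightarrow> var m n (\<lambda>xs ys. xs ! i)"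
  unfolding var_def using svar_nth by blast

lemma var_param: "c \<in> set ps \<Longrightarrow> var m n (\<lambda>xs ys. c)"
  unfolding var_def using cvar_param by blast

lemma svar_var: "svar m n v \<Longrightarrow> var m n v" and cvar_var: "cvar m n v \<Longrightarrow> var m n v"
  by (simp_all add: var_def)

lemma svar_in: "svar m n v \<Longrightarrow> length xs = m \<Longrightarrow> length ys = n \<Longrightarrow> set xs \<subseteq> Sets M \<Longrightarrow> v xs ys \<in> Sets M"
  unfolding svar_def by force

lemma cvar_in:
  assumes "cvar m n v" "length xs = m" "length ys = n" "set ys \<subseteq> Classes M"
  shows "v xs ys \<in> Classes M"
proof -
  obtain j where "j < length (ps @ ys)" "v xs ys = (ps @ ys) ! j"
    using assms(1-3) unfolding cvar_def by auto
  moreover have "set (ps @ ys) \<subseteq> Classes M" using params assms(4) by simp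
  ultimately show ?thesis by (metis nth_mem subsetD)
qed

lemma definableI:
  assumes "delta10 \<phi>" "fits \<phi> m (length ps + n)"
    and "\<And>xs ys. length xs = m \<Longrightarrow> length ys = n \<Longrightarrow> set xs \<subseteq> Sets M \<Longrightarrow> set ys \<subseteq> Classes M \<Longrightarrow>
      sat M \<phi> xs (ps @ ys) \<longleftrightarrow> R xs ys"
  shows "definable m n R"
  using assms unfolding definable_def by blast

lemma definable_cong:
  assumes "definable m n R"
    and "\<And>xs ys. length xs = m \<Longrightarrow> length ys = n \<Longrightarrow> set xs \<subseteq> Sets M \<Longrightarrow> set ys \<subseteq> Classes M \<Longrightarrow>
      R xs ys \<longleftrightarrow> R' xs ys"
  shows "definable m n R'"
  using assms unfolding definable_def by metis

text \<open>Allowing \<open>v\<close> to be of either sort lets one rule treat set names and class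
  names alike; the sort only decides between \<open>InS\<close> and \<open>InC\<close>.\<close>

lemma definable_Mem:
  assumes "svar m n u" "var m n v"
  shows "definable m n (\<lambda>xs ys. Mem M (u xs ys) (v xs ys))"
proof -
  obtain i where i: "i < m" "\<And>xs ys. length xs = m \<Longrightarrow> length ys = n \<Longrightarrow> u xs ys = xs ! i"
    using assms(1) unfolding svar_def by blast
  from assms(2) consider "svar m n v" | "cvar m n v" unfolding var_def by blast
  then show ?thesis
  proof cases
    case 1
    then obtain j where "j < m" "\<And>xs ys. length xs = m \<Longrightarrow> length ys = n \<Longrightarrow> v xs ys = xs ! j"
      unfolding svar_def by blast
    then show ?thesis using i by (intro definableI[of "InS i j"]) auto
  next
    case 2
    then obtain j where "j < length ps + n"
      "\<And>xs ys. length xs = m \<Longrightarrow> length ys = n \<Longrightarrow> v xs ys = (ps @ ys) ! j"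
      unfolding cvar_def by blast
    then show ?thesis using i by (intro definableI[of "InC i j"]) auto
  qed
qed

lemma definable_eq:
  assumes "svar m n u" "svar m n v"
  shows "definable m n (\<lambda>xs ys. u xs ys = v xs ys)"
proof -
  obtain i j where "i < m" "\<And>xs ys. length xs = m \<Longrightarrow> length ys = n \<Longrightarrow> u xs ys = xs ! i"
    "j < m" "\<And>xs ys. length xs = m \<Longrightarrow> length ys = n \<Longrightarrow> v xs ys = xs ! j"
    using assms unfolding svar_def by blast
  then show ?thesis by (intro definableI[of "EqS i j"]) auto
qed

lemma definable_Not:
  assumes "definable m n R" shows "definable m n (\<lambda>xs ys. \<not> R xs ys)"
proof -
  from assms obtain \<phi> where "delta10 \<phi>" "fits \<phi> m (length ps + n)"
    "\<And>xs ys. length xs = m \<Longrightarrow> length ys = n \<Longrightarrow> set xs \<subseteq> Sets M \<Longrightarrow> set ys \<subseteq> Classes M \<Longrightarrow>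
      sat M \<phi> xs (ps @ ys) \<longleftrightarrow> R xs ys"
    unfolding definable_def by blast
  then show ?thesis by (intro definableI[of "Neg \<phi>"]) auto
qed

lemma definable_conj:
  assumes "definable m n R" "definable m n R'"
  shows "definable m n (\<lambda>xs ys. R xs ys \<and> R' xs ys)"
proof -
  from assms obtain \<phi> \<psi> where "delta10 \<phi>" "fits \<phi> m (length ps + n)"
    "\<And>xs ys. length xs = m \<Longrightarrow> length ys = n \<Longrightarrow> set xs \<subseteq> Sets M \<Longrightarrow> set ys \<subseteq> Classes M \<Longrightarrow>
      sat M \<phi> xs (ps @ ys) \<longleftrightarrow> R xs ys"
    "delta10 \<psi>" "fits \<psi> m (length ps + n)"
    "\<And>xs ys. length xs = m \<Longrightarrow> length ys = n \<Longrightarrow> set xs \<subseteq> Sets M \<Longrightarrow> set ys \<subseteq> Classes M \<Longrightarrow>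
      sat M \<psi> xs (ps @ ys) \<longleftrightarrow> R' xs ys"
    unfolding definable_def by blast
  then show ?thesis by (intro definableI[of "And \<phi> \<psi>"]) auto
qed

lemma definable_Bex:
  assumes "definable (Suc m) n (\<lambda>xs ys. Q (hd xs) (tl xs) ys)"
  shows "definable m n (\<lambda>xs ys. \<exists>x\<in>Sets M. Q x xs ys)"
proof -
  from assms obtain \<phi> where "delta10 \<phi>" "fits \<phi> (Suc m) (length ps + n)" and
    \<phi>: "\<And>xs ys. length xs = Suc m \<Longrightarrow> length ys = n \<Longrightarrow> set xs \<subseteq> Sets M \<Longrightarrow> set ys \<subseteq> Classes M \<Longrightarrow>
      sat M \<phi> xs (ps @ ys) \<longleftrightarrow> Q (hd xs) (tl xs) ys"
    unfolding definable_def by blast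
  then show ?thesis using \<phi>[of "_ # _"] by (intro definableI[of "ExS \<phi>"]) auto
qed

lemma definable_disj:
  assumes "definable m n R" "definable m n R'"
  shows "definable m n (\<lambda>xs ys. R xs ys \<or> R' xs ys)"
  by (rule definable_cong[OF definable_Not[OF definable_conj[OF assms[THEN definable_Not]]]]) blast

lemma definable_imp:
  assumes "definable m n R" "definable m n R'"
  shows "definable m n (\<lambda>xs ys. R xs ys \<longrightarrow> R' xs ys)"
  by (rule definable_cong[OF definable_disj[OF definable_Not[OF assms(1)] assms(2)]]) blast

lemma definable_iff:
  assumes "definable m n R" "definable m n R'"
  shows "definable m n (\<lambda>xs ys. R xs ys \<longleftrightarrow> R' xs ys)"
  by (rule definable_cong[OF definable_conj[OF definable_imp[OF assms] definable_imp[OF assms(2,1)]]])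
    blast

lemma definable_Ball:
  assumes "definable (Suc m) n (\<lambda>xs ys. Q (hd xs) (tl xs) ys)"
  shows "definable m n (\<lambda>xs ys. \<forall>x\<in>Sets M. Q x xs ys)"
  by (rule definable_cong[OF definable_Not[OF definable_Bex[OF definable_Not[OF assms]]]]) blast

lemma definable_in_Sets:
  assumes "svar m n u" shows "definable m n (\<lambda>xs ys. u xs ys \<in> Sets M)"
  by (rule definable_cong[OF definable_eq[OF assms assms]]) (auto intro: svar_in[OF assms])

lemma definable_in_Cond:
  assumes "svar m n u" "var m n C" shows "definable m n (\<lambda>xs ys. u xs ys \<in> Cond M (C xs ys))"
  unfolding Cond_def mem_Collect_eq by (intro definable_conj definable_in_Sets definable_Mem assms)

lemma definable_Bex_Cond:
  assumes "var m n C" "definable (Suc m) n (\<lambda>xs ys. Q (hd xs) (tl xs) ys)"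
  shows "definable m n (\<lambda>xs ys. \<exists>x\<in>Cond M (C xs ys). Q x xs ys)"
proof -
  have "definable m n (\<lambda>xs ys. \<exists>x\<in>Sets M. x \<in> Cond M (C xs ys) \<and> Q x xs ys)"
    by (intro definable_Bex definable_conj definable_in_Cond svar_hd var_tl assms)
  then show ?thesis by (rule definable_cong) (auto simp: Cond_def)
qed

lemma definable_Ball_Cond:
  assumes "var m n C" "definable (Suc m) n (\<lambda>xs ys. Q (hd xs) (tl xs) ys)"
  shows "definable m n (\<lambda>xs ys. \<forall>x\<in>Cond M (C xs ys). Q x xs ys)"
proof -
  have "definable m n (\<lambda>xs ys. \<forall>x\<in>Sets M. x \<in> Cond M (C xs ys) \<longrightarrow> Q x xs ys)"
    by (intro definable_Ball definable_imp definable_in_Cond svar_hd var_tl assms)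
  then show ?thesis by (rule definable_cong) (auto simp: Cond_def)
qed

lemmas definable_logic =
  definable_Bex definable_Ball definable_Bex_Cond definable_Ball_Cond definable_in_Cond
  definable_Mem definable_eq definable_Not definable_conj definable_disj definable_imp
  definable_iff definable_in_Sets
  svar_hd svar_tl cvar_tl var_hd var_tl svar_nth cvar_nth var_nth_set var_nth_class
  cvar_param var_param

section \<open>Definability of pairs, names and atomic forcing\<close>

lemma definable_is_upair:
  assumes "svar m n z" "svar m n x" "svar m n y"
  shows "definable m n (\<lambda>xs ys. is_upair M (z xs ys) (x xs ys) (y xs ys))"
  unfolding is_upair_def by (intro definable_logic assms svar_var[OF assms(1)])

lemma definable_is_opair:
  assumes "svar m n z" "svar m n x" "svar m n y"
  shows "definable m n (\<lambda>xs ys. is_opair M (z xs ys) (x xs ys) (y xs ys))"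
  unfolding is_opair_def by (intro definable_logic definable_is_upair assms)

lemma definable_related:
  assumes "var m n R" "svar m n x" "svar m n y"
  shows "definable m n (\<lambda>xs ys. related M (R xs ys) (x xs ys) (y xs ys))"
  unfolding related_def by (intro definable_logic definable_is_opair assms)

lemma definable_related3:
  assumes "var m n R" "svar m n x" "svar m n y" "svar m n z"
  shows "definable m n (\<lambda>xs ys. related3 M (R xs ys) (x xs ys) (y xs ys) (z xs ys))"
  unfolding related3_def by (intro definable_logic definable_is_opair definable_related assms)

lemma definable_set_name:
  assumes "var m n P" "svar m n x"
  shows "definable m n (\<lambda>xs ys. set_name M (P xs ys) (x xs ys))"
  unfolding set_name_def by (intro definable_logic definable_is_opair assms)

lemma definable_class_name:
  assumes "var m n P" "cvar m n C"
  shows "definable m n (\<lambda>xs ys. class_name M (P xs ys) (C xs ys))"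
proof -
  \<comment> \<open>\<open>class_name\<close> quantifies over an unbounded \<open>\<rho>\<close>,
    but a set name is a set of the model, so the quantifier may be bounded and becomes a set
    quantifier.\<close>
  have "definable m n (\<lambda>xs ys. \<forall>z\<in>Sets M. Mem M z (C xs ys) \<longrightarrow>
     (\<exists>\<rho>\<in>Sets M. \<exists>p \<in> Cond M (P xs ys). set_name M (P xs ys) \<rho> \<and> is_opair M z \<rho> p))"
    by (intro definable_logic definable_is_opair definable_set_name assms cvar_var[OF assms(2)])
  then show ?thesis
  proof (rule definable_cong)
    fix xs ys :: "'a list"
    assume "length xs = m" "length ys = n" "set ys \<subseteq> Classes M"
    then have "C xs ys \<in> Classes M" by (intro cvar_in[OF assms(2)])
    then show "(\<forall>z\<in>Sets M. Mem M z (C xs ys) \<longrightarrow>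
        (\<exists>\<rho>\<in>Sets M. \<exists>p \<in> Cond M (P xs ys). set_name M (P xs ys) \<rho> \<and> is_opair M z \<rho> p)) \<longleftrightarrow>
      class_name M (P xs ys) (C xs ys)"
      unfolding class_name_def set_name_def by (simp add: Bex_def conj_ac)
  qed
qed

lemma definable_mem_clause:
  assumes "var m n P" "var m n L" "var m n E" "svar m n p" "svar m n x" "var m n A"
  shows "definable m n (\<lambda>xs ys. mem_clause M (P xs ys) (L xs ys) (related3 M (E xs ys))
    (p xs ys) (x xs ys) (A xs ys))"
  unfolding mem_clause_def by (intro definable_logic definable_related definable_related3 assms)

lemma definable_forces_mem_class:
  assumes "var m n P" "var m n L" "var m n E" "svar m n p" "svar m n x" "var m n A"
  shows "definable m n (\<lambda>xs ys. forces_mem_class M (P xs ys) (L xs ys) (E xs ys)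
    (p xs ys) (x xs ys) (A xs ys))"
  unfolding forces_mem_class_def by (intro definable_mem_clause assms)

lemma definable_forces_eq_class:
  assumes "var m n P" "var m n L" "var m n E" "svar m n p" "var m n A" "var m n B"
  shows "definable m n (\<lambda>xs ys. forces_eq_class M (P xs ys) (L xs ys) (E xs ys)
    (p xs ys) (A xs ys) (B xs ys))"
  unfolding forces_eq_class_def sub_clause_def
  by (intro definable_logic definable_related definable_forces_mem_class assms)

lemmas definable_intros = definable_logic definable_is_upair definable_is_opair definable_related
  definable_related3 definable_set_name definable_class_name definable_forces_mem_class
  definable_forces_eq_class

text \<open>Makes room for one more class variable behind those of \<open>R\<close>: the candidate
  class in the search of \<open>computable_compr\<close>.\<close>

lemma definable_take:
  assumes "definable m n R" "n \<le> n'"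
  shows "definable m n' (\<lambda>xs ys. R xs (take n ys))"
proof -
  from assms(1) obtain \<phi> where \<phi>: "delta10 \<phi>" "fits \<phi> m (length ps + n)"
    "\<And>xs ys. length xs = m \<Longrightarrow> length ys = n \<Longrightarrow> set xs \<subseteq> Sets M \<Longrightarrow> set ys \<subseteq> Classes M \<Longrightarrow>
      sat M \<phi> xs (ps @ ys) \<longleftrightarrow> R xs ys"
    unfolding definable_def by blast
  show ?thesis
  proof (rule definableI[OF \<phi>(1) fits_mono[OF \<phi>(2)]])
    fix xs ys :: "'a list"
    assume *: "length xs = m" "length ys = n'" "set xs \<subseteq> Sets M" "set ys \<subseteq> Classes M"
    have "sat M \<phi> xs ((ps @ take n ys) @ drop n ys) \<longleftrightarrow> sat M \<phi> xs (ps @ take n ys)"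
      using \<phi>(2) * assms(2) by (intro sat_append) (simp add: min_absorb2)
    also have "\<dots> \<longleftrightarrow> R xs (take n ys)"
      using * assms(2) set_take_subset[of n ys] by (intro \<phi>(3)) auto
    finally show "sat M \<phi> xs (ps @ ys) \<longleftrightarrow> R xs (take n ys)" by simp
  qed (use assms(2) in simp)
qed

lemma comprehension:
  assumes "definable (Suc m) n (\<lambda>xs ys. Q (hd xs) (tl xs) ys)"
    and "length xs = m" "length ys = n" "set xs \<subseteq> Sets M" "set ys \<subseteq> Classes M"
  shows "\<exists>X\<in>Classes M. \<forall>z\<in>Sets M. Mem M z X \<longleftrightarrow> Q z xs ys"
proof -
  from assms(1) obtain \<phi> where "delta10 \<phi>" "fits \<phi> (Suc m) (length ps + n)" and \<phi>:
    "\<And>xs ys. length xs = Suc m \<Longrightarrow> length ys = n \<Longrightarrow> set xs \<subseteq> Sets M \<Longrightarrow> set ys \<subseteq> Classes M \<Longrightarrow>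
      sat M \<phi> xs (ps @ ys) \<longleftrightarrow> Q (hd xs) (tl xs) ys"
    unfolding definable_def by blast
  moreover have "elementary_comprehension M" using GB by (simp add: GB_model_def)
  ultimately have "\<exists>X\<in>Classes M. \<forall>z\<in>Sets M. Mem M z X \<longleftrightarrow> sat M \<phi> (z # xs) (ps @ ys)"
    using assms(2-5) params unfolding elementary_comprehension_def
    by (elim allE[of _ \<phi>] allE[of _ xs] allE[of _ "ps @ ys"] impE) simp_all
  moreover have "sat M \<phi> (z # xs) (ps @ ys) \<longleftrightarrow> Q z xs ys" if "z \<in> Sets M" for z
    using \<phi>[of "z # xs" ys] assms(2-5) that by simp
  ultimately show ?thesis by auto
qed

section \<open>Unordered and ordered pairs in the model\<close>

lemma set_eqI:
  "x \<in> Sets M \<Longrightarrow> y \<in> Sets M \<Longrightarrow> (\<And>z. z \<in> Sets M \<Longrightarrow> Mem M z x \<longleftrightarrow> Mem M z y) \<Longrightarrow> x = y"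
  using GB unfolding GB_model_def set_extensionality_def by blast

lemma sorts_disjoint: "Sets M \<inter> Classes M = {}"
  using GB unfolding GB_model_def two_sorted_def by blast

lemma upair_exists: "x \<in> Sets M \<Longrightarrow> y \<in> Sets M \<Longrightarrow> \<exists>z\<in>Sets M. is_upair M z x y"
  using GB unfolding GB_model_def pairing_def by blast

lemma upair_unique: "is_upair M z x y \<Longrightarrow> is_upair M z' x y \<Longrightarrow> z = z'"
  unfolding is_upair_def by (rule set_eqI) blast+

lemma upair_inject:
  "is_upair M z x y \<Longrightarrow> is_upair M z x' y' \<Longrightarrow> {x, y, x', y'} \<subseteq> Sets M \<Longrightarrow> {x, y} = {x', y'}"
  unfolding is_upair_def by blast

lemma opair_exists:
  assumes "x \<in> Sets M" "y \<in> Sets M" shows "\<exists>z\<in>Sets M. is_opair M z x y"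
  unfolding is_opair_def using upair_exists assms by meson

lemma opair_unique: "is_opair M z x y \<Longrightarrow> is_opair M z' x y \<Longrightarrow> z = z'"
  unfolding is_opair_def using upair_unique by metis

lemma opair_in_Sets: "is_opair M z x y \<Longrightarrow> z \<in> Sets M"
  unfolding is_opair_def is_upair_def by blast

text \<open>The usual argument for Kuratowski pairs: the two unordered pairs inside \<open>z\<close>
  match in one order or the other, and each possible identification constrains the entries.\<close>

lemma opair_inject:
  assumes "is_opair M z x y" "is_opair M z x' y'" "x \<in> Sets M" "y \<in> Sets M" "x' \<in> Sets M" "y' \<in> Sets M"
  shows "x = x' \<and> y = y'"
proof -
  obtain a b where ab: "a \<in> Sets M" "b \<in> Sets M" "is_upair M a x x" "is_upair M b x y" "is_upair M z a b"
    using assms(1) unfolding is_opair_def by blast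
  obtain c d where cd: "c \<in> Sets M" "d \<in> Sets M" "is_upair M c x' x'" "is_upair M d x' y'" "is_upair M z c d"
    using assms(2) unfolding is_opair_def by blast
  have "{a, b} = {c, d}" using upair_inject[OF ab(5) cd(5)] ab cd by simp
  moreover have sets: "{x, x} = {x', x'}" if "a = c"
    using upair_inject[OF ab(3), of x' x'] that cd(3) assms by simp
  moreover have "{x, y} = {x', y'}" if "b = d"
    using upair_inject[OF ab(4), of x' y'] that cd(4) assms by simp
  moreover have "{x, x} = {x', y'}" if "a = d"
    using upair_inject[OF ab(3), of x' y'] that cd(4) assms by simp
  moreover have "{x, y} = {x', x'}" if "b = c"
    using upair_inject[OF ab(4), of x' x'] that cd(3) assms by simp
  ultimately show ?thesis by (auto simp: doubleton_eq_iff)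
qed

lemma related_iff_Mem: "is_opair M z x y \<Longrightarrow> related M R x y \<longleftrightarrow> Mem M z R"
  unfolding related_def using opair_unique opair_in_Sets by blast

end

section \<open>Names and atomic forcing\<close>

locale class_forcing =
  fixes M :: "'a structure2" and P L E I :: 'a
  assumes GB_M: "GB_model M"
    and forcing_notion: "class_forcing_notion M P L"
    and forcing_relation: "atomic_forcing_relation M P L E I"

sublocale class_forcing \<subseteq> gb M "[P, L, E, I]"
  using GB_M forcing_notion forcing_relation
  by unfold_locales (auto simp: class_forcing_notion_def atomic_forcing_relation_def)

context class_forcing
begin

abbreviation conditions :: "'a set" where "conditions \<equiv> Cond M P"
abbreviation le (infix "\<preceq>" 50) where "q \<preceq> p \<equiv> related M L q p"
abbreviation forces_mem where "forces_mem \<equiv> forces_mem_class M P L E"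
abbreviation forces_eq where "forces_eq \<equiv> forces_eq_class M P L E"
abbreviation forces_sub where "forces_sub \<equiv> sub_clause M P L forces_mem"

definition name :: "'a \<Rightarrow> bool" where
  "name A \<longleftrightarrow> set_name M P A \<or> class_name M P A"

lemma conditions_Sets: "p \<in> conditions \<Longrightarrow> p \<in> Sets M"
  by (simp add: Cond_def)

lemma le_refl: "p \<in> conditions \<Longrightarrow> p \<preceq> p"
  using forcing_notion by (simp add: class_forcing_notion_def)

lemma le_trans: "r \<preceq> q \<Longrightarrow> q \<preceq> p \<Longrightarrow> r \<in> conditions \<Longrightarrow> q \<in> conditions \<Longrightarrow> p \<in> conditions \<Longrightarrow> r \<preceq> p"
  using forcing_notion unfolding class_forcing_notion_def by blast

lemma set_name_Sets: "set_name M P \<sigma> \<Longrightarrow> \<sigma> \<in> Sets M"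
  by (simp add: set_name_def)

text \<open>One witness \<open>T\<close> serves for a set name and for all names occurring in it.
  The definitions of names only provide some decomposition of the pair \<open>z\<close>; injectivity
  of ordered pairs identifies it with the given one.\<close>

lemma name_member:
  assumes "name A" "related M A \<rho> s" "\<rho> \<in> Sets M" "s \<in> Sets M"
  shows "set_name M P \<rho> \<and> s \<in> conditions"
proof -
  obtain z where z: "z \<in> Sets M" "is_opair M z \<rho> s" "Mem M z A"
    using assms(2) unfolding related_def by blast
  have "\<exists>\<rho>' \<in> Sets M. \<exists>p \<in> conditions. set_name M P \<rho>' \<and> is_opair M z \<rho>' p"
    using assms(1) unfolding name_def
  proof
    assume "set_name M P A"
    then obtain T where T: "T \<in> Sets M" "Mem M A T"
      "\<forall>\<tau> \<in> Sets M. Mem M \<tau> T \<longrightarrow> (\<forall>z \<in> Sets M. Mem M z \<tau> \<longrightarrow>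
        (\<exists>\<rho> \<in> Sets M. \<exists>p \<in> conditions. Mem M \<rho> T \<and> is_opair M z \<rho> p))" "A \<in> Sets M"
      unfolding set_name_def by blast
    then obtain \<rho>' p where "\<rho>' \<in> Sets M" "p \<in> conditions" "Mem M \<rho>' T" "is_opair M z \<rho>' p"
      using z by blast
    then show ?thesis using T unfolding set_name_def by blast
  next
    assume "class_name M P A"
    then show ?thesis using z set_name_Sets unfolding class_name_def by blast
  qed
  then show ?thesis using opair_inject[OF z(2)] assms(3,4) conditions_Sets by blast
qed

lemma forces_mem_iff:
  "forces_mem p \<sigma> A \<longleftrightarrow> (\<forall>q \<in> conditions. q \<preceq> p \<longrightarrow>
     (\<exists>r \<in> conditions. r \<preceq> q \<and> (\<exists>\<rho> \<in> Sets M. \<exists>s \<in> conditions. related M A \<rho> s \<and> r \<preceq> s \<and>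
        related3 M E r \<sigma> \<rho>)))"
  unfolding forces_mem_class_def mem_clause_def ..

lemma I_iff_forces_mem:
  "p \<in> conditions \<Longrightarrow> set_name M P \<sigma> \<Longrightarrow> set_name M P \<tau> \<Longrightarrow> related3 M I p \<sigma> \<tau> \<longleftrightarrow> forces_mem p \<sigma> \<tau>"
  using forcing_relation unfolding atomic_forcing_relation_def forces_mem_class_def by blast

lemma sub_clause_I:
  assumes "set_name M P \<sigma>" "set_name M P \<tau>"
  shows "sub_clause M P L (related3 M I) p \<sigma> \<tau> \<longleftrightarrow> forces_sub p \<sigma> \<tau>"
proof -
  have "related3 M I q \<rho> \<tau> \<longleftrightarrow> forces_mem q \<rho> \<tau>"
    if "\<rho> \<in> Sets M" "s \<in> conditions" "related M \<sigma> \<rho> s" "q \<in> conditions" for \<rho> s q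
    using I_iff_forces_mem name_member[of \<sigma> \<rho> s] assms that conditions_Sets unfolding name_def by blast
  then show ?thesis unfolding sub_clause_def by blast
qed

text \<open>On set names the classes \<open>E\<close> and \<open>I\<close> now obey the same clauses
  as forcing for class names, so facts about \<open>forces_eq\<close> and \<open>forces_mem\<close>
  cover both sorts at once.\<close>

lemma E_iff_forces_eq:
  assumes "p \<in> conditions" "set_name M P \<sigma>" "set_name M P \<tau>"
  shows "related3 M E p \<sigma> \<tau> \<longleftrightarrow> forces_eq p \<sigma> \<tau>"
proof -
  have "related3 M E p \<sigma> \<tau> \<longleftrightarrow>
    sub_clause M P L (related3 M I) p \<sigma> \<tau> \<and> sub_clause M P L (related3 M I) p \<tau> \<sigma>"
    using forcing_relation assms unfolding atomic_forcing_relation_def by blast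
  then show ?thesis
    unfolding forces_eq_class_def sub_clause_I[OF assms(2,3)] sub_clause_I[OF assms(3,2)] .
qed

section \<open>Forced equality as a congruence\<close>

lemma forces_mem_mono:
  "forces_mem p \<sigma> A \<Longrightarrow> q \<preceq> p \<Longrightarrow> q \<in> conditions \<Longrightarrow> p \<in> conditions \<Longrightarrow> forces_mem q \<sigma> A"
  unfolding forces_mem_iff using le_trans by blast

lemma forces_sub_mono:
  "forces_sub p A B \<Longrightarrow> q \<preceq> p \<Longrightarrow> q \<in> conditions \<Longrightarrow> p \<in> conditions \<Longrightarrow> forces_sub q A B"
  unfolding sub_clause_def using le_trans by blast

lemma forces_eq_mono:
  "forces_eq p A B \<Longrightarrow> q \<preceq> p \<Longrightarrow> q \<in> conditions \<Longrightarrow> p \<in> conditions \<Longrightarrow> forces_eq q A B"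
  unfolding forces_eq_class_def using forces_sub_mono by blast

lemma E_mono:
  "related3 M E p \<sigma> \<tau> \<Longrightarrow> q \<preceq> p \<Longrightarrow> q \<in> conditions \<Longrightarrow> p \<in> conditions \<Longrightarrow>
    set_name M P \<sigma> \<Longrightarrow> set_name M P \<tau> \<Longrightarrow> related3 M E q \<sigma> \<tau>"
  using E_iff_forces_eq forces_eq_mono by blast

lemma forces_eq_sym: "forces_eq p A B \<Longrightarrow> forces_eq p B A"
  unfolding forces_eq_class_def by blast

text \<open>A member \<open>\<rho>\<close> of a name \<open>\<sigma>\<close> sits two membership steps below a pair in \<open>\<sigma>\<close>, so foundation is
  applied to the class of sets at distance at most two above a counterexample.\<close>

lemma set_name_induct:
  assumes B: "B \<in> Classes M" "\<And>z. z \<in> Sets M \<Longrightarrow> Mem M z B \<longleftrightarrow> Q z"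
    and \<sigma>: "set_name M P \<sigma>"
    and step: "\<And>\<sigma>. set_name M P \<sigma> \<Longrightarrow>
      (\<And>\<rho> s. \<rho> \<in> Sets M \<Longrightarrow> s \<in> conditions \<Longrightarrow> related M \<sigma> \<rho> s \<Longrightarrow> Q \<rho>) \<Longrightarrow> Q \<sigma>"
  shows "Q \<sigma>"
proof (rule ccontr)
  assume "\<not> Q \<sigma>"
  define bad where "bad z C \<longleftrightarrow> set_name M P z \<and> \<not> Mem M z C" for z C
  have "definable (Suc 0) (Suc 0) (\<lambda>xs ys. bad (hd xs) (ys ! 0) \<or>
    (\<exists>y\<in>Sets M. Mem M y (hd xs) \<and> bad y (ys ! 0)) \<or>
    (\<exists>y\<in>Sets M. Mem M y (hd xs) \<and> (\<exists>z\<in>Sets M. Mem M z y \<and> bad z (ys ! 0))))"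
    unfolding bad_def by (intro definable_intros) simp_all
  then have "\<exists>X\<in>Classes M. \<forall>x\<in>Sets M. Mem M x X \<longleftrightarrow> bad x ([B] ! 0) \<or>
    (\<exists>y\<in>Sets M. Mem M y x \<and> bad y ([B] ! 0)) \<or>
    (\<exists>y\<in>Sets M. Mem M y x \<and> (\<exists>z\<in>Sets M. Mem M z y \<and> bad z ([B] ! 0)))"
    by (rule comprehension[where xs = "[]"]) (use B(1) in simp_all)
  then obtain X where X: "X \<in> Classes M" and X_iff: "\<And>x. x \<in> Sets M \<Longrightarrow> Mem M x X \<longleftrightarrow> bad x B \<or>
    (\<exists>y\<in>Sets M. Mem M y x \<and> bad y B) \<or> (\<exists>y\<in>Sets M. Mem M y x \<and> (\<exists>z\<in>Sets M. Mem M z y \<and> bad z B))"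
    by auto
  have "Mem M \<sigma> X" using X_iff \<sigma> \<open>\<not> Q \<sigma>\<close> B(2) set_name_Sets unfolding bad_def by blast
  moreover have "foundation M" using GB by (simp add: GB_model_def)
  ultimately obtain x where x: "x \<in> Sets M" "Mem M x X" "\<And>y. y \<in> Sets M \<Longrightarrow> Mem M y x \<Longrightarrow> \<not> Mem M y X"
    using X set_name_Sets[OF \<sigma>] unfolding foundation_def by meson
  then have "bad x B" using X_iff by meson
  then have "\<not> Q x" "set_name M P x" using B(2) x(1) unfolding bad_def by blast+
  then obtain \<rho> s where \<rho>: "\<rho> \<in> Sets M" "s \<in> conditions" "related M x \<rho> s" "\<not> Q \<rho>"
    using step by blast
  then have "bad \<rho> B" using name_member[of x \<rho> s] \<open>set_name M P x\<close> B(2) conditions_Sets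
    unfolding bad_def name_def by blast
  obtain z a where z: "z \<in> Sets M" "Mem M z x" "a \<in> Sets M" "Mem M a z" "Mem M \<rho> a"
    using \<rho>(1,3) unfolding related_def is_opair_def is_upair_def by blast
  then have "Mem M z X" using X_iff \<open>bad \<rho> B\<close> \<rho>(1) by blast
  then show False using x(3) z by blast
qed

text \<open>The pair \<open>(\<rho>, s)\<close> itself witnesses the membership below every
  condition. Reflexivity at \<open>\<rho>\<close> is a hypothesis because the lemma is used inside
  the induction that proves reflexivity.\<close>

lemma forces_mem_member:
  assumes "p \<in> conditions" "s \<in> conditions" "p \<preceq> s" "related M A \<rho> s" "set_name M P \<rho>"
    and "\<And>p. p \<in> conditions \<Longrightarrow> related3 M E p \<rho> \<rho>"
  shows "forces_mem p \<rho> A"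
  unfolding forces_mem_iff
proof (intro ballI impI)
  fix q assume "q \<in> conditions" "q \<preceq> p"
  then show "\<exists>r \<in> conditions. r \<preceq> q \<and> (\<exists>\<rho>' \<in> Sets M. \<exists>s \<in> conditions. related M A \<rho>' s \<and> r \<preceq> s \<and>
      related3 M E r \<rho> \<rho>')"
    using assms le_refl le_trans set_name_Sets by blast
qed

lemma E_refl:
  assumes "p \<in> conditions" "set_name M P \<sigma>"
  shows "related3 M E p \<sigma> \<sigma>"
proof -
  \<comment> \<open>Induction on names is available only for a property that is a class of the
    model. Quantifying over all conditions inside the property is harmless, being a set
    quantifier.\<close>
  have "definable (Suc 0) 0 (\<lambda>xs ys. \<forall>p\<in>conditions. related3 M E p (hd xs) (hd xs))"
    by (intro definable_intros) simp_all
  then have "\<exists>B\<in>Classes M. \<forall>z\<in>Sets M. Mem M z B \<longleftrightarrow> (\<forall>p\<in>conditions. related3 M E p z z)"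
    by (rule comprehension[where xs = "[]" and ys = "[]"]) simp_all
  then obtain B where B: "B \<in> Classes M"
    "\<And>z. z \<in> Sets M \<Longrightarrow> Mem M z B \<longleftrightarrow> (\<forall>p\<in>conditions. related3 M E p z z)"
    by blast
  have "\<forall>p\<in>conditions. related3 M E p \<sigma> \<sigma>"
  proof (rule set_name_induct[where Q = "\<lambda>\<sigma>. \<forall>p\<in>conditions. related3 M E p \<sigma> \<sigma>", OF B assms(2)])
    fix \<sigma>
    assume step: "set_name M P \<sigma>" "\<And>\<rho> s. \<rho> \<in> Sets M \<Longrightarrow> s \<in> conditions \<Longrightarrow> related M \<sigma> \<rho> s \<Longrightarrow>
      \<forall>p\<in>conditions. related3 M E p \<rho> \<rho>"
    have "forces_sub p \<sigma> \<sigma>" if "p \<in> conditions" for p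
      unfolding sub_clause_def
    proof (intro ballI impI)
      fix \<rho> s q
      assume *: "\<rho> \<in> Sets M" "s \<in> conditions" "related M \<sigma> \<rho> s" "q \<in> conditions" "q \<preceq> p \<and> q \<preceq> s"
      have "set_name M P \<rho>" using name_member[of \<sigma> \<rho> s] step(1) * conditions_Sets
        unfolding name_def by blast
      then show "forces_mem q \<rho> \<sigma>" using forces_mem_member[of q s \<sigma> \<rho>] step(2)[of \<rho> s] * by blast
    qed
    then show "\<forall>p\<in>conditions. related3 M E p \<sigma> \<sigma>" 
      using E_iff_forces_eq step(1) unfolding forces_eq_class_def by blast
  qed
  then show ?thesis using assms(1) by blast
qed

text \<open>A member of \<open>A\<close> is matched with a member of \<open>B\<close>, and below a
  stronger condition that one with a member of \<open>C\<close>. Transitivity for these members is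
  assumed together with both pairs, the one in \<open>A\<close> and the one in \<open>C\<close>, so
  that an induction hypothesis about the members of either end can discharge it; for class names it
  is discharged by \<open>E_trans\<close>.\<close>

lemma forces_sub_trans:
  assumes sub: "forces_sub p A B" "forces_sub p B C" and p: "p \<in> conditions"
    and names: "name A" "name B" "name C"
    and E_trans: "\<And>\<rho> \<rho>' \<rho>'' r s s''. related M A \<rho> s \<Longrightarrow> related M C \<rho>'' s'' \<Longrightarrow>
      s \<in> conditions \<Longrightarrow> s'' \<in> conditions \<Longrightarrow> r \<in> conditions \<Longrightarrow>
      set_name M P \<rho> \<Longrightarrow> set_name M P \<rho>' \<Longrightarrow> set_name M P \<rho>'' \<Longrightarrow>
      related3 M E r \<rho> \<rho>' \<Longrightarrow> related3 M E r \<rho>' \<rho>'' \<Longrightarrow> related3 M E r \<rho> \<rho>''"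
  shows "forces_sub p A C"
  unfolding sub_clause_def
proof (intro ballI impI)
  fix \<rho> s q
  assume \<rho>: "\<rho> \<in> Sets M" "s \<in> conditions" "related M A \<rho> s" and q: "q \<in> conditions" "q \<preceq> p \<and> q \<preceq> s"
  have n: "set_name M P \<rho>" using name_member[OF names(1)] \<rho> conditions_Sets by blast
  show "forces_mem q \<rho> C"
    unfolding forces_mem_iff
  proof (intro ballI impI)
    fix q' assume q': "q' \<in> conditions" "q' \<preceq> q"
    have "forces_mem q \<rho> B" using sub(1) \<rho> q unfolding sub_clause_def by blast
    then obtain r \<rho>' s' where r: "r \<in> conditions" "r \<preceq> q'" "\<rho>' \<in> Sets M" "s' \<in> conditions"
      "related M B \<rho>' s'" "r \<preceq> s'" "related3 M E r \<rho> \<rho>'"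
      using q' unfolding forces_mem_iff by blast
    have n': "set_name M P \<rho>'" using name_member[OF names(2)] r conditions_Sets by blast
    have "r \<preceq> p" using le_trans r q q' p by meson
    then have "forces_mem r \<rho>' C" using sub(2) r unfolding sub_clause_def by blast
    then obtain t \<rho>'' s'' where t: "t \<in> conditions" "t \<preceq> r" "\<rho>'' \<in> Sets M" "s'' \<in> conditions"
      "related M C \<rho>'' s''" "t \<preceq> s''" "related3 M E t \<rho>' \<rho>''"
      using r(1) le_refl[OF r(1)] unfolding forces_mem_iff by blast
    have n'': "set_name M P \<rho>''" using name_member[OF names(3)] t conditions_Sets by blast
    have "related3 M E t \<rho> \<rho>'" using E_mono[OF r(7) t(2,1) r(1) n n'] .
    then have "related3 M E t \<rho> \<rho>''" using E_trans \<rho> t n n' n'' by blast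
    moreover have "t \<preceq> q'" using le_trans t r q' by blast
    ultimately show "\<exists>r \<in> conditions. r \<preceq> q' \<and> (\<exists>\<rho>' \<in> Sets M. \<exists>s \<in> conditions. related M C \<rho>' s \<and>
      r \<preceq> s \<and> related3 M E r \<rho> \<rho>')" using t by blast
  qed
qed

lemma E_sym:
  "related3 M E p \<sigma> \<tau> \<Longrightarrow> p \<in> conditions \<Longrightarrow> set_name M P \<sigma> \<Longrightarrow> set_name M P \<tau> \<Longrightarrow> related3 M E p \<tau> \<sigma>"
  using E_iff_forces_eq forces_eq_sym by blast

text \<open>The induction is on \<open>\<sigma>\<close> alone, with the other two names quantified
  inside the property so that they may change on the way to members.\<close>

lemma E_trans:
  assumes "related3 M E p \<sigma> \<tau>" "related3 M E p \<tau> \<pi>" "p \<in> conditions"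
    "set_name M P \<sigma>" "set_name M P \<tau>" "set_name M P \<pi>"
  shows "related3 M E p \<sigma> \<pi>"
proof -
  let ?Q = "\<lambda>\<sigma>. \<forall>p\<in>conditions. \<forall>\<tau>\<in>Sets M. \<forall>\<pi>\<in>Sets M. set_name M P \<tau> \<and> set_name M P \<pi> \<and>
    related3 M E p \<sigma> \<tau> \<and> related3 M E p \<tau> \<pi> \<longrightarrow> related3 M E p \<sigma> \<pi>"
  have "definable (Suc 0) 0 (\<lambda>xs ys. ?Q (hd xs))"
    by (intro definable_intros) simp_all
  then have "\<exists>B\<in>Classes M. \<forall>z\<in>Sets M. Mem M z B \<longleftrightarrow> ?Q z"
    by (rule comprehension[where xs = "[]" and ys = "[]"]) simp_all
  then obtain B where B: "B \<in> Classes M" "\<And>z. z \<in> Sets M \<Longrightarrow> Mem M z B \<longleftrightarrow> ?Q z"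
    by blast
  have "?Q \<sigma>"
  proof (rule set_name_induct[where Q = ?Q, OF B assms(4)])
    fix \<sigma>
    assume step: "set_name M P \<sigma>" "\<And>\<rho> s. \<rho> \<in> Sets M \<Longrightarrow> s \<in> conditions \<Longrightarrow> related M \<sigma> \<rho> s \<Longrightarrow> ?Q \<rho>"
    show "?Q \<sigma>"
    proof (intro ballI impI, elim conjE)
      fix p \<tau> \<pi>
      assume p: "p \<in> conditions" and names: "set_name M P \<tau>" "set_name M P \<pi>"
        and "related3 M E p \<sigma> \<tau>" "related3 M E p \<tau> \<pi>"
      then have sub: "forces_sub p \<sigma> \<tau>" "forces_sub p \<tau> \<sigma>" "forces_sub p \<tau> \<pi>" "forces_sub p \<pi> \<tau>"
        using E_iff_forces_eq step(1) unfolding forces_eq_class_def by blast+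
      have IH: "related3 M E r \<rho> \<rho>''"
        if "related M \<sigma> \<rho> s" "s \<in> conditions" "r \<in> conditions" "set_name M P \<rho>" "set_name M P \<rho>'"
          "set_name M P \<rho>''" "related3 M E r \<rho> \<rho>'" "related3 M E r \<rho>' \<rho>''" for \<rho> \<rho>' \<rho>'' r s
        using bspec[OF bspec[OF bspec[OF step(2)[OF set_name_Sets[OF that(4)] that(2,1)] that(3)]
            set_name_Sets[OF that(5)]] set_name_Sets[OF that(6)]] that(5-8) by simp
      have "forces_sub p \<sigma> \<pi>"
      proof (rule forces_sub_trans[OF sub(1,3) p])
        fix \<rho> \<rho>' \<rho>'' r s s''
        assume "related M \<sigma> \<rho> s" "s \<in> conditions" "r \<in> conditions" "set_name M P \<rho>"
          "set_name M P \<rho>'" "set_name M P \<rho>''" "related3 M E r \<rho> \<rho>'" "related3 M E r \<rho>' \<rho>''"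
        then show "related3 M E r \<rho> \<rho>''" by (rule IH)
      qed (use step(1) names in \<open>simp_all add: name_def\<close>)
      moreover have "forces_sub p \<pi> \<sigma>"
      proof (rule forces_sub_trans[OF sub(4,2) p])
        fix \<rho> \<rho>' \<rho>'' r s s''
        assume *: "related M \<sigma> \<rho>'' s''" "s'' \<in> conditions" "r \<in> conditions" "set_name M P \<rho>"
          "set_name M P \<rho>'" "set_name M P \<rho>''" "related3 M E r \<rho> \<rho>'" "related3 M E r \<rho>' \<rho>''"
        \<comment> \<open>Here \<open>\<sigma>\<close> stands at the end of the chain. The chain is
          reversed by symmetry, since the induction hypothesis speaks only about chains starting at
          a member of \<open>\<sigma>\<close>.\<close>
        then have "related3 M E r \<rho>'' \<rho>'" "related3 M E r \<rho>' \<rho>"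
          by (blast dest: E_sym)+
        then have "related3 M E r \<rho>'' \<rho>" by (rule IH[OF *(1-3,6,5,4)])
        then show "related3 M E r \<rho> \<rho>''" by (rule E_sym[OF _ *(3,6,4)])
      qed (use step(1) names in \<open>simp_all add: name_def\<close>)
      ultimately show "related3 M E p \<sigma> \<pi>"
        using E_iff_forces_eq step(1) names p unfolding forces_eq_class_def by blast
    qed
  qed
  from bspec[OF bspec[OF bspec[OF this assms(3)] set_name_Sets[OF assms(5)]] set_name_Sets[OF assms(6)]]
  show ?thesis using assms by simp
qed

lemma forces_eq_refl:
  assumes "p \<in> conditions" "name A"
  shows "forces_eq p A A"
proof -
  have "forces_sub p A A"
    unfolding sub_clause_def
  proof (intro ballI impI)
    fix \<rho> s q
    assume *: "\<rho> \<in> Sets M" "s \<in> conditions" "related M A \<rho> s" "q \<in> conditions" "q \<preceq> p \<and> q \<preceq> s"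
    have "set_name M P \<rho>" using name_member[OF assms(2)] * conditions_Sets by blast
    then show "forces_mem q \<rho> A" using forces_mem_member[of q s A \<rho>] E_refl * by blast
  qed
  then show ?thesis unfolding forces_eq_class_def by blast
qed

lemma forces_eq_trans:
  assumes "forces_eq p A B" "forces_eq p B C" "p \<in> conditions" "name A" "name B" "name C"
  shows "forces_eq p A C"
proof -
  have "forces_sub p A C" if "forces_sub p A B" "forces_sub p B C" "name A" "name C" for A C
    by (rule forces_sub_trans[OF that(1,2) assms(3) that(3) assms(5) that(4)]) (rule E_trans)
  then show ?thesis using assms unfolding forces_eq_class_def by blast
qed

lemma forces_mem_cong_left:
  assumes "forces_mem p \<sigma> A" "related3 M E p \<sigma>' \<sigma>" "p \<in> conditions"
    "set_name M P \<sigma>" "set_name M P \<sigma>'" "name A"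
  shows "forces_mem p \<sigma>' A"
  unfolding forces_mem_iff
proof (intro ballI impI)
  fix q assume "q \<in> conditions" "q \<preceq> p"
  then obtain r \<rho> s where r: "r \<in> conditions" "r \<preceq> q" "\<rho> \<in> Sets M" "s \<in> conditions"
    "related M A \<rho> s" "r \<preceq> s" "related3 M E r \<sigma> \<rho>"
    using assms(1) unfolding forces_mem_iff by blast
  have "r \<preceq> p" using le_trans r \<open>q \<in> conditions\<close> \<open>q \<preceq> p\<close> assms(3) by blast
  then have "related3 M E r \<sigma>' \<sigma>" using E_mono assms r(1) by blast
  moreover have "set_name M P \<rho>" using name_member[OF assms(6)] r conditions_Sets by blast
  ultimately have "related3 M E r \<sigma>' \<rho>" using E_trans r assms by blast
  then show "\<exists>r \<in> conditions. r \<preceq> q \<and> (\<exists>\<rho> \<in> Sets M. \<exists>s \<in> conditions. related M A \<rho> s \<and>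
      r \<preceq> s \<and> related3 M E r \<sigma>' \<rho>)" using r by blast
qed

text \<open>Where \<open>\<sigma>\<close> is forced equal to a member \<open>\<rho>\<close> of
  \<open>A\<close>, the inclusion of \<open>A\<close> in \<open>B\<close> forces
  \<open>\<rho>\<close> into \<open>B\<close>, and congruence on the left returns from
  \<open>\<rho>\<close> to \<open>\<sigma>\<close>. A further extension then exposes the required
  member of \<open>B\<close>.\<close>

lemma forces_mem_cong_right:
  assumes "forces_mem p \<sigma> A" "forces_eq p A B" "p \<in> conditions" "set_name M P \<sigma>" "name A" "name B"
  shows "forces_mem p \<sigma> B"
  unfolding forces_mem_iff
proof (intro ballI impI)
  fix q assume q: "q \<in> conditions" "q \<preceq> p"
  then obtain r \<rho> s where r: "r \<in> conditions" "r \<preceq> q" "\<rho> \<in> Sets M" "s \<in> conditions"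
    "related M A \<rho> s" "r \<preceq> s" "related3 M E r \<sigma> \<rho>"
    using assms(1) unfolding forces_mem_iff by blast
  have "r \<preceq> p" using le_trans r q assms(3) by blast
  then have "forces_mem r \<rho> B"
    using assms(2) r unfolding forces_eq_class_def sub_clause_def by blast
  moreover have "set_name M P \<rho>" using name_member[OF assms(5)] r conditions_Sets by blast
  ultimately have "forces_mem r \<sigma> B" using forces_mem_cong_left r assms(4,6) by blast
  then obtain t where "t \<in> conditions" "t \<preceq> r" "\<exists>\<rho> \<in> Sets M. \<exists>s \<in> conditions. related M B \<rho> s \<and>
      t \<preceq> s \<and> related3 M E t \<sigma> \<rho>"
    using le_refl[OF r(1)] r(1) unfolding forces_mem_iff by blast
  then show "\<exists>r \<in> conditions. r \<preceq> q \<and> (\<exists>\<rho> \<in> Sets M. \<exists>s \<in> conditions. related M B \<rho> s \<and>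
      r \<preceq> s \<and> related3 M E r \<sigma> \<rho>)" using le_trans r q by blast
qed

section \<open>Forcing and truth in the extension\<close>

text \<open>Existential formulas are forced by a witness; density is only used for negations.\<close>

fun forces :: "fm \<Rightarrow> 'a list \<Rightarrow> 'a \<Rightarrow> 'a list \<Rightarrow> bool" where
  "forces (EqS i j) ys p xs \<longleftrightarrow> p \<in> conditions \<and> related3 M E p (xs ! i) (xs ! j)"
| "forces (EqC i j) ys p xs \<longleftrightarrow> p \<in> conditions \<and> forces_eq p (ys ! i) (ys ! j)"
| "forces (InS i j) ys p xs \<longleftrightarrow> p \<in> conditions \<and> forces_mem p (xs ! i) (xs ! j)"
| "forces (InC i j) ys p xs \<longleftrightarrow> p \<in> conditions \<and> forces_mem p (xs ! i) (ys ! j)"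
| "forces (Neg \<phi>) ys p xs \<longleftrightarrow> p \<in> conditions \<and> \<not> (\<exists>q\<in>conditions. q \<preceq> p \<and> forces \<phi> ys q xs)"
| "forces (And \<phi> \<psi>) ys p xs \<longleftrightarrow> forces \<phi> ys p xs \<and> forces \<psi> ys p xs"
| "forces (ExS \<phi>) ys p xs \<longleftrightarrow> (\<exists>\<sigma>\<in>Sets M. set_name M P \<sigma> \<and> forces \<phi> ys p (\<sigma> # xs))"
| "forces (ExC \<phi>) ys p xs \<longleftrightarrow> False"

lemma forces_condition: "forces \<phi> ys p xs \<Longrightarrow> p \<in> conditions"
  by (induction \<phi> arbitrary: xs) auto

definition names_for :: "'a list \<Rightarrow> 'a list \<Rightarrow> bool" where
  "names_for xs ys \<longleftrightarrow> (\<forall>x\<in>set xs. set_name M P x) \<and> (\<forall>y\<in>set ys. class_name M P y)"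

lemma names_for_Cons: "names_for (x # xs) ys \<longleftrightarrow> set_name M P x \<and> names_for xs ys"
  by (auto simp: names_for_def)

lemma names_for_nth:
  "names_for xs ys \<Longrightarrow> i < length xs \<Longrightarrow> set_name M P (xs ! i)"
  "names_for xs ys \<Longrightarrow> j < length ys \<Longrightarrow> class_name M P (ys ! j)"
  by (auto simp: names_for_def)

lemma forces_mono:
  "forces \<phi> ys p xs \<Longrightarrow> q \<preceq> p \<Longrightarrow> q \<in> conditions \<Longrightarrow> fits \<phi> (length xs) (length ys) \<Longrightarrow>
    names_for xs ys \<Longrightarrow> forces \<phi> ys q xs"
proof (induction \<phi> arbitrary: xs)
  case (EqS i j)
  then show ?case using E_mono names_for_nth by auto
next
  case (EqC i j)
  then show ?case using forces_eq_mono by auto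
next
  case (InS i j)
  then show ?case using forces_mem_mono by auto
next
  case (InC i j)
  then show ?case using forces_mem_mono by auto
next
  case (Neg \<phi>)
  then have p: "p \<in> conditions" "\<not> (\<exists>r\<in>conditions. r \<preceq> p \<and> forces \<phi> ys r xs)" by simp_all
  have "\<not> (\<exists>r\<in>conditions. r \<preceq> q \<and> forces \<phi> ys r xs)"
    using p le_trans Neg.prems(2,3) by blast
  then show ?case using Neg.prems(3) by simp
next
  case (ExS \<phi>)
  then show ?case by (auto simp: names_for_Cons)
qed auto

text \<open>The recursion is over actual formulas, so each \<open>\<phi>\<close> gets its own
  defining formula. The names are given by a list \<open>vs\<close> of variables in order to pass
  quantifiers: the variable pushed is the stronger condition for \<open>Neg\<close> and the new name
  for \<open>ExS\<close>, and all older variables are then read off the tail.\<close>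

lemma definable_forces:
  assumes "delta10 \<phi>" "fits \<phi> (length vs) n" "svar m n p" "\<And>v. v \<in> set vs \<Longrightarrow> svar m n v"
  shows "definable m n (\<lambda>xs ys. forces \<phi> ys (p xs ys) (map (\<lambda>v. v xs ys) vs))"
  using assms
proof (induction \<phi> arbitrary: m p vs)
  case (EqS i j)
  then have *: "i < length vs" "j < length vs" "svar m n (vs ! i)" "svar m n (vs ! j)" by auto
  show ?case unfolding forces.simps nth_map[OF *(1)] nth_map[OF *(2)]
    by (intro definable_intros EqS *) simp_all
next
  case (EqC i j)
  then show ?case unfolding forces.simps by (intro definable_intros EqC) simp_all
next
  case (InS i j)
  then have *: "i < length vs" "j < length vs" "svar m n (vs ! i)" "svar m n (vs ! j)" by auto
  show ?case unfolding forces.simps nth_map[OF *(1)] nth_map[OF *(2)]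
    by (intro definable_intros InS * svar_var) simp_all
next
  case (InC i j)
  then have *: "i < length vs" "j < n" "svar m n (vs ! i)" by auto
  show ?case unfolding forces.simps nth_map[OF *(1)]
    by (intro definable_intros InC *) simp_all
next
  case (Neg \<phi>)
  have "definable (Suc m) n (\<lambda>xs ys. forces \<phi> ys (hd xs)
      (map (\<lambda>v. v xs ys) (map (\<lambda>v xs ys. v (tl xs) ys) vs)))"
    using Neg.prems by (intro Neg.IH) (auto intro: svar_hd svar_tl)
  then have "definable (Suc m) n (\<lambda>xs ys. forces \<phi> ys (hd xs) (map (\<lambda>v. v (tl xs) ys) vs))"
    by (simp add: comp_def)
  then show ?case unfolding forces.simps by (intro definable_intros Neg.prems) simp_all
next
  case (And \<phi> \<psi>)
  then show ?case unfolding forces.simps by (intro definable_conj And.IH) simp_all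
next
  case (ExS \<phi>)
  have "definable (Suc m) n (\<lambda>xs ys. forces \<phi> ys (p (tl xs) ys)
      (map (\<lambda>v. v xs ys) ((\<lambda>xs ys. hd xs) # map (\<lambda>v xs ys. v (tl xs) ys) vs)))"
    using ExS.prems by (intro ExS.IH) (auto intro: svar_hd svar_tl)
  then have "definable (Suc m) n (\<lambda>xs ys. forces \<phi> ys (p (tl xs) ys)
      (hd xs # map (\<lambda>v. v (tl xs) ys) vs))"
    by (simp add: comp_def)
  then show ?case unfolding forces.simps by (intro definable_intros) simp_all
qed simp

lemma forces_class:
  assumes "delta10 \<phi>" "fits \<phi> (length xs) (length ys)" "names_for xs ys"
  shows "\<exists>X\<in>Classes M. \<forall>p\<in>Sets M. Mem M p X \<longleftrightarrow> forces \<phi> ys p xs"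
proof -
  let ?m = "length xs" and ?n = "length ys"
  have "definable (Suc ?m) ?n (\<lambda>zs ys. forces \<phi> ys (hd zs)
      (map (\<lambda>v. v zs ys) (map (\<lambda>i zs ys. tl zs ! i) [0..<?m])))"
    by (intro definable_forces) (use assms in \<open>auto intro!: svar_hd svar_tl svar_nth\<close>)
  then have "definable (Suc ?m) ?n (\<lambda>zs ys. forces \<phi> ys (hd zs) (map (\<lambda>i. tl zs ! i) [0..<?m]))"
    by (simp add: comp_def)
  then have "\<exists>X\<in>Classes M. \<forall>p\<in>Sets M. Mem M p X \<longleftrightarrow> forces \<phi> ys p (map (\<lambda>i. xs ! i) [0..<?m])"
    by (rule comprehension)
      (use assms(3) in \<open>auto simp: names_for_def class_name_def set_name_Sets\<close>)
  then show ?thesis by (simp add: map_nth)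
qed

section \<open>Names with pairwise distinct values\<close>

lemma singleton_name:
  assumes "set_name M P \<rho>" "s \<in> conditions"
  shows "\<exists>\<tau>. set_name M P \<tau> \<and> (\<forall>z\<in>Sets M. Mem M z \<tau> \<longleftrightarrow> is_opair M z \<rho> s)"
proof -
  obtain T where T: "T \<in> Sets M" "Mem M \<rho> T" "\<forall>\<tau> \<in> Sets M. Mem M \<tau> T \<longrightarrow>
      (\<forall>z \<in> Sets M. Mem M z \<tau> \<longrightarrow> (\<exists>\<rho> \<in> Sets M. \<exists>p \<in> conditions. Mem M \<rho> T \<and> is_opair M z \<rho> p))"
    using assms(1) unfolding set_name_def by blast
  have \<rho>: "\<rho> \<in> Sets M" using assms(1) by (rule set_name_Sets)
  obtain z where z: "z \<in> Sets M" "is_opair M z \<rho> s"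
    using opair_exists[OF \<rho> conditions_Sets[OF assms(2)]] by blast
  \<comment> \<open>\<open>\<tau>\<close> is the singleton of the pair \<open>z\<close>. The witness
    \<open>T\<close> for \<open>\<rho>\<close> is enlarged by \<open>\<tau>\<close> itself:
    \<open>T'\<close> is the union of \<open>{T, {\<tau>}}\<close>.\<close>
  obtain \<tau> where \<tau>: "\<tau> \<in> Sets M" "is_upair M \<tau> z z" using upair_exists[OF z(1,1)] by blast
  obtain u where u: "u \<in> Sets M" "is_upair M u \<tau> \<tau>" using upair_exists[OF \<tau>(1,1)] by blast
  obtain v where v: "v \<in> Sets M" "is_upair M v T u" using upair_exists[OF T(1) u(1)] by blast
  have "union M" using GB by (simp add: GB_model_def)
  then obtain T' where T': "T' \<in> Sets M"
    "\<forall>x\<in>Sets M. Mem M x T' \<longleftrightarrow> (\<exists>y\<in>Sets M. Mem M y v \<and> Mem M x y)"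
    using v(1) unfolding union_def by blast
  have T'_iff: "Mem M x T' \<longleftrightarrow> Mem M x T \<or> x = \<tau>" if "x \<in> Sets M" for x
  proof -
    have "Mem M x T' \<longleftrightarrow> (\<exists>y\<in>Sets M. (y = T \<or> y = u) \<and> Mem M x y)"
      using T'(2) v(2) that unfolding is_upair_def by simp
    also have "\<dots> \<longleftrightarrow> Mem M x T \<or> Mem M x u" using T(1) u(1) by blast
    finally show ?thesis using u(2) that unfolding is_upair_def by simp
  qed
  have mem_\<tau>: "Mem M x \<tau> \<longleftrightarrow> is_opair M x \<rho> s" if "x \<in> Sets M" for x
    using that \<tau>(2) z(2) opair_unique[OF _ z(2), of x] unfolding is_upair_def by auto
  have "Mem M \<tau> T'" using T'_iff[OF \<tau>(1)] by simp
  have "set_name M P \<tau>"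
    unfolding set_name_def
  proof (rule conjI[OF \<tau>(1)], rule bexI[OF _ T'(1)], intro conjI ballI impI)
    fix x y assume x: "x \<in> Sets M" "Mem M x T'" and y: "y \<in> Sets M" "Mem M y x"
    have "\<exists>\<rho>\<in>Sets M. \<exists>p\<in>conditions. Mem M \<rho> T \<and> is_opair M y \<rho> p"
    proof (cases "x = \<tau>")
      case True
      then show ?thesis using mem_\<tau> y T(2) \<rho> assms(2) by blast
    next
      case False
      then show ?thesis using T'_iff x y T(3) by blast
    qed
    then show "\<exists>\<rho>\<in>Sets M. \<exists>p\<in>conditions. Mem M \<rho> T' \<and> is_opair M y \<rho> p" using T'_iff by blast
  qed fact+
  then show ?thesis using mem_\<tau> by blast
qed

lemma empty_name: "\<exists>\<tau>. set_name M P \<tau> \<and> (\<forall>z\<in>Sets M. \<not> Mem M z \<tau>)"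
proof -
  have "infinity M" using GB by (simp add: GB_model_def)
  then obtain e where e: "e \<in> Sets M" "\<forall>z\<in>Sets M. \<not> Mem M z e" unfolding infinity_def by blast
  obtain T where "T \<in> Sets M" "is_upair M T e e" using upair_exists[OF e(1,1)] by blast
  then have T: "T \<in> Sets M" "Mem M e T" "\<And>x. x \<in> Sets M \<Longrightarrow> Mem M x T \<Longrightarrow> x = e"
    using e(1) unfolding is_upair_def by simp_all
  have "set_name M P e"
    unfolding set_name_def
  proof (rule conjI[OF e(1)], rule bexI[OF _ T(1)], rule conjI[OF T(2)], intro ballI impI)
    fix \<tau> z assume "\<tau> \<in> Sets M" "Mem M \<tau> T" "z \<in> Sets M" "Mem M z \<tau>"
    then have False using T(3) e(2) by metis
    then show "\<exists>\<rho>\<in>Sets M. \<exists>p\<in>conditions. Mem M \<rho> T \<and> is_opair M z \<rho> p" ..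
  qed
  then show ?thesis using e(2) by blast
qed

text \<open>The names are Zermelo numerals: \<open>f 0\<close> is empty and the only element of
  \<open>f (Suc n)\<close> is the pair of \<open>f n\<close> and \<open>p\<close>, which is active
  at every condition below \<open>p\<close>. An equality of \<open>f (Suc m)\<close> and
  \<open>f n\<close> puts \<open>f m\<close> into \<open>f n\<close>; this is absurd for
  \<open>n = 0\<close>, and for \<open>n = Suc k\<close> it yields equality of \<open>f m\<close>
  and \<open>f k\<close> at a stronger condition, whence the descent on \<open>m\<close>.\<close>

lemma distinct_names:
  assumes p: "p \<in> conditions"
  obtains f :: "nat \<Rightarrow> 'a" where "\<And>n. set_name M P (f n)"
    and "\<And>q m n. q \<in> conditions \<Longrightarrow> q \<preceq> p \<Longrightarrow> m < n \<Longrightarrow> \<not> related3 M E q (f m) (f n)"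
proof -
  obtain e where e: "set_name M P e" "\<forall>z\<in>Sets M. \<not> Mem M z e" using empty_name by blast
  obtain g where g: "\<And>\<rho>. set_name M P \<rho> \<Longrightarrow> set_name M P (g \<rho>)"
    "\<And>\<rho> z. set_name M P \<rho> \<Longrightarrow> z \<in> Sets M \<Longrightarrow> Mem M z (g \<rho>) \<longleftrightarrow> is_opair M z \<rho> p"
    using singleton_name[OF _ p] by metis
  define f where "f = rec_nat e (\<lambda>_ \<rho>. g \<rho>)"
  have f: "f 0 = e" "f (Suc n) = g (f n)" for n by (simp_all add: f_def)
  have names: "set_name M P (f n)" for n by (induction n) (simp_all add: f e(1) g(1))
  have rel0: "\<not> related M (f 0) x y" for x y using e(2) unfolding f related_def by blast
  have relSuc: "related M (f (Suc n)) (f n) p" for n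
  proof -
    obtain z where z: "z \<in> Sets M" "is_opair M z (f n) p"
      using opair_exists[OF set_name_Sets[OF names] conditions_Sets[OF p]] by blast
    then show ?thesis using g(2)[OF names[of n], of z] unfolding f related_iff_Mem[OF z(2)] by simp
  qed
  have relSuc': "x = f n" if r: "related M (f (Suc n)) x y" and "x \<in> Sets M" "y \<in> Sets M" for x y n
  proof -
    obtain z where z: "z \<in> Sets M" "is_opair M z x y" "Mem M z (g (f n))"
      using r unfolding f related_def by blast
    have "is_opair M z (f n) p" using g(2)[OF names z(1), of n] z(3) by simp
    from opair_inject[OF z(2) this that(2,3) set_name_Sets[OF names] conditions_Sets[OF p]]
    show ?thesis by simp
  qed
  have mem: "forces_mem q (f m) (f n)"
    if h: "related3 M E q (f (Suc m)) (f n)" "q \<in> conditions" "q \<preceq> p" for q m n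
  proof -
    have "forces_sub q (f (Suc m)) (f n)"
      using h(1) E_iff_forces_eq[OF h(2) names names] unfolding forces_eq_class_def by simp
    then show ?thesis
      using relSuc[of m] p h(2,3) le_refl[OF h(2)] set_name_Sets[OF names[of m]]
      unfolding sub_clause_def by simp
  qed
  have "\<not> related3 M E q (f m) (f n)" if "q \<in> conditions" "q \<preceq> p" "m < n" for q m n
    using that
  proof (induction m arbitrary: q n)
    case 0
    then obtain k where k: "n = Suc k" by (cases n) auto
    show ?case
    proof
      assume "related3 M E q (f 0) (f n)"
      then have "related3 M E q (f (Suc k)) (f 0)"
        using E_sym 0 names unfolding k by blast
      then have "forces_mem q (f k) (f 0)" using mem 0 by blast
      then show False using rel0 le_refl[OF 0(1)] 0(1) unfolding forces_mem_iff by blast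
    qed
  next
    case (Suc m)
    then obtain k where k: "n = Suc k" "m < k" by (cases n) auto
    show ?case
    proof
      assume "related3 M E q (f (Suc m)) (f n)"
      then have "forces_mem q (f m) (f (Suc k))" using mem Suc.prems unfolding k by blast
      then obtain r \<rho> s where r: "r \<in> conditions" "r \<preceq> q" "\<rho> \<in> Sets M" "s \<in> conditions"
        "related M (f (Suc k)) \<rho> s" "related3 M E r (f m) \<rho>"
        using Suc.prems(1) le_refl[OF Suc.prems(1)] unfolding forces_mem_iff by blast
      then have "related3 M E r (f m) (f k)" using relSuc' conditions_Sets by blast
      moreover have "r \<preceq> p" using le_trans r Suc.prems p by blast
      ultimately show False using Suc.IH r(1) k(2) by blast
    qed
  qed
  then show thesis using that names by blast
qed

end

locale generic_extension = class_forcing M P L E I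
  for M :: "'a structure2" and P L E I :: 'a +
  fixes G :: "'a set"
  assumes generic: "generic_filter M P L G"
begin

section \<open>The quotient of names by forced equality\<close>

abbreviation extension where "extension \<equiv> forcing_extension M P L E I G"

definition set_rel :: "('a \<times> 'a) set" where
  "set_rel = {(\<sigma>, \<tau>). set_name M P \<sigma> \<and> set_name M P \<tau> \<and> (\<exists>p \<in> G. related3 M E p \<sigma> \<tau>)}"

definition class_rel :: "('a \<times> 'a) set" where
  "class_rel = {(\<Gamma>, \<Delta>). class_name M P \<Gamma> \<and> class_name M P \<Delta> \<and> (\<exists>p \<in> G. forces_eq p \<Gamma> \<Delta>)}"

lemma G_conditions: "p \<in> G \<Longrightarrow> p \<in> conditions"
  using generic unfolding generic_filter_def filter_on_def by blast

lemma G_nonempty: "G \<noteq> {}"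
  using generic unfolding generic_filter_def filter_on_def by blast

lemma G_directed: "p \<in> G \<Longrightarrow> q \<in> G \<Longrightarrow> \<exists>r\<in>G. r \<preceq> p \<and> r \<preceq> q"
  using generic unfolding generic_filter_def filter_on_def by blast

lemma G_dense: "dense_subclass M P L D \<Longrightarrow> \<exists>p\<in>G. p \<in> Cond M D"
  using generic unfolding generic_filter_def by blast

lemma equiv_set_rel: "equiv {\<sigma>. set_name M P \<sigma>} set_rel"
proof (rule equivI)
  show "refl_on {\<sigma>. set_name M P \<sigma>} set_rel"
    using E_refl G_conditions G_nonempty unfolding set_rel_def refl_on_def by blast
  show "sym set_rel" using E_sym G_conditions unfolding set_rel_def sym_def by blast
  show "trans set_rel"
  proof (rule transI)
    fix x y z assume "(x, y) \<in> set_rel" "(y, z) \<in> set_rel"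
    then obtain p q where n: "set_name M P x" "set_name M P y" "set_name M P z"
      and p: "p \<in> G" "related3 M E p x y" and q: "q \<in> G" "related3 M E q y z"
      unfolding set_rel_def by blast
    obtain r where r: "r \<in> G" "r \<preceq> p" "r \<preceq> q" using G_directed p q by blast
    have "related3 M E r x y" "related3 M E r y z"
      using E_mono[OF p(2)] E_mono[OF q(2)] n r p(1) q(1) G_conditions by blast+
    then have "related3 M E r x z" using E_trans n r(1) G_conditions by blast
    then show "(x, z) \<in> set_rel" using n r(1) unfolding set_rel_def by blast
  qed
qed (auto simp: set_rel_def)

lemma equiv_class_rel: "equiv {\<Gamma>. class_name M P \<Gamma>} class_rel"
proof (rule equivI)
  show "refl_on {\<Gamma>. class_name M P \<Gamma>} class_rel"
    using forces_eq_refl G_conditions G_nonempty unfolding class_rel_def refl_on_def name_def by blast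
  show "sym class_rel" using forces_eq_sym unfolding class_rel_def sym_def by blast
  show "trans class_rel"
  proof (rule transI)
    fix x y z assume "(x, y) \<in> class_rel" "(y, z) \<in> class_rel"
    then obtain p q where n: "class_name M P x" "class_name M P y" "class_name M P z"
      and p: "p \<in> G" "forces_eq p x y" and q: "q \<in> G" "forces_eq q y z"
      unfolding class_rel_def by blast
    obtain r where r: "r \<in> G" "r \<preceq> p" "r \<preceq> q" using G_directed p q by blast
    have "forces_eq r x y" "forces_eq r y z"
      using forces_eq_mono[OF p(2)] forces_eq_mono[OF q(2)] r p(1) q(1) G_conditions by blast+
    then have "forces_eq r x z" using forces_eq_trans n r(1) G_conditions unfolding name_def by blast
    then show "(x, z) \<in> class_rel" using n r(1) unfolding class_rel_def by blast
  qed
qed (auto simp: class_rel_def)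

definition set_val :: "'a \<Rightarrow> 'a set" where "set_val \<sigma> = set_rel `` {\<sigma>}"
definition class_val :: "'a \<Rightarrow> 'a set" where "class_val \<Gamma> = class_rel `` {\<Gamma>}"

lemma Sets_extension: "Sets extension = set_val ` {\<sigma>. set_name M P \<sigma>}"
  unfolding forcing_extension_def set_rel_def[symmetric] class_rel_def[symmetric]
  by (auto simp: quotient_def set_val_def Let_def)

lemma Classes_extension: "Classes extension = class_val ` {\<Gamma>. class_name M P \<Gamma>}"
  unfolding forcing_extension_def set_rel_def[symmetric] class_rel_def[symmetric]
  by (auto simp: quotient_def class_val_def Let_def)

lemma Mem_extension: "Mem extension x y \<longleftrightarrow> x \<in> Sets extension \<and>
   (y \<in> Sets extension \<and> (\<exists>\<sigma>\<in>x. \<exists>\<tau>\<in>y. \<exists>p\<in>G. related3 M I p \<sigma> \<tau>) \<or>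
    y \<in> Classes extension \<and> (\<exists>\<sigma>\<in>x. \<exists>\<Gamma>\<in>y. \<exists>p\<in>G. forces_mem p \<sigma> \<Gamma>))"
  unfolding forcing_extension_def by (simp add: Let_def)

lemma set_val_eq_iff:
  "set_name M P \<sigma> \<Longrightarrow> set_name M P \<tau> \<Longrightarrow> set_val \<sigma> = set_val \<tau> \<longleftrightarrow> (\<exists>p\<in>G. related3 M E p \<sigma> \<tau>)"
  unfolding set_val_def using eq_equiv_class_iff[OF equiv_set_rel] by (simp add: set_rel_def)

lemma class_val_eq_iff:
  "class_name M P \<Gamma> \<Longrightarrow> class_name M P \<Delta> \<Longrightarrow> class_val \<Gamma> = class_val \<Delta> \<longleftrightarrow> (\<exists>p\<in>G. forces_eq p \<Gamma> \<Delta>)"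
  unfolding class_val_def using eq_equiv_class_iff[OF equiv_class_rel] by (simp add: class_rel_def)

lemma set_val_self: "set_name M P \<sigma> \<Longrightarrow> \<sigma> \<in> set_val \<sigma>"
  unfolding set_val_def using equiv_class_self[OF equiv_set_rel] by simp

lemma class_val_self: "class_name M P \<Gamma> \<Longrightarrow> \<Gamma> \<in> class_val \<Gamma>"
  unfolding class_val_def using equiv_class_self[OF equiv_class_rel] by simp

lemma set_valD: "\<tau> \<in> set_val \<sigma> \<Longrightarrow> set_name M P \<tau> \<and> (\<exists>p\<in>G. related3 M E p \<sigma> \<tau>)"
  unfolding set_val_def set_rel_def by blast

lemma class_valD: "\<Delta> \<in> class_val \<Gamma> \<Longrightarrow> class_name M P \<Delta> \<and> (\<exists>p\<in>G. forces_eq p \<Gamma> \<Delta>)"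
  unfolding class_val_def class_rel_def by blast

text \<open>An equivalence class contains its representative, so a common value would make one
  element of the model both a set and a class. This separates the two alternatives in the membership
  relation of the extension.\<close>

lemma extension_sorts_disjoint: "Sets extension \<inter> Classes extension = {}"
proof -
  have False if "set_name M P \<sigma>" "class_name M P \<Gamma>" "set_val \<sigma> = class_val \<Gamma>" for \<sigma> \<Gamma>
    using set_val_self[OF that(1)] class_valD[of \<sigma> \<Gamma>] that set_name_Sets[of \<sigma>] sorts_disjoint
    unfolding class_name_def by auto
  then show ?thesis unfolding Sets_extension Classes_extension by blast
qed

text \<open>Membership in the extension speaks of some representatives of the two values; this
  carries it over to chosen ones. A condition of \<open>G\<close> below all three given ones is
  reached by using directedness twice.\<close>

lemma forces_mem_val:
  assumes "set_name M P \<sigma>" "set_name M P \<sigma>'" "name A" "name B"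
    and "\<exists>p\<in>G. forces_mem p \<sigma>' B" "\<exists>p\<in>G. related3 M E p \<sigma> \<sigma>'" "\<exists>p\<in>G. forces_eq p A B"
  shows "\<exists>p\<in>G. forces_mem p \<sigma> A"
proof -
  obtain p q r where pqr: "p \<in> G" "q \<in> G" "r \<in> G"
    "forces_mem p \<sigma>' B" "related3 M E q \<sigma> \<sigma>'" "forces_eq r A B"
    using assms(5-7) by blast
  obtain s where s: "s \<in> G" "s \<preceq> p" "s \<preceq> q" using G_directed pqr by blast
  obtain t where t: "t \<in> G" "t \<preceq> s" "t \<preceq> r" using G_directed s pqr by blast
  have c: "p \<in> conditions" "q \<in> conditions" "r \<in> conditions" "s \<in> conditions" "t \<in> conditions"
    using pqr s t G_conditions by blast+
  have "t \<preceq> p" "t \<preceq> q" using le_trans t s c by blast+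
  then have "forces_mem t \<sigma>' B" "related3 M E t \<sigma> \<sigma>'" "forces_eq t A B"
    using forces_mem_mono E_mono forces_eq_mono pqr c t assms by blast+
  then have "forces_mem t \<sigma> A"
    using forces_mem_cong_left forces_mem_cong_right forces_eq_sym c assms by blast
  then show ?thesis using t by blast
qed

lemma Mem_extension_set:
  assumes "set_name M P \<sigma>" "set_name M P \<tau>"
  shows "Mem extension (set_val \<sigma>) (set_val \<tau>) \<longleftrightarrow> (\<exists>p\<in>G. forces_mem p \<sigma> \<tau>)"
proof
  assume "Mem extension (set_val \<sigma>) (set_val \<tau>)"
  moreover have "set_val \<tau> \<notin> Classes extension"
    using extension_sorts_disjoint assms unfolding Sets_extension by blast
  ultimately obtain \<sigma>' \<tau>' p where *: "\<sigma>' \<in> set_val \<sigma>" "\<tau>' \<in> set_val \<tau>" "p \<in> G" "related3 M I p \<sigma>' \<tau>'"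
    unfolding Mem_extension by blast
  then have "forces_mem p \<sigma>' \<tau>'" using I_iff_forces_mem G_conditions set_valD by blast
  moreover obtain q where "q \<in> G" "related3 M E q \<tau> \<tau>'" using set_valD *(2) by blast
  moreover have "forces_eq q \<tau> \<tau>'"
    using E_iff_forces_eq[of q \<tau> \<tau>'] calculation G_conditions assms set_valD[OF *(2)] by blast
  ultimately show "\<exists>p\<in>G. forces_mem p \<sigma> \<tau>"
    using forces_mem_val[of \<sigma> \<sigma>' \<tau> \<tau>'] assms set_valD[OF *(1)] set_valD[OF *(2)] *(3)
    unfolding name_def by blast
next
  assume "\<exists>p\<in>G. forces_mem p \<sigma> \<tau>"
  then have "\<exists>p\<in>G. related3 M I p \<sigma> \<tau>" using I_iff_forces_mem G_conditions assms by blast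
  then show "Mem extension (set_val \<sigma>) (set_val \<tau>)"
    using assms set_val_self unfolding Mem_extension Sets_extension by blast
qed

lemma Mem_extension_class:
  assumes "set_name M P \<sigma>" "class_name M P \<Gamma>"
  shows "Mem extension (set_val \<sigma>) (class_val \<Gamma>) \<longleftrightarrow> (\<exists>p\<in>G. forces_mem p \<sigma> \<Gamma>)"
proof
  assume "Mem extension (set_val \<sigma>) (class_val \<Gamma>)"
  moreover have "class_val \<Gamma> \<notin> Sets extension"
    using extension_sorts_disjoint assms unfolding Classes_extension by blast
  ultimately obtain \<sigma>' \<Gamma>' p where *: "\<sigma>' \<in> set_val \<sigma>" "\<Gamma>' \<in> class_val \<Gamma>" "p \<in> G" "forces_mem p \<sigma>' \<Gamma>'"
    unfolding Mem_extension by blast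
  then show "\<exists>p\<in>G. forces_mem p \<sigma> \<Gamma>"
    using forces_mem_val[of \<sigma> \<sigma>' \<Gamma> \<Gamma>'] assms set_valD[OF *(1)] class_valD[OF *(2)]
    unfolding name_def by blast
next
  assume "\<exists>p\<in>G. forces_mem p \<sigma> \<Gamma>"
  then show "Mem extension (set_val \<sigma>) (class_val \<Gamma>)"
    using assms set_val_self class_val_self unfolding Mem_extension Sets_extension Classes_extension by blast
qed

text \<open>Conjunction needs only directedness and monotonicity, and a set quantifier ranges over
  values of names. Negation is the case in which the forcing relation for fixed names has to be a
  class of the model.\<close>

lemma truth:
  assumes "delta10 \<phi>" "fits \<phi> (length xs) (length ys)" "names_for xs ys"
  shows "sat extension \<phi> (map set_val xs) (map class_val ys) \<longleftrightarrow> (\<exists>p\<in>G. forces \<phi> ys p xs)"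
  using assms
proof (induction \<phi> arbitrary: xs)
  case (EqS i j)
  then show ?case using set_val_eq_iff names_for_nth G_conditions by auto
next
  case (EqC i j)
  then show ?case using class_val_eq_iff names_for_nth G_conditions by auto
next
  case (InS i j)
  then show ?case using Mem_extension_set names_for_nth G_conditions by auto
next
  case (InC i j)
  then show ?case using Mem_extension_class names_for_nth G_conditions by auto
next
  case (Neg \<phi>)
  obtain X where X: "X \<in> Classes M" "\<forall>p\<in>Sets M. Mem M p X \<longleftrightarrow> forces \<phi> ys p xs"
    using forces_class[of \<phi> xs ys] Neg.prems by auto
  obtain Y where Y: "Y \<in> Classes M" "\<forall>p\<in>Sets M. Mem M p Y \<longleftrightarrow> forces (Neg \<phi>) ys p xs"
    using forces_class[of "Neg \<phi>" xs ys] Neg.prems by auto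
  \<comment> \<open>\<open>D\<close> consists of the conditions deciding \<open>\<phi>\<close>: a
    condition that does not force the negation has an extension forcing \<open>\<phi>\<close>, hence
    density.\<close>
  have "definable (Suc 0) (Suc (Suc 0)) (\<lambda>xs ys. Mem M (hd xs) (ys ! 0) \<or> Mem M (hd xs) (ys ! 1))"
    by (intro definable_intros) simp_all
  then have "\<exists>D\<in>Classes M. \<forall>p\<in>Sets M. Mem M p D \<longleftrightarrow> Mem M p ([X, Y] ! 0) \<or> Mem M p ([X, Y] ! 1)"
    by (rule comprehension[where xs = "[]"]) (use X Y in simp_all)
  then obtain D where D: "D \<in> Classes M"
    "\<And>p. p \<in> Sets M \<Longrightarrow> Mem M p D \<longleftrightarrow> forces \<phi> ys p xs \<or> forces (Neg \<phi>) ys p xs"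
    using X(2) Y(2) by auto
  have "dense_subclass M P L D"
    unfolding dense_subclass_def
  proof (intro conjI ballI)
    show "Cond M D \<subseteq> conditions"
      using D(2) forces_condition unfolding Cond_def by blast
    fix p assume p: "p \<in> conditions"
    show "\<exists>q\<in>Cond M D. q \<preceq> p"
    proof (cases "forces (Neg \<phi>) ys p xs")
      case True
      then show ?thesis using D(2) le_refl p conditions_Sets unfolding Cond_def by blast
    next
      case False
      then obtain q where "q \<in> conditions" "q \<preceq> p" "forces \<phi> ys q xs" using p by auto
      then show ?thesis using D(2) conditions_Sets unfolding Cond_def by blast
    qed
  qed (rule D(1))
  then obtain p where p: "p \<in> G" "forces \<phi> ys p xs \<or> forces (Neg \<phi>) ys p xs"
    using G_dense D(2) unfolding Cond_def by blast
  have "False" if qr: "q \<in> G" "forces \<phi> ys q xs" "r \<in> G" "forces (Neg \<phi>) ys r xs" for q r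
  proof -
    obtain s where s: "s \<in> G" "s \<preceq> q" "s \<preceq> r" using G_directed qr by blast
    then have "forces \<phi> ys s xs" using forces_mono that Neg.prems G_conditions by auto
    then show False using that(4) s G_conditions by auto
  qed
  then show ?case using Neg p by auto
next
  case (And \<phi> \<psi>)
  have "(\<exists>p\<in>G. forces \<phi> ys p xs \<and> forces \<psi> ys p xs)" 
    if qr: "q \<in> G" "forces \<phi> ys q xs" "r \<in> G" "forces \<psi> ys r xs" for q r
  proof -
    obtain s where s: "s \<in> G" "s \<preceq> q" "s \<preceq> r" using G_directed qr by blast
    then have "forces \<phi> ys s xs" "forces \<psi> ys s xs"
      using forces_mono[OF qr(2)] forces_mono[OF qr(4)] And.prems G_conditions by auto
    then show ?thesis using s(1) by blast
  qed
  then show ?case using And by auto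
next
  case (ExS \<phi>)
  have "sat extension (ExS \<phi>) (map set_val xs) (map class_val ys) \<longleftrightarrow>
    (\<exists>\<sigma>. set_name M P \<sigma> \<and> sat extension \<phi> (map set_val (\<sigma> # xs)) (map class_val ys))"
    unfolding sat.simps Sets_extension by auto
  also have "\<dots> \<longleftrightarrow> (\<exists>\<sigma>. set_name M P \<sigma> \<and> (\<exists>p\<in>G. forces \<phi> ys p (\<sigma> # xs)))"
    using ExS.IH[of "_ # xs"] ExS.prems by (auto simp: names_for_Cons)
  also have "\<dots> \<longleftrightarrow> (\<exists>p\<in>G. forces (ExS \<phi>) ys p xs)"
    using set_name_Sets by auto
  finally show ?case .
qed simp

lemma infinite_extension: "infinite (Sets extension)"
proof -
  obtain p where p: "p \<in> G" using G_nonempty by blast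
  obtain f :: "nat \<Rightarrow> 'a" where f: "\<And>n. set_name M P (f n)"
    "\<And>q m n. q \<in> conditions \<Longrightarrow> q \<preceq> p \<Longrightarrow> m < n \<Longrightarrow> \<not> related3 M E q (f m) (f n)"
    using distinct_names[OF G_conditions[OF p]] by blast
  have ne: "set_val (f m) \<noteq> set_val (f n)" if "m < n" for m n
  proof
    assume "set_val (f m) = set_val (f n)"
    then obtain q where q: "q \<in> G" "related3 M E q (f m) (f n)" using set_val_eq_iff f(1) by blast
    obtain r where r: "r \<in> G" "r \<preceq> p" "r \<preceq> q" using G_directed p q by blast
    then have "related3 M E r (f m) (f n)" using E_mono q f(1) G_conditions by blast
    then show False using f(2) r that G_conditions by blast
  qed
  have "inj (\<lambda>n. set_val (f n))" by (rule linorder_injI) (rule ne)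
  moreover have "range (\<lambda>n. set_val (f n)) \<subseteq> Sets extension" using f(1) unfolding Sets_extension by auto
  ultimately show ?thesis using finite_imageD finite_subset infinite_UNIV_nat by blast
qed

end

section \<open>Computing with classes\<close>

locale gb_omega = gb M ps for M :: "nat structure2" and ps +
  assumes omega: "on_omega M"
begin

abbreviation diagram where "diagram \<equiv> delta10_diagram M"

lemma computable_list_encode:
  "list_all (computable A) fs \<Longrightarrow> computable A (\<lambda>x. list_encode (map (\<lambda>f. f x) fs))"
  by (induction fs) (auto intro!: computable_intros)

text \<open>A single query: the formula code and the parameters \<open>ps\<close> are constants, the
  other entries are computed. Membership in the diagram includes the sorts of all entries, so the
  sort conditions come with the answer.\<close>

lemma decidable_definable:
  assumes "definable m n R" "length fs = m" "length gs = n"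
    and "list_all (computable diagram) fs" "list_all (computable diagram) gs"
  shows "decidable diagram (\<lambda>x. set (map (\<lambda>f. f x) fs) \<subseteq> Sets M \<and> set (map (\<lambda>g. g x) gs) \<subseteq> Classes M \<and>
    R (map (\<lambda>f. f x) fs) (map (\<lambda>g. g x) gs))"
proof -
  from assms(1) obtain \<phi> where \<phi>: "delta10 \<phi>" "fits \<phi> m (length ps + n)"
    "\<And>xs ys. length xs = m \<Longrightarrow> length ys = n \<Longrightarrow> set xs \<subseteq> Sets M \<Longrightarrow> set ys \<subseteq> Classes M \<Longrightarrow>
      sat M \<phi> xs (ps @ ys) \<longleftrightarrow> R xs ys"
    unfolding definable_def by blast
  have "computable diagram (\<lambda>x. list_encode (map (\<lambda>g. g x) (map (\<lambda>p x. p) ps @ gs)))"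
    using assms(5) by (intro computable_list_encode) (auto simp: list_all_iff intro: computable_const)
  then have "computable diagram (\<lambda>x. list_encode (ps @ map (\<lambda>g. g x) gs))"
    by (simp add: comp_def)
  then have "decidable diagram (\<lambda>x. prod_encode (fm_code \<phi>, prod_encode
      (list_encode (map (\<lambda>f. f x) fs), list_encode (ps @ map (\<lambda>g. g x) gs))) \<in> diagram)"
    using assms(4) by (intro computable_oracle computable_pair computable_const computable_list_encode)
  then show ?thesis
  proof (rule back_subst[of "decidable diagram"], intro ext)
    fix x
    show "prod_encode (fm_code \<phi>, prod_encode
      (list_encode (map (\<lambda>f. f x) fs), list_encode (ps @ map (\<lambda>g. g x) gs))) \<in> diagram \<longleftrightarrow>
      set (map (\<lambda>f. f x) fs) \<subseteq> Sets M \<and> set (map (\<lambda>g. g x) gs) \<subseteq> Classes M \<and>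
      R (map (\<lambda>f. f x) fs) (map (\<lambda>g. g x) gs)"
      unfolding delta10_diagram_iff
      using \<phi>(1,2) \<phi>(3)[of "map (\<lambda>f. f x) fs" "map (\<lambda>g. g x) gs"] assms(2,3) params by auto
  qed
qed

text \<open>Together with \<open>decidable_definable\<close> this tests the sorts alone. Atomic
  formulas need variables, so a closed truth is made with a quantifier.\<close>

lemma definable_True: "definable m n (\<lambda>xs ys. True)"
  by (rule definableI[of "Neg (ExS (And (EqS 0 0) (Neg (EqS 0 0))))"]) auto

text \<open>Comprehension as a total operation on numbers. Whether a candidate class has the right
  elements is itself expressed with set quantifiers only, so the oracle can check candidates one by
  one; on parameters of the wrong sort the condition is vacuous and the search stops at
  once.\<close>

definition compr :: "(nat \<Rightarrow> nat list \<Rightarrow> nat list \<Rightarrow> bool) \<Rightarrow> nat list \<Rightarrow> nat list \<Rightarrow> nat" where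
  "compr Q xs ys = (LEAST X. set xs \<subseteq> Sets M \<and> set ys \<subseteq> Classes M \<longrightarrow>
     X \<in> Classes M \<and> (\<forall>z\<in>Sets M. Mem M z X \<longleftrightarrow> Q z xs ys))"

lemma compr_exists:
  assumes "definable (Suc m) n (\<lambda>xs ys. Q (hd xs) (tl xs) ys)" "length xs = m" "length ys = n"
  shows "\<exists>X. set xs \<subseteq> Sets M \<and> set ys \<subseteq> Classes M \<longrightarrow>
    X \<in> Classes M \<and> (\<forall>z\<in>Sets M. Mem M z X \<longleftrightarrow> Q z xs ys)"
  using comprehension[OF assms] by blast

lemma compr:
  assumes "definable (Suc m) n (\<lambda>xs ys. Q (hd xs) (tl xs) ys)" "length xs = m" "length ys = n"
    "set xs \<subseteq> Sets M" "set ys \<subseteq> Classes M"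
  shows "compr Q xs ys \<in> Classes M" "z \<in> Sets M \<Longrightarrow> Mem M z (compr Q xs ys) \<longleftrightarrow> Q z xs ys"
  using LeastI_ex[OF compr_exists[OF assms(1-3)]] assms(4,5) unfolding compr_def by blast+

lemma computable_compr:
  assumes Q: "definable (Suc m) n (\<lambda>xs ys. Q (hd xs) (tl xs) ys)" and "length fs = m" "length gs = n"
    and fs: "list_all (computable diagram) fs" and gs: "list_all (computable diagram) gs"
  shows "computable diagram (\<lambda>x. compr Q (map (\<lambda>f. f x) fs) (map (\<lambda>g. g x) gs))"
  unfolding compr_def
proof (rule computable_Least)
  let ?fs = "map (\<lambda>f z. f (psnd z)) fs" and ?gs = "map (\<lambda>g z. g (psnd z)) gs"
  have psnd: "computable diagram (\<lambda>z. f (psnd z))" if "f \<in> set fs \<union> set gs" for f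
    using that fs gs unfolding list_all_iff
    by (intro computable_comp[of diagram f psnd] computable_psnd_self) auto
  have "definable m (Suc n) (\<lambda>xs ys. \<forall>z\<in>Sets M. Mem M z (ys ! n) \<longleftrightarrow> Q z xs (take n ys))"
    by (intro definable_Ball definable_iff definable_Mem svar_hd var_nth_class
        definable_take[OF Q, of "Suc n", simplified]) simp
  from decidable_definable[OF this, of ?fs "?gs @ [pfst]"]
  have 1: "decidable diagram (\<lambda>x. set (map (\<lambda>f. f (psnd x)) fs) \<subseteq> Sets M \<and>
      pfst x \<in> Classes M \<and> set (map (\<lambda>f. f (psnd x)) gs) \<subseteq> Classes M \<and>
      (\<forall>z\<in>Sets M. Mem M z (pfst x) \<longleftrightarrow> Q z (map (\<lambda>f. f (psnd x)) fs) (map (\<lambda>f. f (psnd x)) gs)))"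
    using assms(2,3) psnd by (simp add: comp_def nth_append list_all_iff computable_pfst_self)
  \<comment> \<open>The guard is decided on its own, since the query for the candidate also answers
    no when a parameter has the wrong sort.\<close>
  from decidable_definable[OF definable_True, of ?fs m ?gs n]
  have 2: "decidable diagram (\<lambda>x. set (map (\<lambda>f. f (psnd x)) fs) \<subseteq> Sets M \<and>
      set (map (\<lambda>f. f (psnd x)) gs) \<subseteq> Classes M)"
    using assms(2,3) psnd by (simp add: comp_def list_all_iff)
  show "decidable diagram (\<lambda>z. set (map (\<lambda>f. f (psnd z)) fs) \<subseteq> Sets M \<and>
      set (map (\<lambda>g. g (psnd z)) gs) \<subseteq> Classes M \<longrightarrow> pfst z \<in> Classes M \<and>
      (\<forall>x\<in>Sets M. Mem M x (pfst z) \<longleftrightarrow> Q x (map (\<lambda>f. f (psnd z)) fs) (map (\<lambda>g. g (psnd z)) gs)))"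
    by (rule back_subst[of "decidable diagram", OF decidable_imp[OF 2 1]]) blast
qed (rule compr_exists[OF Q], use assms(2,3) in simp_all)

definition compr2 :: "(nat \<Rightarrow> nat \<Rightarrow> nat list \<Rightarrow> nat list \<Rightarrow> bool) \<Rightarrow> nat list \<Rightarrow> nat list \<Rightarrow> nat" where
  "compr2 Q = compr (\<lambda>z xs ys. \<exists>x\<in>Sets M. \<exists>y\<in>Sets M. is_opair M z x y \<and> Q x y xs ys)"

text \<open>From the top of the list the pushed variables are \<open>y\<close>, \<open>x\<close> and
  the pair \<open>z\<close>. The relation does not mention \<open>z\<close>, hence the three tails
  before its own parameters.\<close>

lemma definable_compr2:
  assumes "definable (Suc (Suc (Suc m))) n (\<lambda>xs ys. Q (hd (tl xs)) (hd xs) (tl (tl (tl xs))) ys)"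
  shows "definable (Suc m) n (\<lambda>xs ys. \<exists>x\<in>Sets M. \<exists>y\<in>Sets M. is_opair M (hd xs) x y \<and> Q x y (tl xs) ys)"
  by (intro definable_Bex definable_conj definable_is_opair svar_hd svar_tl assms(1))

lemma compr2:
  assumes "definable (Suc (Suc (Suc m))) n (\<lambda>xs ys. Q (hd (tl xs)) (hd xs) (tl (tl (tl xs))) ys)"
    "length xs = m" "length ys = n" "set xs \<subseteq> Sets M" "set ys \<subseteq> Classes M"
  shows "compr2 Q xs ys \<in> Classes M"
    and "x \<in> Sets M \<Longrightarrow> y \<in> Sets M \<Longrightarrow> related M (compr2 Q xs ys) x y \<longleftrightarrow> Q x y xs ys"
proof -
  note c = compr[OF definable_compr2[OF assms(1)] assms(2-), folded compr2_def]
  show "compr2 Q xs ys \<in> Classes M" by (rule c(1))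
  assume xy: "x \<in> Sets M" "y \<in> Sets M"
  obtain z where z: "z \<in> Sets M" "is_opair M z x y" using opair_exists[OF xy] by blast
  show "related M (compr2 Q xs ys) x y \<longleftrightarrow> Q x y xs ys"
    unfolding related_iff_Mem[OF z(2)] c(2)[OF z(1)] using opair_inject[OF z(2)] z(2) xy by blast
qed

lemma computable_compr2:
  assumes "definable (Suc (Suc (Suc m))) n (\<lambda>xs ys. Q (hd (tl xs)) (hd xs) (tl (tl (tl xs))) ys)"
    and "length fs = m" "length gs = n"
    and "list_all (computable diagram) fs" "list_all (computable diagram) gs"
  shows "computable diagram (\<lambda>x. compr2 Q (map (\<lambda>f. f x) fs) (map (\<lambda>g. g x) gs))"
  unfolding compr2_def by (rule computable_compr[OF definable_compr2[OF assms(1)] assms(2-)])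

end

locale forcing_omega = class_forcing M P L E I for M :: "nat structure2" and P L E I :: nat +
  assumes on_omega_M: "on_omega M"

sublocale forcing_omega \<subseteq> gb_omega M "[P, L, E, I]"
  by unfold_locales (rule on_omega_M)

context forcing_omega
begin

section \<open>Decidability of names, conditions and density\<close>

lemma decidable_in_Sets:
  assumes "computable diagram f" shows "decidable diagram (\<lambda>x. f x \<in> Sets M)"
  using decidable_definable[OF definable_True, of "[f]" "Suc 0" "[]" 0] assms by simp

lemma decidable_in_Classes:
  assumes "computable diagram f" shows "decidable diagram (\<lambda>x. f x \<in> Classes M)"
  using decidable_definable[OF definable_True, of "[]" 0 "[f]" "Suc 0"] assms by simp

lemma decidable_set_name:
  assumes "computable diagram f" shows "decidable diagram (\<lambda>x. set_name M P (f x))"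
proof -
  have "definable (Suc 0) 0 (\<lambda>xs ys. set_name M P (xs ! 0))"
    by (intro definable_intros) simp_all
  from decidable_definable[OF this, of "[f]" "[]"] assms
  have "decidable diagram (\<lambda>x. f x \<in> Sets M \<and> set_name M P (f x))" by simp
  then show ?thesis by (rule back_subst[of "decidable diagram"]) (auto dest: set_name_Sets)
qed

lemma decidable_class_name:
  assumes "computable diagram f" shows "decidable diagram (\<lambda>x. class_name M P (f x))"
proof -
  have "definable 0 (Suc 0) (\<lambda>xs ys. class_name M P (ys ! 0))"
    by (intro definable_intros) simp_all
  from decidable_definable[OF this, of "[]" "[f]"] assms
  have "decidable diagram (\<lambda>x. f x \<in> Classes M \<and> class_name M P (f x))" by simp
  then show ?thesis by (rule back_subst[of "decidable diagram"]) (auto simp: class_name_def)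
qed

lemma decidable_condition:
  assumes "computable diagram f" shows "decidable diagram (\<lambda>x. f x \<in> conditions)"
proof -
  have "definable (Suc 0) 0 (\<lambda>xs ys. xs ! 0 \<in> conditions)"
    by (intro definable_intros) simp_all
  from decidable_definable[OF this, of "[f]" "[]"] assms
  have "decidable diagram (\<lambda>x. f x \<in> Sets M \<and> f x \<in> conditions)" by simp
  then show ?thesis by (rule back_subst[of "decidable diagram"]) (auto dest: conditions_Sets)
qed

lemma decidable_dense:
  assumes "computable diagram f" shows "decidable diagram (\<lambda>x. dense_subclass M P L (f x))"
proof -
  have "definable 0 (Suc 0) (\<lambda>xs ys. (\<forall>q\<in>Cond M (ys ! 0). q \<in> conditions) \<and>
      (\<forall>p\<in>conditions. \<exists>q\<in>Cond M (ys ! 0). q \<preceq> p))"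
    by (intro definable_intros) simp_all
  from decidable_definable[OF this, of "[]" "[f]"] assms
  have "decidable diagram (\<lambda>x. f x \<in> Classes M \<and> (\<forall>q\<in>Cond M (f x). q \<in> conditions) \<and>
      (\<forall>p\<in>conditions. \<exists>q\<in>Cond M (f x). q \<preceq> p))" by simp
  then show ?thesis
    by (rule back_subst[of "decidable diagram"]) (auto simp: dense_subclass_def subset_iff)
qed

section \<open>A descending sequence and the filter it generates\<close>

definition extend :: "nat \<Rightarrow> nat \<Rightarrow> nat" where
  "extend D p = (LEAST q. if p \<in> conditions \<and> dense_subclass M P L D then q \<in> Cond M D \<and> q \<preceq> p else q = p)"

lemma extend_exists:
  "\<exists>q. if p \<in> conditions \<and> dense_subclass M P L D then q \<in> Cond M D \<and> q \<preceq> p else q = p"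
  by (cases "p \<in> conditions \<and> dense_subclass M P L D") (auto simp: dense_subclass_def)

lemma extend:
  "p \<in> conditions \<Longrightarrow> dense_subclass M P L D \<Longrightarrow> extend D p \<in> Cond M D \<and> extend D p \<preceq> p"
  "\<not> dense_subclass M P L D \<Longrightarrow> extend D p = p"
  using LeastI_ex[OF extend_exists[of p D]] unfolding extend_def[symmetric] by simp_all

lemma computable_extend:
  assumes "computable diagram f" "computable diagram g"
  shows "computable diagram (\<lambda>x. extend (f x) (g x))"
proof (rule computable_comp2[OF _ assms])
  have "definable (Suc (Suc 0)) (Suc 0) (\<lambda>xs ys. xs ! 0 \<in> Cond M (ys ! 0) \<and> xs ! 0 \<preceq> xs ! 1)"
    by (intro definable_intros) simp_all
  from decidable_definable[OF this, of "[pfst, \<lambda>x. psnd (psnd x)]" "[\<lambda>x. pfst (psnd x)]"]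
  have step: "decidable diagram (\<lambda>x. pfst x \<in> Sets M \<and> psnd (psnd x) \<in> Sets M \<and> pfst (psnd x) \<in> Classes M \<and>
      pfst x \<in> Cond M (pfst (psnd x)) \<and> pfst x \<preceq> psnd (psnd x))"
    by (simp add: computable_pfst_self computable_psnd_self computable_pfst computable_psnd)
  have "decidable diagram (\<lambda>x.
      (psnd (psnd x) \<in> conditions \<and> dense_subclass M P L (pfst (psnd x))) \<and>
        (pfst x \<in> Sets M \<and> psnd (psnd x) \<in> Sets M \<and> pfst (psnd x) \<in> Classes M \<and>
         pfst x \<in> Cond M (pfst (psnd x)) \<and> pfst x \<preceq> psnd (psnd x)) \<or>
      \<not> (psnd (psnd x) \<in> conditions \<and> dense_subclass M P L (pfst (psnd x))) \<and> pfst x = psnd (psnd x))"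
    by (intro decidable_disj[OF decidable_conj[OF _ step]]
        computable_intros decidable_condition decidable_dense)
  then show "computable diagram (\<lambda>z. extend (pfst z) (psnd z))"
    unfolding extend_def
  proof (intro computable_Least extend_exists, elim back_subst[of "decidable diagram"], intro ext)
    fix x
    show "((psnd (psnd x) \<in> conditions \<and> dense_subclass M P L (pfst (psnd x))) \<and>
        (pfst x \<in> Sets M \<and> psnd (psnd x) \<in> Sets M \<and> pfst (psnd x) \<in> Classes M \<and>
         pfst x \<in> Cond M (pfst (psnd x)) \<and> pfst x \<preceq> psnd (psnd x)) \<or>
      \<not> (psnd (psnd x) \<in> conditions \<and> dense_subclass M P L (pfst (psnd x))) \<and> pfst x = psnd (psnd x)) =
      (if psnd (psnd x) \<in> conditions \<and> dense_subclass M P L (pfst (psnd x))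
       then pfst x \<in> Cond M (pfst (psnd x)) \<and> pfst x \<preceq> psnd (psnd x) else pfst x = psnd (psnd x))"
      unfolding dense_subclass_def Cond_def by auto
  qed
qed

text \<open>Any condition will do; being one fixed number, it is a constant for programs. It also
  ends coded tuples and fills dummy parameter lists, as a set known to exist.\<close>

definition start :: nat where "start = (SOME p. p \<in> conditions)"

lemma start: "start \<in> conditions"
  using forcing_notion unfolding class_forcing_notion_def start_def some_in_eq by simp

definition generic_seq :: "nat \<Rightarrow> nat" where
  "generic_seq n = rec_nat start extend n"

lemma computable_generic_seq: "computable diagram f \<Longrightarrow> computable diagram (\<lambda>x. generic_seq (f x))"
  unfolding generic_seq_def
  by (intro computable_rec_nat[where h = "\<lambda>n r x. extend n r"] computable_extend computable_intros)

lemma generic_seq_Suc: "generic_seq (Suc n) = extend n (generic_seq n)"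
  by (simp add: generic_seq_def)

lemma generic_seq_condition: "generic_seq n \<in> conditions"
proof (induction n)
  case (Suc n)
  have "dense_subclass M P L n \<Longrightarrow> Cond M n \<subseteq> conditions" by (simp add: dense_subclass_def)
  then show ?case
    using Suc extend(1)[OF Suc, of n] extend(2)[of n "generic_seq n"] unfolding generic_seq_Suc
    by (cases "dense_subclass M P L n") auto
qed (simp add: generic_seq_def start)

lemma generic_seq_step: "generic_seq (Suc n) \<preceq> generic_seq n"
  using extend(1)[OF generic_seq_condition, of n n] extend(2)[of n "generic_seq n"]
    le_refl[OF generic_seq_condition[of n]]
  unfolding generic_seq_Suc by (cases "dense_subclass M P L n") auto

lemma generic_seq_decreasing: "m \<le> n \<Longrightarrow> generic_seq n \<preceq> generic_seq m"
proof (induction n rule: dec_induct)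
  case base
  show ?case by (rule le_refl[OF generic_seq_condition])
next
  case (step n)
  then show ?case using le_trans generic_seq_step generic_seq_condition by blast
qed

definition G :: "nat set" where
  "G = {p \<in> conditions. \<exists>n. generic_seq n \<preceq> p}"

lemma generic_seq_in_G: "generic_seq n \<in> G"
  using generic_seq_condition le_refl unfolding G_def by blast

lemma generic_G: "generic_filter M P L G"
  unfolding generic_filter_def filter_on_def
proof (intro conjI allI impI ballI)
  show "G \<noteq> {}" using generic_seq_in_G by blast
  fix D assume "dense_subclass M P L D"
  then have "generic_seq (Suc D) \<in> Cond M D"
    using extend(1) generic_seq_condition unfolding generic_seq_Suc by blast
  then show "G \<inter> Cond M D \<noteq> {}" using generic_seq_in_G by blast
next
  fix p q assume "p \<in> G" "q \<in> conditions" "p \<preceq> q"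
  then show "q \<in> G" using le_trans generic_seq_condition unfolding G_def by blast
next
  fix p q assume "p \<in> G" "q \<in> G"
  then obtain m n where mn: "generic_seq m \<preceq> p" "generic_seq n \<preceq> q" "p \<in> conditions" "q \<in> conditions"
    unfolding G_def by blast
  have "generic_seq (max m n) \<preceq> p" "generic_seq (max m n) \<preceq> q"
    using le_trans[OF generic_seq_decreasing[of m "max m n"] mn(1)]
      le_trans[OF generic_seq_decreasing[of n "max m n"] mn(2)] mn generic_seq_condition by auto
  then show "\<exists>r\<in>G. r \<preceq> p \<and> r \<preceq> q" using generic_seq_in_G by blast
qed (simp add: G_def)

end

sublocale forcing_omega \<subseteq> generic_extension M P L E I G
  by unfold_locales (rule generic_G)

context forcing_omega
begin

section \<open>Deciding whether the filter meets a class\<close>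

definition decision_stage :: "nat \<Rightarrow> nat" where
  "decision_stage K = (LEAST n. K \<in> Classes M \<longrightarrow> Mem M (generic_seq n) K \<or>
     \<not> (\<exists>q\<in>conditions. q \<preceq> generic_seq n \<and> Mem M q K))"

text \<open>The conditions that lie in \<open>K\<close> or have no extension in \<open>K\<close>
  form a dense class \<open>D\<close>, which the sequence enters at index \<open>Suc D\<close>. For
  a \<open>K\<close> that is not a class the guard ends the search at 0.\<close>

lemma decision_stage_exists:
  "\<exists>n. K \<in> Classes M \<longrightarrow> Mem M (generic_seq n) K \<or>
     \<not> (\<exists>q\<in>conditions. q \<preceq> generic_seq n \<and> Mem M q K)"
proof (cases "K \<in> Classes M")
  case True
  have "definable (Suc 0) (Suc 0) (\<lambda>xs ys. hd xs \<in> conditions \<and> (Mem M (hd xs) (ys ! 0) \<or>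
      \<not> (\<exists>q\<in>conditions. q \<preceq> hd xs \<and> Mem M q (ys ! 0))))"
    by (intro definable_intros) simp_all
  then have "\<exists>D\<in>Classes M. \<forall>p\<in>Sets M. Mem M p D \<longleftrightarrow> p \<in> conditions \<and> (Mem M p ([K] ! 0) \<or>
      \<not> (\<exists>q\<in>conditions. q \<preceq> p \<and> Mem M q ([K] ! 0)))"
    by (rule comprehension[where xs = "[]"]) (use True in simp_all)
  then obtain D where D: "D \<in> Classes M" "\<And>p. p \<in> Sets M \<Longrightarrow> Mem M p D \<longleftrightarrow> p \<in> conditions \<and>
      (Mem M p K \<or> \<not> (\<exists>q\<in>conditions. q \<preceq> p \<and> Mem M q K))"
    by auto
  have D_iff: "p \<in> Cond M D \<longleftrightarrow> p \<in> conditions \<and>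
      (Mem M p K \<or> \<not> (\<exists>q\<in>conditions. q \<preceq> p \<and> Mem M q K))" for p
    using D(2) conditions_Sets unfolding Cond_def by blast
  have dense: "dense_subclass M P L D"
    unfolding dense_subclass_def
  proof (intro conjI ballI)
    fix p assume p: "p \<in> conditions"
    show "\<exists>q\<in>Cond M D. q \<preceq> p"
      unfolding Bex_def D_iff using p le_refl by blast
  qed (use D D_iff in auto)
  then have "generic_seq (Suc D) \<in> Cond M D"
    using extend(1) generic_seq_condition unfolding generic_seq_Suc by blast
  then show ?thesis unfolding D_iff by blast
qed simp

definition met :: "nat \<Rightarrow> bool" where
  "met K \<longleftrightarrow> K \<in> Classes M \<and> Mem M (generic_seq (decision_stage K)) K"

text \<open>Suppose the search stops at a condition with no extension in \<open>K\<close>. A member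
  of \<open>G\<close> in \<open>K\<close> would have a common extension with it in \<open>G\<close>,
  and that extension would lie in \<open>K\<close> by downward closure.\<close>

lemma met_iff:
  assumes "K \<in> Classes M"
    and down: "\<And>p q. p \<in> conditions \<Longrightarrow> q \<in> conditions \<Longrightarrow> q \<preceq> p \<Longrightarrow> Mem M p K \<Longrightarrow> Mem M q K"
  shows "met K \<longleftrightarrow> (\<exists>p\<in>G. Mem M p K)"
proof
  assume "met K"
  then show "\<exists>p\<in>G. Mem M p K" using generic_seq_in_G unfolding met_def by blast
next
  assume "\<exists>p\<in>G. Mem M p K"
  then obtain p where p: "p \<in> G" "Mem M p K" by blast
  obtain r where r: "r \<in> G" "r \<preceq> p" "r \<preceq> generic_seq (decision_stage K)"
    using G_directed[OF p(1) generic_seq_in_G] by blast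
  have "Mem M r K" "r \<in> conditions" using down r p G_conditions by blast+
  then show "met K"
    using LeastI_ex[OF decision_stage_exists[of K]] assms(1) r(3)
    unfolding decision_stage_def[symmetric] met_def by blast
qed

lemma decidable_Mem:
  assumes "computable diagram f" "computable diagram g"
  shows "decidable diagram (\<lambda>x. f x \<in> Sets M \<and> g x \<in> Classes M \<and> Mem M (f x) (g x))"
proof -
  have "definable (Suc 0) (Suc 0) (\<lambda>xs ys. Mem M (xs ! 0) (ys ! 0))"
    by (intro definable_intros) simp_all
  from decidable_definable[OF this, of "[f]" "[g]"] assms show ?thesis by simp
qed

lemma decidable_met:
  assumes "computable diagram f" shows "decidable diagram (\<lambda>x. met (f x))"
proof (rule decidable_comp[OF _ assms])
  have "computable diagram decision_stage"
    unfolding decision_stage_def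
  proof (rule computable_Least[OF _ decision_stage_exists])
    have "definable (Suc 0) (Suc 0) (\<lambda>xs ys. Mem M (xs ! 0) (ys ! 0) \<or>
        \<not> (\<exists>q\<in>conditions. q \<preceq> xs ! 0 \<and> Mem M q (ys ! 0)))"
      by (intro definable_intros) simp_all
    from decidable_definable[OF this, of "[\<lambda>x. generic_seq (pfst x)]" "[psnd]"]
    have "decidable diagram (\<lambda>x. generic_seq (pfst x) \<in> Sets M \<and> psnd x \<in> Classes M \<and>
        (Mem M (generic_seq (pfst x)) (psnd x) \<or>
        \<not> (\<exists>q\<in>conditions. q \<preceq> generic_seq (pfst x) \<and> Mem M q (psnd x))))"
      by (simp add: computable_generic_seq computable_pfst_self computable_psnd_self)
    from decidable_imp[OF decidable_in_Classes[OF computable_psnd_self] this]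
    have "decidable diagram (\<lambda>x. psnd x \<in> Classes M \<longrightarrow>
        generic_seq (pfst x) \<in> Sets M \<and> psnd x \<in> Classes M \<and>
        (Mem M (generic_seq (pfst x)) (psnd x) \<or>
        \<not> (\<exists>q\<in>conditions. q \<preceq> generic_seq (pfst x) \<and> Mem M q (psnd x))))"
      .
    then show "decidable diagram (\<lambda>x. psnd x \<in> Classes M \<longrightarrow>
        Mem M (generic_seq (pfst x)) (psnd x) \<or>
        \<not> (\<exists>q\<in>conditions. q \<preceq> generic_seq (pfst x) \<and> Mem M q (psnd x)))"
      by (rule back_subst[of "decidable diagram"])
        (use conditions_Sets[OF generic_seq_condition] in auto)
  qed
  then have "decidable diagram (\<lambda>K. generic_seq (decision_stage K) \<in> Sets M \<and> K \<in> Classes M \<and>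
      Mem M (generic_seq (decision_stage K)) K)"
    by (intro decidable_Mem computable_generic_seq computable_id) simp
  then show "decidable diagram met"
    by (rule back_subst[of "decidable diagram"])
      (use conditions_Sets[OF generic_seq_condition] in \<open>auto simp: met_def\<close>)
qed

text \<open>The definition of \<open>G\<close> only gives an enumeration. However, a condition
  \<open>p\<close> belongs to \<open>G\<close> iff \<open>G\<close> meets the class of conditions
  below \<open>p\<close>, which is closed downwards.\<close>

lemma decidable_G: "decidable diagram (\<lambda>p. p \<in> G)"
proof -
  let ?Q = "\<lambda>z xs ys. z \<in> conditions \<and> z \<preceq> xs ! 0"
  have def_Q: "definable (Suc (Suc 0)) 0 (\<lambda>xs ys. ?Q (hd xs) (tl xs) ys)"
    by (intro definable_intros) simp_all
  have "computable diagram (\<lambda>p. compr ?Q [p] [])"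
    using computable_compr[OF def_Q, of "[\<lambda>x. x]" "[]"] by (simp add: computable_id)
  then have "decidable diagram (\<lambda>p. p \<in> conditions \<and> met (compr ?Q [p] []))"
    by (intro decidable_conj decidable_condition decidable_met computable_id)
  moreover have "p \<in> conditions \<and> met (compr ?Q [p] []) \<longleftrightarrow> p \<in> G" for p
  proof (cases "p \<in> conditions")
    case True
    have K: "compr ?Q [p] [] \<in> Classes M"
      "\<And>z. z \<in> Sets M \<Longrightarrow> Mem M z (compr ?Q [p] []) \<longleftrightarrow> z \<in> conditions \<and> z \<preceq> p"
      using compr[OF def_Q, of "[p]" "[]"] True conditions_Sets by auto
    have "met (compr ?Q [p] []) \<longleftrightarrow> (\<exists>q\<in>G. Mem M q (compr ?Q [p] []))"
      by (rule met_iff[OF K(1)]) (use K(2) conditions_Sets True le_trans in blast)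
    also have "\<dots> \<longleftrightarrow> (\<exists>q\<in>G. q \<preceq> p)" using K(2) G_conditions conditions_Sets by blast
    also have "\<dots> \<longleftrightarrow> p \<in> G"
      using True le_refl generic_G unfolding generic_filter_def filter_on_def by blast
    finally show ?thesis using True by simp
  qed (simp add: G_def)
  ultimately show ?thesis by simp
qed

section \<open>A presentation of the extension\<close>

definition eq_conditions_sets :: "nat \<Rightarrow> nat \<Rightarrow> nat" where
  "eq_conditions_sets x y = compr (\<lambda>z xs ys. z \<in> conditions \<and> related3 M E z (xs ! 0) (xs ! 1)) [x, y] []"

definition eq_conditions_classes :: "nat \<Rightarrow> nat \<Rightarrow> nat" where
  "eq_conditions_classes x y = compr (\<lambda>z xs ys. z \<in> conditions \<and> forces_eq z (ys ! 0) (ys ! 1)) [] [x, y]"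

lemma definable_eq_conditions_sets:
  "definable (Suc (Suc (Suc 0))) 0
    (\<lambda>xs ys. hd xs \<in> conditions \<and> related3 M E (hd xs) (tl xs ! 0) (tl xs ! 1))"
  by (intro definable_intros) simp_all

lemma definable_eq_conditions_classes:
  "definable (Suc 0) (Suc (Suc 0))
    (\<lambda>xs ys. hd xs \<in> conditions \<and> forces_eq (hd xs) (ys ! 0) (ys ! 1))"
  by (intro definable_intros) simp_all

lemma met_eq_conditions_sets:
  assumes "set_name M P x" "set_name M P y"
  shows "met (eq_conditions_sets x y) \<longleftrightarrow> set_val x = set_val y"
proof -
  have K: "eq_conditions_sets x y \<in> Classes M"
    "\<And>z. z \<in> Sets M \<Longrightarrow> Mem M z (eq_conditions_sets x y) \<longleftrightarrow> z \<in> conditions \<and> related3 M E z x y"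
    using compr[OF definable_eq_conditions_sets, of "[x, y]" "[]"] assms set_name_Sets
    unfolding eq_conditions_sets_def by auto
  have "met (eq_conditions_sets x y) \<longleftrightarrow> (\<exists>p\<in>G. Mem M p (eq_conditions_sets x y))"
    by (rule met_iff[OF K(1)]) (use K(2) conditions_Sets E_mono assms in blast)
  then show ?thesis
    unfolding set_val_eq_iff[OF assms] using K(2) G_conditions conditions_Sets by blast
qed

lemma met_eq_conditions_classes:
  assumes "class_name M P x" "class_name M P y"
  shows "met (eq_conditions_classes x y) \<longleftrightarrow> class_val x = class_val y"
proof -
  have K: "eq_conditions_classes x y \<in> Classes M"
    "\<And>z. z \<in> Sets M \<Longrightarrow> Mem M z (eq_conditions_classes x y) \<longleftrightarrow> z \<in> conditions \<and> forces_eq z x y"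
    using compr[OF definable_eq_conditions_classes, of "[]" "[x, y]"] assms
    unfolding eq_conditions_classes_def class_name_def by auto
  have "met (eq_conditions_classes x y) \<longleftrightarrow> (\<exists>p\<in>G. Mem M p (eq_conditions_classes x y))"
    by (rule met_iff[OF K(1)]) (use K(2) conditions_Sets forces_eq_mono in blast)
  then show ?thesis
    unfolding class_val_eq_iff[OF assms] using K(2) G_conditions conditions_Sets by blast
qed

lemma computable_eq_conditions_sets:
  "computable diagram f \<Longrightarrow> computable diagram g \<Longrightarrow> computable diagram (\<lambda>x. eq_conditions_sets (f x) (g x))"
  using computable_compr[OF definable_eq_conditions_sets, of "[f, g]" "[]"] unfolding eq_conditions_sets_def by simp

lemma computable_eq_conditions_classes:
  "computable diagram f \<Longrightarrow> computable diagram g \<Longrightarrow> computable diagram (\<lambda>x. eq_conditions_classes (f x) (g x))"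
  using computable_compr[OF definable_eq_conditions_classes, of "[]" "[f, g]"]
  unfolding eq_conditions_classes_def by simp

definition val :: "nat \<Rightarrow> nat set" where
  "val x = (if set_name M P x then set_val x else class_val x)"

lemma name_sort: "class_name M P x \<Longrightarrow> \<not> set_name M P x"
  using set_name_Sets sorts_disjoint unfolding class_name_def by blast

lemma val_Sets_iff: "name x \<Longrightarrow> val x \<in> Sets extension \<longleftrightarrow> set_name M P x"
  and val_Classes_iff: "name x \<Longrightarrow> val x \<in> Classes extension \<longleftrightarrow> class_name M P x"
  using extension_sorts_disjoint name_sort
  unfolding Sets_extension Classes_extension name_def val_def by auto

definition same_val :: "nat \<Rightarrow> nat \<Rightarrow> bool" where
  "same_val x y \<longleftrightarrow> (set_name M P x \<and> set_name M P y \<and> met (eq_conditions_sets x y)) \<or>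
     (class_name M P x \<and> class_name M P y \<and> met (eq_conditions_classes x y))"

lemma same_val_iff: "same_val x y \<longleftrightarrow> name x \<and> name y \<and> val x = val y"
proof (cases "name x \<and> name y \<and> (set_name M P x \<longleftrightarrow> set_name M P y)")
  case True
  then show ?thesis
    using met_eq_conditions_sets met_eq_conditions_classes name_sort
    unfolding same_val_def name_def val_def by auto
next
  case False
  then have "val x \<noteq> val y" if "name x" "name y"
    using val_Sets_iff[of x] val_Sets_iff[of y] that by auto
  then show ?thesis using False name_sort unfolding same_val_def name_def by auto
qed

definition reps :: "nat set" where
  "reps = {x. same_val x x \<and> (\<forall>y<x. \<not> same_val y x)}"

lemma reps_name: "x \<in> reps \<Longrightarrow> name x"
  unfolding reps_def same_val_iff by blast

lemma decidable_same_val: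
  assumes "computable diagram f" "computable diagram g"
  shows "decidable diagram (\<lambda>x. same_val (f x) (g x))"
  unfolding same_val_def by (intro computable_intros decidable_set_name decidable_class_name
      decidable_met computable_eq_conditions_sets computable_eq_conditions_classes assms)

lemma decidable_reps: "computable diagram f \<Longrightarrow> decidable diagram (\<lambda>x. f x \<in> reps)"
proof (rule decidable_comp[where P = "\<lambda>x. x \<in> reps"])
  show "decidable diagram (\<lambda>x. x \<in> reps)"
    unfolding reps_def mem_Collect_eq
    by (intro decidable_conj decidable_ball decidable_Not decidable_same_val computable_intros)
qed

lemma bij_val: "bij_betw val reps (dom2 extension)"
proof (rule bij_betwI')
  show "val x = val y \<longleftrightarrow> x = y" if "x \<in> reps" "y \<in> reps" for x y
    using that unfolding reps_def same_val_iff by (cases x y rule: linorder_cases) auto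
  show "val x \<in> dom2 extension" if "x \<in> reps" for x
    using val_Sets_iff[of x] val_Classes_iff[of x] reps_name[OF that] unfolding dom2_def name_def by blast
  show "\<exists>x\<in>reps. v = val x" if v: "v \<in> dom2 extension" for v
  proof -
    obtain y where y: "name y" "v = val y"
      using v name_sort unfolding dom2_def Sets_extension Classes_extension name_def val_def by force
    define x where "x = (LEAST x. same_val x y)"
    have "same_val x y" unfolding x_def using y same_val_iff by (intro LeastI) blast
    moreover have "\<not> same_val z y" if "z < x" for z
      using not_less_Least that unfolding x_def by blast
    ultimately have "x \<in> reps" "v = val x" using y(2) unfolding reps_def same_val_iff by auto
    then show ?thesis by blast
  qed
qed

lemma infinite_reps: "infinite reps"
  using bij_betw_finite[OF bij_val] infinite_extension unfolding dom2_def by simp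

definition rep :: "nat \<Rightarrow> nat" where "rep = enumerate reps"

lemma bij_rep: "bij_betw rep UNIV reps"
  unfolding rep_def by (rule bij_enumerate[OF infinite_reps])

lemma rep_name: "name (rep n)"
  using bij_rep reps_name unfolding bij_betw_def by blast

text \<open>The next representative is found by search, which halts because there are infinitely
  many.\<close>

lemma computable_rep: "computable diagram f \<Longrightarrow> computable diagram (\<lambda>x. rep (f x))"
proof -
  have "rep n = rec_nat (LEAST s. s \<in> reps) (\<lambda>n r. LEAST s. s \<in> reps \<and> r < s) n" for n
    by (induction n) (simp_all add: rep_def enumerate_0 enumerate_Suc''[OF infinite_reps])
  moreover assume "computable diagram f"
  then have "computable diagram (\<lambda>x. rec_nat (LEAST s. s \<in> reps) (\<lambda>n r. LEAST s. s \<in> reps \<and> r < s) (f x))"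
    by (intro computable_rec_nat[where h = "\<lambda>n r x. LEAST s. s \<in> reps \<and> r < s"] computable_Least
        decidable_reps computable_intros) (use infinite_reps in \<open>auto simp: infinite_nat_iff_unbounded\<close>)
  ultimately show ?thesis by simp
qed

text \<open>The extension transported along \<open>val (rep k)\<close>, so that the isomorphism
  holds by construction and only decidability of the diagram remains to be shown.\<close>

definition N :: "nat structure2" where
  "N = \<lparr>Sets = {k. set_name M P (rep k)}, Classes = {k. class_name M P (rep k)},
    Mem = (\<lambda>k l. Mem extension (val (rep k)) (val (rep l)))\<rparr>"

lemma N_simps [simp]:
  "Sets N = {k. set_name M P (rep k)}" "Classes N = {k. class_name M P (rep k)}"
  "Mem N k l \<longleftrightarrow> Mem extension (val (rep k)) (val (rep l))"
  by (simp_all add: N_def)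

lemma dom_N: "dom2 N = UNIV"
  using rep_name unfolding dom2_def name_def by auto

lemma on_omega_N: "on_omega N"
  using dom_N name_sort val_Sets_iff[OF rep_name] Mem_extension
  unfolding on_omega_def two_sorted_def by auto

lemma isomorphism_N:
  "bij_betw (\<lambda>k. val (rep k)) (dom2 N) (dom2 extension)"
  "(\<lambda>k. val (rep k)) ` Sets N = Sets extension"
  "(\<lambda>k. val (rep k)) ` Classes N = Classes extension"
  "\<forall>x\<in>dom2 N. \<forall>y\<in>dom2 N. Mem N x y \<longleftrightarrow> Mem extension (val (rep x)) (val (rep y))"
proof -
  show bij: "bij_betw (\<lambda>k. val (rep k)) (dom2 N) (dom2 extension)"
    using bij_betw_trans[OF bij_rep bij_val] unfolding dom_N comp_def .
  have onto: "\<exists>k. v = val (rep k)" if "v \<in> dom2 extension" for v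
    using bij that unfolding bij_betw_def dom_N by blast
  show "(\<lambda>k. val (rep k)) ` Sets N = Sets extension"
  proof
    show "Sets extension \<subseteq> (\<lambda>k. val (rep k)) ` Sets N"
      using val_Sets_iff[OF rep_name] onto unfolding dom2_def N_simps by blast
  qed (use val_Sets_iff[OF rep_name] in auto)
  show "(\<lambda>k. val (rep k)) ` Classes N = Classes extension"
  proof
    show "Classes extension \<subseteq> (\<lambda>k. val (rep k)) ` Classes N"
      using val_Classes_iff[OF rep_name] onto unfolding dom2_def N_simps by blast
  qed (use val_Classes_iff[OF rep_name] in auto)
qed simp

section \<open>Tuples of names and their projections\<close>

definition opair_code :: "nat \<Rightarrow> nat \<Rightarrow> nat" where
  "opair_code x t = (LEAST u. x \<in> Sets M \<and> t \<in> Sets M \<longrightarrow> is_opair M u x t)"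

lemma opair_code_exists: "\<exists>u. x \<in> Sets M \<and> t \<in> Sets M \<longrightarrow> is_opair M u x t"
  using opair_exists by blast

lemma opair_code: "x \<in> Sets M \<Longrightarrow> t \<in> Sets M \<Longrightarrow> is_opair M (opair_code x t) x t"
  using LeastI_ex[OF opair_code_exists] unfolding opair_code_def by blast

lemma computable_opair_code:
  assumes "computable diagram f" "computable diagram g"
  shows "computable diagram (\<lambda>x. opair_code (f x) (g x))"
proof (rule computable_comp2[OF _ assms])
  have "definable (Suc (Suc (Suc 0))) 0 (\<lambda>xs ys. is_opair M (xs ! 0) (xs ! 1) (xs ! 2))"
    by (intro definable_intros) simp_all
  from decidable_definable[OF this, of "[pfst, \<lambda>x. pfst (psnd x), \<lambda>x. psnd (psnd x)]" "[]"]
  have "decidable diagram (\<lambda>x. pfst x \<in> Sets M \<and> pfst (psnd x) \<in> Sets M \<and> psnd (psnd x) \<in> Sets M \<and>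
      is_opair M (pfst x) (pfst (psnd x)) (psnd (psnd x)))"
    by (simp add: computable_pfst_self computable_psnd_self computable_pfst computable_psnd numeral_2_eq_2)
  from decidable_imp[OF decidable_conj[OF decidable_in_Sets decidable_in_Sets] this,
      OF computable_pfst[OF computable_psnd_self] computable_psnd[OF computable_psnd_self]]
  have "decidable diagram (\<lambda>x. pfst (psnd x) \<in> Sets M \<and> psnd (psnd x) \<in> Sets M \<longrightarrow>
      is_opair M (pfst x) (pfst (psnd x)) (psnd (psnd x)))"
    by (rule back_subst[of "decidable diagram"]) (auto dest: opair_in_Sets)
  then show "computable diagram (\<lambda>z. opair_code (pfst z) (psnd z))"
    unfolding opair_code_def by (rule computable_Least[OF _ opair_code_exists])
qed

text \<open>Packs an assignment of any length into one set of the model. The entry for variable 0 is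
  outermost, so a quantifier adds one ordered pair in front, in accordance with the de Bruijn
  indices.\<close>

fun tuple :: "nat list \<Rightarrow> nat" where
  "tuple [] = start"
| "tuple (x # xs) = opair_code x (tuple xs)"

lemma tuple_Sets: "set xs \<subseteq> Sets M \<Longrightarrow> tuple xs \<in> Sets M"
  by (induction xs) (auto intro: opair_in_Sets opair_code conditions_Sets[OF start])

lemma tuple_Cons: "x \<in> Sets M \<Longrightarrow> set xs \<subseteq> Sets M \<Longrightarrow> is_opair M (tuple (x # xs)) x (tuple xs)"
  by (simp add: opair_code tuple_Sets)

text \<open>Recursion on the list code \<open>c\<close>: its tail has the smaller code
  \<open>psnd (c - 1)\<close>, whose tuple is looked up in the history.\<close>

lemma computable_tuple:
  assumes "computable diagram f"
  shows "computable diagram (\<lambda>x. tuple (map rep (list_decode (f x))))"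
proof (rule computable_course_of_values[where f = "\<lambda>c x. tuple (map rep (list_decode c))"
      and h = "\<lambda>c r x. if c = 0 then start
        else opair_code (rep (pfst (c - 1))) (code_nth r (c - Suc (psnd (c - 1))))"])
  show "computable diagram (\<lambda>z. if pfst z = 0 then start
      else opair_code (rep (pfst (pfst z - 1)))
        (code_nth (pfst (psnd z)) (pfst z - Suc (psnd (pfst z - 1)))))"
    by (intro computable_intros computable_opair_code computable_rep computable_code_nth)
  show "tuple (map rep (list_decode c)) = (if c = 0 then start
      else opair_code (rep (pfst (c - 1)))
        (code_nth (history (\<lambda>i. tuple (map rep (list_decode i))) c) (c - Suc (psnd (c - 1)))))" for c
  proof (cases c)
    case (Suc k)
    have "psnd (c - 1) < c" using psnd_le[of k] Suc by simp
    moreover have "list_decode c = pfst (c - 1) # list_decode (psnd (c - 1))"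
      unfolding Suc by (simp add: pfst_def psnd_def split: prod.split)
    moreover have "c \<noteq> 0" using Suc by simp
    ultimately show ?thesis by (simp only: history_nth list.map tuple.simps if_False)
  qed simp
qed (rule assms computable_id)+

text \<open>A projection is a class of pairs consisting of a tuple and one of its entries. Each is
  obtained from its predecessor by the same comprehension, which makes its number computable from
  the index; a variable of a formula can thus be treated as a class.\<close>

definition projection_base :: nat where
  "projection_base = compr2 (\<lambda>t x xs ys. \<exists>u\<in>Sets M. is_opair M t x u) [] []"

definition projection_step :: "nat \<Rightarrow> nat" where
  "projection_step R = compr2 (\<lambda>t x xs ys. \<exists>y\<in>Sets M. \<exists>u\<in>Sets M. is_opair M t y u \<and>
    related M (ys ! 0) u x) [] [R]"

definition projection :: "nat \<Rightarrow> nat" where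
  "projection i = rec_nat projection_base (\<lambda>_. projection_step) i"

lemma definable_projection_base:
  "definable (Suc (Suc (Suc 0))) 0 (\<lambda>xs ys. \<exists>u\<in>Sets M. is_opair M (hd (tl xs)) (hd xs) u)"
  by (intro definable_intros)

lemma definable_projection_step:
  "definable (Suc (Suc (Suc 0))) (Suc 0) (\<lambda>xs ys. \<exists>y\<in>Sets M. \<exists>u\<in>Sets M.
    is_opair M (hd (tl xs)) y u \<and> related M (ys ! 0) u (hd xs))"
  by (intro definable_intros) simp_all

lemma projection:
  "projection i \<in> Classes M"
  "i < length xs \<Longrightarrow> set xs \<subseteq> Sets M \<Longrightarrow> x \<in> Sets M \<Longrightarrow>
    related M (projection i) (tuple xs) x \<longleftrightarrow> x = xs ! i"
proof -
  have "projection i \<in> Classes M \<and> (\<forall>xs x. i < length xs \<and> set xs \<subseteq> Sets M \<and> x \<in> Sets M \<longrightarrow>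
    (related M (projection i) (tuple xs) x \<longleftrightarrow> x = xs ! i))"
  proof (induction i)
    case 0
    have base: "projection 0 \<in> Classes M" "\<And>t x. t \<in> Sets M \<Longrightarrow> x \<in> Sets M \<Longrightarrow>
        related M (projection 0) t x \<longleftrightarrow> (\<exists>u\<in>Sets M. is_opair M t x u)"
      using compr2[OF definable_projection_base, of "[]" "[]"]
      unfolding projection_def projection_base_def by auto
    have "related M (projection 0) (tuple (y # xs)) x \<longleftrightarrow> x = y"
      if "y \<in> Sets M" "set xs \<subseteq> Sets M" "x \<in> Sets M" for y xs x
      using base(2)[OF tuple_Sets that(3), of "y # xs"] tuple_Cons[OF that(1,2)] that tuple_Sets[OF that(2)]
        opair_inject[OF tuple_Cons[OF that(1,2)]] by auto
    then show ?case using base(1)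
      by (auto simp: neq_Nil_conv simp flip: length_greater_0_conv simp del: tuple.simps)
  next
    case (Suc i)
    have step: "projection (Suc i) \<in> Classes M" "\<And>t x. t \<in> Sets M \<Longrightarrow> x \<in> Sets M \<Longrightarrow>
        related M (projection (Suc i)) t x \<longleftrightarrow>
        (\<exists>y\<in>Sets M. \<exists>u\<in>Sets M. is_opair M t y u \<and> related M (projection i) u x)"
      using compr2[OF definable_projection_step, of "[]" "[projection i]"] Suc
      unfolding projection_def projection_step_def by auto
    have "related M (projection (Suc i)) (tuple (y # xs)) x \<longleftrightarrow> x = xs ! i"
      if "i < length xs" "y \<in> Sets M" "set xs \<subseteq> Sets M" "x \<in> Sets M" for y xs x
    proof -
      have "related M (projection (Suc i)) (tuple (y # xs)) x \<longleftrightarrow> related M (projection i) (tuple xs) x"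
        using step(2)[OF tuple_Sets that(4), of "y # xs"] tuple_Cons[OF that(2,3)] that tuple_Sets[OF that(3)]
          opair_inject[OF tuple_Cons[OF that(2,3)]] by auto
      then show ?thesis using Suc that by blast
    qed
    then show ?case using step(1) by (auto simp: Suc_less_eq2 length_Suc_conv simp del: tuple.simps)
  qed
  then show "projection i \<in> Classes M"
    "i < length xs \<Longrightarrow> set xs \<subseteq> Sets M \<Longrightarrow> x \<in> Sets M \<Longrightarrow>
      related M (projection i) (tuple xs) x \<longleftrightarrow> x = xs ! i"
    by blast+
qed

lemma computable_projection_step:
  "computable diagram f \<Longrightarrow> computable diagram (\<lambda>x. projection_step (f x))"
  using computable_compr2[OF definable_projection_step, of "[]" "[f]"]
  unfolding projection_step_def by simp

lemma computable_projection: "computable diagram f \<Longrightarrow> computable diagram (\<lambda>x. projection (f x))"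
  unfolding projection_def
  by (intro computable_rec_nat[where h = "\<lambda>n r x. projection_step r"] computable_projection_step
      computable_intros)

section \<open>Deciding truth in the extension\<close>

text \<open>The forcing clause for the outermost symbol, indexed by its tag in \<^const>\<open>fm_code\<close>. The
  classes \<open>A\<close> and \<open>B\<close> represent the immediate constituents: projections for set variables,
  class names for class variables, and the forcing classes of the subformulas.\<close>

definition clause :: "nat \<Rightarrow> nat \<Rightarrow> nat \<Rightarrow> nat \<Rightarrow> nat \<Rightarrow> bool" where
  "clause k p t A B \<longleftrightarrow>
    (if k = 0 then p \<in> conditions \<and> (\<exists>x\<in>Sets M. \<exists>y\<in>Sets M. related M A t x \<and> related M B t y \<and>
       related3 M E p x y)
     else if k = 1 then p \<in> conditions \<and> forces_eq p A B
     else if k = 2 then p \<in> conditions \<and> (\<exists>x\<in>Sets M. \<exists>y\<in>Sets M. related M A t x \<and> related M B t y \<and>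
       forces_mem p x y)
     else if k = 3 then p \<in> conditions \<and> (\<exists>x\<in>Sets M. related M A t x \<and> forces_mem p x B)
     else if k = 4 then p \<in> conditions \<and> \<not> (\<exists>q\<in>conditions. q \<preceq> p \<and> related M A q t)
     else if k = 5 then related M A p t \<and> related M B p t
     else (\<exists>\<sigma>\<in>Sets M. set_name M P \<sigma> \<and> (\<exists>u\<in>Sets M. is_opair M u \<sigma> t \<and> related M A p u)))"

text \<open>The tag is a fixed number outside the formula, so the case distinction selects among
  seven formulas and does not enter any of them.\<close>

lemma definable_clause:
  "definable (Suc (Suc (Suc 0))) (Suc (Suc 0))
    (\<lambda>xs ys. clause k (hd (tl xs)) (hd xs) (ys ! 0) (ys ! 1))"
proof -
  consider "k = 0" | "k = 1" | "k = 2" | "k = 3" | "k = 4" | "k = 5" | "k \<ge> 6" by linarith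
  then show ?thesis
  proof cases
    case 1
    then show ?thesis unfolding clause_def by simp (intro definable_intros; simp)
  next
    case 2
    then show ?thesis unfolding clause_def by simp (intro definable_intros; simp)
  next
    case 3
    then show ?thesis unfolding clause_def by simp (intro definable_intros; simp)
  next
    case 4
    then show ?thesis unfolding clause_def by simp (intro definable_intros; simp)
  next
    case 5
    then show ?thesis unfolding clause_def by simp (intro definable_intros; simp)
  next
    case 6
    then show ?thesis unfolding clause_def by simp (intro definable_intros; simp)
  next
    case 7
    then show ?thesis unfolding clause_def by simp (intro definable_intros; simp)
  qed
qed

definition clause_class :: "nat \<Rightarrow> nat \<Rightarrow> nat \<Rightarrow> nat" where
  "clause_class k A B = compr2 (\<lambda>p t xs ys. clause k p t (ys ! 0) (ys ! 1)) [] [A, B]"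

lemma clause_class:
  assumes "A \<in> Classes M" "B \<in> Classes M"
  shows "clause_class k A B \<in> Classes M"
    "p \<in> Sets M \<Longrightarrow> t \<in> Sets M \<Longrightarrow> related M (clause_class k A B) p t \<longleftrightarrow> clause k p t A B"
  using compr2[OF definable_clause, of "[]" "[A, B]"] assms unfolding clause_class_def by auto

lemma computable_clause_class:
  "computable diagram f \<Longrightarrow> computable diagram g \<Longrightarrow> computable diagram (\<lambda>x. clause_class k (f x) (g x))"
  using computable_compr2[OF definable_clause, of "[]" "[f, g]"] unfolding clause_class_def by simp

text \<open>Defined on all numbers, as a total function has to be; \<open>y\<close> codes the list
  of class parameters. All tags above 5, including that of \<open>ExC\<close>, fall into the last
  branch, and codes of formulas with class quantifiers are rejected later by
  \<open>well_formed\<close>. A formula with one immediate subformula passes its class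
  twice.\<close>

function formula_class :: "nat \<Rightarrow> nat \<Rightarrow> nat" where
  "formula_class c y =
    (if pfst c = 0 then clause_class 0 (projection (pfst (psnd c))) (projection (psnd (psnd c)))
     else if pfst c = 1 then
       clause_class 1 (rep (code_nth y (pfst (psnd c)))) (rep (code_nth y (psnd (psnd c))))
     else if pfst c = 2 then clause_class 2 (projection (pfst (psnd c))) (projection (psnd (psnd c)))
     else if pfst c = 3 then
       clause_class 3 (projection (pfst (psnd c))) (rep (code_nth y (psnd (psnd c))))
     else if pfst c = 4 then clause_class 4 (formula_class (psnd c) y) (formula_class (psnd c) y)
     else if pfst c = 5 then
       clause_class 5 (formula_class (pfst (psnd c)) y) (formula_class (psnd (psnd c)) y)
     else clause_class 6 (formula_class (psnd c) y) (formula_class (psnd c) y))"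
  by pat_completeness auto
termination
  by (relation "measure fst")
    (auto intro: psnd_less le_less_trans[OF pfst_le psnd_less] le_less_trans[OF psnd_le psnd_less])

declare formula_class.simps [simp del]

lemma computable_formula_class:
  assumes "computable diagram f" "computable diagram g"
  shows "computable diagram (\<lambda>x. formula_class (f x) (g x))"
proof (rule computable_course_of_values[OF _ _ assms])
  \<comment> \<open>Looks up the value at the smaller code \<open>d\<close> in the reversed history
    \<open>r\<close> of length \<open>c\<close>.\<close>
  let ?r = "\<lambda>r c d. code_nth r (c - Suc d)"
  let ?h = "\<lambda>c r y.
    (if pfst c = 0 then clause_class 0 (projection (pfst (psnd c))) (projection (psnd (psnd c)))
     else if pfst c = 1 then
       clause_class 1 (rep (code_nth y (pfst (psnd c)))) (rep (code_nth y (psnd (psnd c))))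
     else if pfst c = 2 then clause_class 2 (projection (pfst (psnd c))) (projection (psnd (psnd c)))
     else if pfst c = 3 then
       clause_class 3 (projection (pfst (psnd c))) (rep (code_nth y (psnd (psnd c))))
     else if pfst c = 4 then clause_class 4 (?r r c (psnd c)) (?r r c (psnd c))
     else if pfst c = 5 then clause_class 5 (?r r c (pfst (psnd c))) (?r r c (psnd (psnd c)))
     else clause_class 6 (?r r c (psnd c)) (?r r c (psnd c)))"
  show "computable diagram (\<lambda>z. ?h (pfst z) (pfst (psnd z)) (psnd (psnd z)))"
    by (intro computable_intros computable_clause_class computable_projection computable_rep
        computable_code_nth)
  show "formula_class c y = ?h c (history (\<lambda>i. formula_class i y) c) y" for c y
  \<comment> \<open>A lookup is correct only at numbers below \<open>c\<close>, which
    \<open>psnd_less\<close> guarantees for a positive tag; with tag 0 nothing is looked up.\<close>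
  proof (cases "pfst c = 0")
    case False
    then have "psnd c < c" using psnd_less by simp
    then have "pfst (psnd c) < c" "psnd (psnd c) < c"
      using pfst_le[of "psnd c"] psnd_le[of "psnd c"] by simp_all
    with \<open>psnd c < c\<close> show ?thesis
      by (subst formula_class.simps) (simp only: history_nth)
  next
    case True
    then show ?thesis by (subst formula_class.simps) (simp only: if_True refl)
  qed
qed

text \<open>The number \<open>m\<close> of set variables varies in the induction, because a set
  quantifier lengthens the assignment; the class parameters stay fixed, as there are no class
  quantifiers.\<close>

lemma formula_class:
  assumes "delta10 \<phi>" "fits \<phi> m (length ys)" "\<forall>y\<in>set ys. class_name M P (rep y)"
  shows "formula_class (fm_code \<phi>) (list_encode ys) \<in> Classes M \<and>
    (\<forall>xs p. length xs = m \<and> set xs \<subseteq> Sets M \<and> p \<in> Sets M \<longrightarrow>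
      (related M (formula_class (fm_code \<phi>) (list_encode ys)) p (tuple xs) \<longleftrightarrow>
       forces \<phi> (map rep ys) p xs))"
  using assms(1,2)
proof (induction \<phi> arbitrary: m)
  case (EqS i j)
  have "formula_class (fm_code (EqS i j)) (list_encode ys) = clause_class 0 (projection i) (projection j)"
    by (subst formula_class.simps) simp
  then show ?case
    using EqS by (auto simp: clause_class projection tuple_Sets clause_def)
next
  case (EqC i j)
  have "formula_class (fm_code (EqC i j)) (list_encode ys) = clause_class 1 (rep (ys ! i)) (rep (ys ! j))"
    using EqC by (subst formula_class.simps) simp
  moreover have "rep (ys ! i) \<in> Classes M" "rep (ys ! j) \<in> Classes M"
    using EqC assms(3) unfolding class_name_def by auto
  ultimately show ?case
    using EqC by (auto simp: clause_class tuple_Sets clause_def)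
next
  case (InS i j)
  have "formula_class (fm_code (InS i j)) (list_encode ys) = clause_class 2 (projection i) (projection j)"
    by (subst formula_class.simps) simp
  then show ?case
    using InS by (auto simp: clause_class projection tuple_Sets clause_def)
next
  case (InC i j)
  have "formula_class (fm_code (InC i j)) (list_encode ys) = clause_class 3 (projection i) (rep (ys ! j))"
    using InC by (subst formula_class.simps) simp
  moreover have "rep (ys ! j) \<in> Classes M"
    using InC assms(3) unfolding class_name_def by auto
  ultimately show ?case
    using InC by (auto simp: clause_class projection tuple_Sets clause_def)
next
  case (Neg \<phi>)
  let ?F = "formula_class (fm_code \<phi>) (list_encode ys)"
  have "formula_class (fm_code (Neg \<phi>)) (list_encode ys) = clause_class 4 ?F ?F"
    by (subst formula_class.simps) simp
  moreover note IH = Neg.IH[of m] Neg.prems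
  ultimately show ?case
    using IH conditions_Sets by (simp add: clause_class tuple_Sets clause_def)
next
  case (And \<phi> \<psi>)
  let ?F = "formula_class (fm_code \<phi>) (list_encode ys)" and ?F' = "formula_class (fm_code \<psi>) (list_encode ys)"
  have "formula_class (fm_code (And \<phi> \<psi>)) (list_encode ys) = clause_class 5 ?F ?F'"
    by (subst formula_class.simps) simp
  then show ?case
    using And.IH[of m] And.prems by (simp add: clause_class tuple_Sets clause_def)
next
  case (ExS \<phi>)
  let ?F = "formula_class (fm_code \<phi>) (list_encode ys)"
  have eq: "formula_class (fm_code (ExS \<phi>)) (list_encode ys) = clause_class 6 ?F ?F"
    by (subst formula_class.simps) simp
  have F: "?F \<in> Classes M" and IH: "\<And>x xs p. length xs = m \<Longrightarrow> x \<in> Sets M \<Longrightarrow> set xs \<subseteq> Sets M \<Longrightarrow> p \<in> Sets M \<Longrightarrow>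
      related M ?F p (tuple (x # xs)) \<longleftrightarrow> forces \<phi> (map rep ys) p (x # xs)"
    using ExS.IH[of "Suc m"] ExS.prems by (simp_all del: tuple.simps)
  have "related M (clause_class 6 ?F ?F) p (tuple xs) \<longleftrightarrow> forces (ExS \<phi>) (map rep ys) p xs"
    if h: "length xs = m" "set xs \<subseteq> Sets M" "p \<in> Sets M" for xs p
  proof -
    \<comment> \<open>Ordered pairs are unique, so \<open>u\<close> can only be the tuple of the
      assignment with \<open>\<sigma>\<close> put in front.\<close>
    have "(\<exists>u\<in>Sets M. is_opair M u \<sigma> (tuple xs) \<and> related M ?F p u) \<longleftrightarrow> forces \<phi> (map rep ys) p (\<sigma> # xs)"
      if "\<sigma> \<in> Sets M" for \<sigma>
      using tuple_Cons[OF that h(2)] opair_unique opair_in_Sets IH[OF h(1) that h(2,3)] by blast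
    then show ?thesis
      using h by (simp add: clause_class F tuple_Sets clause_def)
  qed
  then show ?case unfolding eq using clause_class(1)[OF F F] by blast
qed simp

text \<open>The section of a forcing class at one tuple: the conditions forcing the formula under
  that assignment, a class to which \<open>met\<close> can be applied.\<close>

definition value_class :: "nat \<Rightarrow> nat \<Rightarrow> nat" where
  "value_class t F = compr (\<lambda>z xs ys. related M (ys ! 0) z (xs ! 0)) [t] [F]"

lemma definable_value_class:
  "definable (Suc (Suc 0)) (Suc 0) (\<lambda>xs ys. related M (ys ! 0) (hd xs) (tl xs ! 0))"
  by (intro definable_intros) simp_all

lemma value_class:
  assumes "t \<in> Sets M" "F \<in> Classes M"
  shows "value_class t F \<in> Classes M"
    "z \<in> Sets M \<Longrightarrow> Mem M z (value_class t F) \<longleftrightarrow> related M F z t"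
  using compr[OF definable_value_class, of "[t]" "[F]"] assms unfolding value_class_def by auto

lemma computable_value_class:
  "computable diagram f \<Longrightarrow> computable diagram g \<Longrightarrow> computable diagram (\<lambda>x. value_class (f x) (g x))"
  using computable_compr[OF definable_value_class, of "[f]" "[g]"] unfolding value_class_def by simp

text \<open>Truth moves along the isomorphism to the extension, where it is forced by some member of
  \<open>G\<close>. For fixed names the forcing conditions are closed downwards, so
  \<open>met\<close> detects such a member.\<close>

lemma sat_N_iff:
  assumes \<phi>: "delta10 \<phi>" "fits \<phi> (length xs) (length ys)"
    and xs: "set xs \<subseteq> Sets N" and ys: "set ys \<subseteq> Classes N"
  shows "sat N \<phi> xs ys \<longleftrightarrow>
    met (value_class (tuple (map rep xs)) (formula_class (fm_code \<phi>) (list_encode ys)))"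
proof -
  let ?F = "formula_class (fm_code \<phi>) (list_encode ys)"
  let ?K = "value_class (tuple (map rep xs)) ?F"
  have names: "names_for (map rep xs) (map rep ys)" using xs ys unfolding names_for_def by auto
  have fits: "fits \<phi> (length (map rep xs)) (length (map rep ys))" using \<phi>(2) by simp
  have sets: "set (map rep xs) \<subseteq> Sets M" using xs set_name_Sets by auto
  have F: "?F \<in> Classes M" "\<And>p. p \<in> Sets M \<Longrightarrow> related M ?F p (tuple (map rep xs)) \<longleftrightarrow>
      forces \<phi> (map rep ys) p (map rep xs)"
    using formula_class[OF \<phi>, THEN conjunct1]
      formula_class[OF \<phi>, THEN conjunct2, THEN spec, of "map rep xs"] ys sets by auto
  have K: "?K \<in> Classes M" "\<And>p. p \<in> Sets M \<Longrightarrow> Mem M p ?K \<longleftrightarrow> forces \<phi> (map rep ys) p (map rep xs)"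
    using value_class[OF tuple_Sets[OF sets] F(1)] F(2) by auto
  have "map (\<lambda>k. val (rep k)) xs = map set_val (map rep xs)"
    "map (\<lambda>k. val (rep k)) ys = map class_val (map rep ys)"
    using xs ys name_sort unfolding val_def by auto
  then have "sat N \<phi> xs ys \<longleftrightarrow> sat extension \<phi> (map set_val (map rep xs)) (map class_val (map rep ys))"
    using sat_isomorphic[OF isomorphism_N xs ys \<phi>(2)] by (simp only:)
  also have "\<dots> \<longleftrightarrow> (\<exists>p\<in>G. forces \<phi> (map rep ys) p (map rep xs))"
    by (rule truth[OF \<phi>(1) fits names])
  also have "\<dots> \<longleftrightarrow> (\<exists>p\<in>G. Mem M p ?K)" using K(2) G_conditions conditions_Sets by blast
  also have "\<dots> \<longleftrightarrow> met ?K"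
  proof (rule met_iff[OF K(1), symmetric])
    fix p q assume "p \<in> conditions" "q \<in> conditions" "q \<preceq> p" "Mem M p ?K"
    then show "Mem M q ?K" using K(2) conditions_Sets forces_mono[OF _ _ _ fits names] by blast
  qed
  finally show ?thesis .
qed

text \<open>The oracle itself recognises codes of formulas, by means of the tautology \<open>\<not> (\<phi> \<and> \<not> \<phi>)\<close>.\<close>

definition well_formed :: "nat \<Rightarrow> nat \<Rightarrow> nat \<Rightarrow> bool" where
  "well_formed c m n \<longleftrightarrow> prod_encode (prod_encode (4, prod_encode (5, prod_encode (c, prod_encode (4, c)))),
     prod_encode (list_encode (replicate m start), list_encode (replicate n P))) \<in> diagram"

text \<open>The tags 4 and 5 are those of \<open>Neg\<close> and \<open>And\<close>, so any formula
  with the queried code has a first conjunct coded by \<open>c\<close>. The copies of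
  \<open>start\<close> and \<open>P\<close> only provide parameters of the right sorts and numbers;
  the formula is true whatever they are.\<close>

lemma well_formed_iff: "well_formed c m n \<longleftrightarrow> (\<exists>\<phi>. c = fm_code \<phi> \<and> delta10 \<phi> \<and> fits \<phi> m n)"
proof
  assume "\<exists>\<phi>. c = fm_code \<phi> \<and> delta10 \<phi> \<and> fits \<phi> m n"
  then obtain \<phi> where \<phi>: "c = fm_code \<phi>" "delta10 \<phi>" "fits \<phi> m n" by blast
  have "prod_encode (fm_code (Neg (And \<phi> (Neg \<phi>))),
      prod_encode (list_encode (replicate m start), list_encode (replicate n P))) \<in> diagram"
    unfolding delta10_diagram_iff using \<phi> params conditions_Sets[OF start] by auto
  then show "well_formed c m n" unfolding well_formed_def \<phi>(1) by simp
next
  assume "well_formed c m n"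
  then obtain \<psi> xs ys where \<psi>: "delta10 \<psi>" "fits \<psi> (length xs) (length ys)"
    "fm_code \<psi> = prod_encode (4, prod_encode (5, prod_encode (c, prod_encode (4, c))))"
    "xs = replicate m start" "ys = replicate n P"
    unfolding well_formed_def delta10_diagram_def by auto
  then obtain \<psi>1 where "\<psi> = Neg \<psi>1" "fm_code \<psi>1 = prod_encode (5, prod_encode (c, prod_encode (4, c)))"
    by (cases \<psi>) auto
  moreover then obtain \<phi> \<phi>' where "\<psi>1 = And \<phi> \<phi>'" "c = fm_code \<phi>"
    by (cases \<psi>1) auto
  ultimately show "\<exists>\<phi>. c = fm_code \<phi> \<and> delta10 \<phi> \<and> fits \<phi> m n" using \<psi> by auto
qed

lemma diagram_N_iff:
  "n \<in> delta10_diagram N \<longleftrightarrow>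
    well_formed (pfst n) (code_length (pfst (psnd n))) (code_length (psnd (psnd n))) \<and>
    (\<forall>i<code_length (pfst (psnd n)). set_name M P (rep (code_nth (pfst (psnd n)) i))) \<and>
    (\<forall>i<code_length (psnd (psnd n)). class_name M P (rep (code_nth (psnd (psnd n)) i))) \<and>
    met (value_class (tuple (map rep (list_decode (pfst (psnd n)))))
      (formula_class (pfst n) (psnd (psnd n))))"
proof -
  \<comment> \<open>Pairing and list coding are onto, so every number splits into a possible formula
    code and two lists.\<close>
  define c xs ys where "c = pfst n"
    and "xs = list_decode (pfst (psnd n))" and "ys = list_decode (psnd (psnd n))"
  have n: "n = prod_encode (c, prod_encode (list_encode xs, list_encode ys))"
    by (simp add: c_def xs_def ys_def)
  have "n \<in> delta10_diagram N \<longleftrightarrow> (\<exists>\<phi>. c = fm_code \<phi> \<and> delta10 \<phi> \<and> fits \<phi> (length xs) (length ys) \<and>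
      set xs \<subseteq> Sets N \<and> set ys \<subseteq> Classes N \<and> sat N \<phi> xs ys)"
    unfolding n delta10_diagram_def by auto
  also have "\<dots> \<longleftrightarrow> (\<exists>\<phi>. c = fm_code \<phi> \<and> delta10 \<phi> \<and> fits \<phi> (length xs) (length ys)) \<and>
      set xs \<subseteq> Sets N \<and> set ys \<subseteq> Classes N \<and>
      met (value_class (tuple (map rep xs)) (formula_class c (list_encode ys)))"
    using sat_N_iff by blast
  also have "\<dots> \<longleftrightarrow> well_formed c (length xs) (length ys) \<and>
      (\<forall>i<length xs. set_name M P (rep (xs ! i))) \<and> (\<forall>i<length ys. class_name M P (rep (ys ! i))) \<and>
      met (value_class (tuple (map rep xs)) (formula_class c (list_encode ys)))"
    unfolding well_formed_iff N_simps subset_eq all_set_conv_all_nth mem_Collect_eq ..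
  finally show ?thesis unfolding n by simp
qed

lemma decidable_diagram_N: "decidable diagram (\<lambda>n. n \<in> delta10_diagram N)"
proof -
  have "decidable diagram (\<lambda>x. well_formed (f x) (g x) (h x))"
    if "computable diagram f" "computable diagram g" "computable diagram h" for f g h
    unfolding well_formed_def
    by (intro computable_oracle computable_pair computable_const computable_code_replicate that)
  moreover have "decidable diagram (\<lambda>n. \<forall>i<code_length (pfst (psnd n)).
      set_name M P (rep (code_nth (pfst (psnd n)) i)))"
    by (intro decidable_ball decidable_set_name computable_rep computable_code_nth computable_code_length
        computable_intros)
  moreover have "decidable diagram (\<lambda>n. \<forall>i<code_length (psnd (psnd n)).
      class_name M P (rep (code_nth (psnd (psnd n)) i)))"
    by (intro decidable_ball decidable_class_name computable_rep computable_code_nth computable_code_length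
        computable_intros)
  moreover have "decidable diagram (\<lambda>n. met (value_class (tuple (map rep (list_decode (pfst (psnd n)))))
      (formula_class (pfst n) (psnd (psnd n)))))"
    by (intro decidable_met computable_value_class computable_tuple computable_formula_class computable_intros)
  ultimately show ?thesis
    unfolding diagram_N_iff by (intro decidable_conj) (simp_all add: computable_code_length computable_intros)
qed

end

lemma decidable_imp_decides: "decidable A (\<lambda>n. n \<in> B) \<Longrightarrow> \<exists>e. decides A e B"
  unfolding decidable_def computable_def decides_def of_bool_def .

theorem theorem6p2:
  fixes M :: "nat structure2" and P L E I :: nat
  assumes "GB_model M" and "on_omega M"
    and "class_forcing_notion M P L"
    and "atomic_forcing_relation M P L E I"
  shows "\<exists>G N e\<^sub>G e\<^sub>N.
    generic_filter M P L G \<and>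
    decides (delta10_diagram M) e\<^sub>G G \<and>
    on_omega N \<and> isomorphic2 N (forcing_extension M P L E I G) \<and>
    decides (delta10_diagram M) e\<^sub>N (delta10_diagram N)"
proof -
  interpret forcing_omega M P L E I
    using assms by unfold_locales
  have "isomorphic2 N extension" unfolding isomorphic2_def using isomorphism_N by blast
  then show ?thesis
    using generic_G on_omega_N decidable_imp_decides[OF decidable_G]
      decidable_imp_decides[OF decidable_diagram_N]
    by blast
qed

end
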